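(* Let $G\rightrightarrows Q$ be a Lie groupoid with source $\alpha$, target $\beta$ and Lie algebroid $\tau\colon AG\to Q$. If $\mathcal R\colon AG\to G$ is a generalized discretization map on $G$, then the tangent map $T\mathcal R\colon T(AG)\to TG$ is a generalized discretization map on the tangent Lie groupoid $TG\rightrightarrows TQ$ (with source $T\alpha$ and target $T\beta$).
   Context: Conventions: for a Lie groupoid $G\rightrightarrows Q$ with source $\alpha$, target $\beta$ and identity section $\epsilon\colon Q\to G$, the product $gh$ is defined when $\beta(g)=\alpha(h)$. The Lie algebroid $\tau\colon AG\to Q$ has fibers $A_qG=\ker T_{\epsilon(q)}\alpha\subset T_{\epsilon(q)}G$. Let $0_{AG}\colon Q\to AG$ be the zero section, and for $v_q\in A_qG$ let $(v_q)^{\mathtt v}_{0_{AG}(q)}=\frac{d}{dt}\big|_{t=0}(tv_q)\in T_{0_{AG}(q)}(A_qG)$ be the vertical lift. A smooth map $\mathcal R\colon AG\to G$ is a generalized discretization map on $G$ if: (1) $\mathcal R\circ 0_{AG}=\epsilon$; (2) writing $\mathcal R_q=\mathcal R|_{A_qG}$, $$\left(T_{0_{AG}(q)}\mathcal R_q\right)\left((v_q)^{\mathtt v}_{0_{AG}(q)}\right)=v_q+\left[T_q\epsilon\circ T_{\epsilon(q)}\alpha\circ T_{0_{AG}(q)}\mathcal R_q\right]\left((v_q)^{\mathtt v}_{0_{AG}(q)}\right)$$ for all $q\in Q$ and $v_q\in A_qG$. The tangent Lie groupoid $TG\rightrightarrows TQ$ has as structural maps the tangent maps of the structural maps of $G$;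 in particular its identity section is $T\epsilon\colon TQ\to TG$. Its Lie algebroid $A(TG)\to TQ$ is identified with the vector bundle $T\tau\colon T(AG)\to TQ$ (whose zero section is $T0_{AG}$) by the canonical isomorphism $T(AG)\to A(TG)$ obtained by restricting the canonical involution $\kappa_G\colon TTG\to TTG$. In coordinates $(q^i,u^\gamma)$ on $G$ with $\alpha(q,u)=q$, $\epsilon(q)=(q,0)$, and induced fibre coordinates $(q^i,y^\gamma)$ on $AG$, the point $(q,y;\dot q,\dot y)\in T(AG)$ corresponds to the vector $y^\gamma\partial_{u^\gamma}+\dot y^\gamma\partial_{\dot u^\gamma}$ at $(q,0;\dot q,0)\in TG$. The condition of being a generalized discretization map on $TG\rightrightarrows TQ$ is understood with this identification. *)

theory Defs
  imports "HOL-Analysis.Analysis"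
begin

section \<open>Model spaces and smooth maps between them\<close>

text \<open>Model spaces of manifolds are finite-dimensional inner product spaces. The class
  \<^class>\<open>euclidean_space\<close> is not used because it excludes dimension 0, and hence Lie groups
  (Lie groupoids over a point).\<close>

class fd_inner = real_inner +
  assumes finite_spanning: "\<exists>B. finite B \<and> (\<forall>x :: 'a. \<exists>c. x = (\<Sum>b\<in>B. c b *\<^sub>R b))"

instance euclidean_space \<subseteq> fd_inner
proof
  have "\<forall>x :: 'a. \<exists>c. x = (\<Sum>b\<in>Basis. c b *\<^sub>R b)"
    by (metis euclidean_representation)
  then show "\<exists>B. finite B \<and> (\<forall>x :: 'a. \<exists>c. x = (\<Sum>b\<in>B. c b *\<^sub>R b))"
    using finite_Basis by blast
qed

lemma fd_inner_span: "\<exists>B. finite B \<and> span B = (UNIV :: 'a::fd_inner set)"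
proof -
  obtain B :: "'a set" where B: "finite B" "\<And>x. \<exists>c. x = (\<Sum>b\<in>B. c b *\<^sub>R b)"
    using finite_spanning by blast
  have "x \<in> span B" for x
  proof -
    obtain c where "x = (\<Sum>b\<in>B. c b *\<^sub>R b)" using B(2) by blast
    then show ?thesis by (simp add: span_base span_scale span_sum)
  qed
  then show ?thesis using B(1) by blast
qed

instance prod :: (fd_inner, fd_inner) fd_inner
proof
  obtain B :: "'a set" where B: "finite B" "span B = UNIV" using fd_inner_span by blast
  obtain C :: "'b set" where C: "finite C" "span C = UNIV" using fd_inner_span by blast
  let ?D = "(\<lambda>x. (x, 0)) ` B \<union> (\<lambda>y. (0, y)) ` C"
  have l1: "linear (\<lambda>x :: 'a. (x, 0 :: 'b))" and l2: "linear (\<lambda>y :: 'b. (0 :: 'a, y))"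
    by (auto intro!: linearI)
  have 1: "(x, 0) \<in> span ?D" for x :: 'a
  proof -
    have "(x, 0) \<in> span ((\<lambda>x. (x, 0 :: 'b)) ` B)"
      using linear_span_image[OF l1, of B] B by auto
    then show ?thesis using span_mono[of _ ?D] by blast
  qed
  have 2: "(0, y) \<in> span ?D" for y :: 'b
  proof -
    have "(0, y) \<in> span ((\<lambda>y. (0 :: 'a, y)) ` C)"
      using linear_span_image[OF l2, of C] C by auto
    then show ?thesis using span_mono[of _ ?D] by blast
  qed
  have "z \<in> span ?D" for z :: "'a \<times> 'b"
    using span_add[OF 1[of "fst z"] 2[of "snd z"]] by simp
  moreover have fin: "finite ?D" using B C by simp
  ultimately have "\<forall>z :: 'a \<times> 'b. \<exists>c. z = (\<Sum>d\<in>?D. c d *\<^sub>R d)"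
    unfolding span_finite[OF fin] by blast
  then show "\<exists>D. finite D \<and> (\<forall>z :: 'a \<times> 'b. \<exists>c. z = (\<Sum>d\<in>D. c d *\<^sub>R d))"
    using fin by blast
qed

text \<open>In finite dimensions, a map on an open set is $C^{n+1}$ iff it is differentiable and all its
  directional derivatives are $C^n$.\<close>

fun Ck_on :: "nat \<Rightarrow> 'a::real_normed_vector set \<Rightarrow> ('a \<Rightarrow> 'b::real_normed_vector) \<Rightarrow> bool" where
  "Ck_on 0 S f \<longleftrightarrow> continuous_on S f"
| "Ck_on (Suc n) S f \<longleftrightarrow> (\<forall>x\<in>S. f differentiable (at x)) \<and>
     (\<forall>v. Ck_on n S (\<lambda>x. frechet_derivative f (at x) v))"

definition smooth_on :: "'a::real_normed_vector set \<Rightarrow> ('a \<Rightarrow> 'b::real_normed_vector) \<Rightarrow> bool" where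
  "smooth_on S f \<longleftrightarrow> (\<forall>n. Ck_on n S f)"


section \<open>Smooth manifolds\<close>

text \<open>A manifold is given by an atlas, not necessarily maximal. A chart is a domain together with a
  coordinate map, whose values outside the domain are irrelevant.\<close>

type_synonym ('a, 'e) chart = "'a set \<times> ('a \<Rightarrow> 'e)"
type_synonym ('a, 'e) atlas = "('a, 'e) chart set"

definition carrier :: "('a, 'e) atlas \<Rightarrow> 'a set" where
  "carrier M = \<Union> (fst ` M)"

definition manifold_topology :: "('a, 'e::topological_space) atlas \<Rightarrow> 'a topology" where
  "manifold_topology M =
     topology (\<lambda>W. W \<subseteq> carrier M \<and> (\<forall>(U, \<phi>)\<in>M. open (\<phi> ` (W \<inter> U))))"

definition second_countable_space :: "'a topology \<Rightarrow> bool" where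
  "second_countable_space X \<longleftrightarrow>
     (\<exists>\<B>. countable \<B> \<and> (\<forall>V\<in>\<B>. openin X V) \<and>
          (\<forall>W x. openin X W \<and> x \<in> W \<longrightarrow> (\<exists>V\<in>\<B>. x \<in> V \<and> V \<subseteq> W)))"

definition smooth_manifold :: "('a, 'e::fd_inner) atlas \<Rightarrow> bool" where
  "smooth_manifold M \<longleftrightarrow>
     (\<forall>(U, \<phi>)\<in>M. inj_on \<phi> U \<and> open (\<phi> ` U)) \<and>
     (\<forall>(U, \<phi>)\<in>M. \<forall>(V, \<psi>)\<in>M. open (\<phi> ` (U \<inter> V)) \<and>
        smooth_on (\<phi> ` (U \<inter> V)) (\<psi> \<circ> inv_into U \<phi>)) \<and>
     Hausdorff_space (manifold_topology M) \<and>
     second_countable_space (manifold_topology M)"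

text \<open>Smooth maps on a subset \<open>S\<close> of \<open>M\<close>, with values in \<open>N\<close>: near every point of \<open>S\<close>, the
  expression of the map in charts extends to a smooth map on an open set of the model space. For
  \<open>S = carrier M\<close> these are the smooth maps \<open>M \<rightarrow> N\<close>; for an embedded submanifold \<open>S\<close> of \<open>M\<close> they
  are the maps that are smooth with respect to the submanifold structure of \<open>S\<close>.\<close>

definition smooth_map_on ::
  "('a, 'e::fd_inner) atlas \<Rightarrow> 'a set \<Rightarrow> ('b, 'f::fd_inner) atlas \<Rightarrow> ('a \<Rightarrow> 'b) \<Rightarrow> bool" where
  "smooth_map_on M S N f \<longleftrightarrow>
     (\<forall>p\<in>S. \<exists>(U, \<phi>)\<in>M. \<exists>(V, \<psi>)\<in>N. \<exists>W F.
        p \<in> U \<and> open W \<and> \<phi> p \<in> W \<and> W \<subseteq> \<phi> ` U \<and> smooth_on W F \<and>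
        (\<forall>x\<in>S \<inter> U. \<phi> x \<in> W \<longrightarrow> f x \<in> V \<and> \<psi> (f x) = F (\<phi> x)))"

abbreviation smooth_map ::
  "('a, 'e::fd_inner) atlas \<Rightarrow> ('b, 'f::fd_inner) atlas \<Rightarrow> ('a \<Rightarrow> 'b) \<Rightarrow> bool" where
  "smooth_map M N f \<equiv> smooth_map_on M (carrier M) N f"

definition real_line :: "(real, real) atlas" where
  "real_line = {(UNIV, \<lambda>t. t)}"

definition prod_manifold :: "('a, 'e) atlas \<Rightarrow> ('b, 'f) atlas \<Rightarrow> ('a \<times> 'b, 'e \<times> 'f) atlas" where
  "prod_manifold M N = {(U \<times> V, map_prod \<phi> \<psi>) | U \<phi> V \<psi>. (U, \<phi>) \<in> M \<and> (V, \<psi>) \<in> N}"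


section \<open>Tangent bundles and tangent maps\<close>

text \<open>A tangent vector of \<open>M\<close> at \<open>p\<close> is an equivalence class of smooth curves in \<open>M\<close>, defined near
  \<open>0\<close> and passing through \<open>p\<close> at \<open>0\<close>. Curves are total functions, whose values away from \<open>0\<close> are
  irrelevant.\<close>

type_synonym 'a tangent = "(real \<Rightarrow> 'a) set"

definition curve_in :: "('a, 'e::fd_inner) atlas \<Rightarrow> 'a set \<Rightarrow> (real \<Rightarrow> 'a) \<Rightarrow> bool" where
  "curve_in M S \<gamma> \<longleftrightarrow>
     (\<exists>\<epsilon>>0. \<gamma> ` {-\<epsilon><..<\<epsilon>} \<subseteq> S \<and> smooth_map_on real_line {-\<epsilon><..<\<epsilon>} M \<gamma>)"

definition velocity :: "('a, 'e::fd_inner) atlas \<Rightarrow> (real \<Rightarrow> 'a) \<Rightarrow> 'a tangent" where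
  "velocity M \<gamma> = {\<delta>. curve_in M (carrier M) \<delta> \<and> \<delta> 0 = \<gamma> 0 \<and>
     (\<forall>(U, \<phi>)\<in>M. \<gamma> 0 \<in> U \<longrightarrow>
        vector_derivative (\<phi> \<circ> \<delta>) (at 0) = vector_derivative (\<phi> \<circ> \<gamma>) (at 0))}"

text \<open>For an embedded submanifold \<open>S\<close> of \<open>M\<close>, the set \<open>tangent_on M S\<close> is \<open>TS\<close>, regarded as a
  submanifold of \<open>TM\<close>.\<close>

definition tangent_on :: "('a, 'e::fd_inner) atlas \<Rightarrow> 'a set \<Rightarrow> 'a tangent set" where
  "tangent_on M S = {velocity M \<gamma> | \<gamma>. curve_in M S \<gamma>}"

abbreviation tangent_vectors :: "('a, 'e::fd_inner) atlas \<Rightarrow> 'a tangent set" where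
  "tangent_vectors M \<equiv> tangent_on M (carrier M)"

definition foot :: "'a tangent \<Rightarrow> 'a" where
  "foot v = (THE p. \<exists>\<gamma>\<in>v. p = \<gamma> 0)"

definition tangent_component :: "('a \<Rightarrow> 'e::real_normed_vector) \<Rightarrow> 'a tangent \<Rightarrow> 'e" where
  "tangent_component \<phi> v = (THE d. \<exists>\<gamma>\<in>v. d = vector_derivative (\<phi> \<circ> \<gamma>) (at 0))"

definition tangent_coords :: "('a \<Rightarrow> 'e::real_normed_vector) \<Rightarrow> 'a tangent \<Rightarrow> 'e \<times> 'e" where
  "tangent_coords \<phi> v = (\<phi> (foot v), tangent_component \<phi> v)"

definition tangent_bundle :: "('a, 'e::fd_inner) atlas \<Rightarrow> ('a tangent, 'e \<times> 'e) atlas" where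
  "tangent_bundle M =
     {({v \<in> tangent_vectors M. foot v \<in> U}, tangent_coords \<phi>) | U \<phi>. (U, \<phi>) \<in> M}"

definition zero_tangent :: "('a, 'e::fd_inner) atlas \<Rightarrow> 'a \<Rightarrow> 'a tangent" where
  "zero_tangent M p = velocity M (\<lambda>_. p)"

definition add_tangent :: "('a, 'e::fd_inner) atlas \<Rightarrow> 'a tangent \<Rightarrow> 'a tangent \<Rightarrow> 'a tangent" where
  "add_tangent M v w = (THE u. u \<in> tangent_vectors M \<and> foot u = foot v \<and>
     (\<forall>(U, \<phi>)\<in>M. foot v \<in> U \<longrightarrow>
        tangent_component \<phi> u = tangent_component \<phi> v + tangent_component \<phi> w))"

definition scale_tangent :: "('a, 'e::fd_inner) atlas \<Rightarrow> real \<Rightarrow> 'a tangent \<Rightarrow> 'a tangent" where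
  "scale_tangent M c v = (THE u. u \<in> tangent_vectors M \<and> foot u = foot v \<and>
     (\<forall>(U, \<phi>)\<in>M. foot v \<in> U \<longrightarrow> tangent_component \<phi> u = c *\<^sub>R tangent_component \<phi> v))"

text \<open>The tangent map \<open>TS \<rightarrow> TN\<close> of a smooth map \<open>f : S \<rightarrow> N\<close>, where \<open>S \<subseteq> M\<close>. The representing
  curve has to stay in \<open>S\<close>, since \<open>f\<close> is only meaningful there.\<close>

definition tangent_map_on ::
  "('a, 'e::fd_inner) atlas \<Rightarrow> 'a set \<Rightarrow> ('b, 'f::fd_inner) atlas \<Rightarrow> ('a \<Rightarrow> 'b) \<Rightarrow>
   'a tangent \<Rightarrow> 'b tangent" where
  "tangent_map_on M S N f v = (THE w. \<exists>\<gamma>\<in>v. curve_in M S \<gamma> \<and> w = velocity N (f \<circ> \<gamma>))"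

abbreviation tangent_map ::
  "('a, 'e::fd_inner) atlas \<Rightarrow> ('b, 'f::fd_inner) atlas \<Rightarrow> ('a \<Rightarrow> 'b) \<Rightarrow> 'a tangent \<Rightarrow> 'b tangent" where
  "tangent_map M N f \<equiv> tangent_map_on M (carrier M) N f"

text \<open>The canonical identification \<open>TM \<times> TN \<cong> T(M \<times> N)\<close>.\<close>

definition pair_tangent :: "'a tangent \<Rightarrow> 'b tangent \<Rightarrow> ('a \<times> 'b) tangent" where
  "pair_tangent v w = {\<lambda>t. (\<gamma> t, \<delta> t) | \<gamma> \<delta>. \<gamma> \<in> v \<and> \<delta> \<in> w}"

text \<open>The canonical involution \<open>\<kappa>\<^sub>M\<close> of \<open>TTM\<close>. In the coordinates of \<open>TTM\<close> induced by a chart of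
  \<open>M\<close> it is \<open>((x, v), (x', v')) \<mapsto> ((x, x'), (v, v'))\<close>.\<close>

definition canonical_involution ::
  "('a, 'e::fd_inner) atlas \<Rightarrow> 'a tangent tangent \<Rightarrow> 'a tangent tangent" where
  "canonical_involution M \<xi> =
     (THE \<eta>. \<eta> \<in> tangent_vectors (tangent_bundle M) \<and> foot (foot \<eta>) = foot (foot \<xi>) \<and>
        (\<forall>(U, \<phi>)\<in>M. foot (foot \<xi>) \<in> U \<longrightarrow>
           tangent_coords (tangent_coords \<phi>) \<eta> =
             (case tangent_coords (tangent_coords \<phi>) \<xi> of
                ((x, v), (x', v')) \<Rightarrow> ((x, x'), (v, v')))))"


section \<open>Lie groupoids\<close>

record ('q, 'm, 'g, 'n) groupoid =
  base :: "('q, 'm) atlas"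
  arrows :: "('g, 'n) atlas"
  src :: "'g \<Rightarrow> 'q"
  tgt :: "'g \<Rightarrow> 'q"
  ident :: "'q \<Rightarrow> 'g"
  mult :: "'g \<Rightarrow> 'g \<Rightarrow> 'g"
  invert :: "'g \<Rightarrow> 'g"

definition composable :: "('q, 'm, 'g, 'n) groupoid \<Rightarrow> ('g \<times> 'g) set" where
  "composable G =
     {(g, h). g \<in> carrier (arrows G) \<and> h \<in> carrier (arrows G) \<and> tgt G g = src G h}"

definition submersion ::
  "('a, 'e::fd_inner) atlas \<Rightarrow> ('b, 'f::fd_inner) atlas \<Rightarrow> ('a \<Rightarrow> 'b) \<Rightarrow> bool" where
  "submersion M N f \<longleftrightarrow> smooth_map M N f \<and>
     (\<forall>p\<in>carrier M. \<forall>w\<in>tangent_vectors N. foot w = f p \<longrightarrow>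
        (\<exists>v\<in>tangent_vectors M. foot v = p \<and> tangent_map M N f v = w))"

text \<open>Surjectivity of the source and target maps follows from \<open>src_ident\<close> and \<open>tgt_ident\<close>. The set
  of composable pairs is an embedded submanifold because source and target are submersions.\<close>

locale lie_groupoid =
  fixes G :: "('q, 'm::fd_inner, 'g, 'n::fd_inner) groupoid"
  assumes base_manifold: "smooth_manifold (base G)"
    and arrows_manifold: "smooth_manifold (arrows G)"
    and src_submersion: "submersion (arrows G) (base G) (src G)"
    and tgt_submersion: "submersion (arrows G) (base G) (tgt G)"
    and ident_smooth: "smooth_map (base G) (arrows G) (ident G)"
    and mult_smooth:
      "smooth_map_on (prod_manifold (arrows G) (arrows G)) (composable G) (arrows G)
         (\<lambda>(g, h). mult G g h)"
    and invert_smooth: "smooth_map (arrows G) (arrows G) (invert G)"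
    and src_ident: "\<And>q. q \<in> carrier (base G) \<Longrightarrow> src G (ident G q) = q"
    and tgt_ident: "\<And>q. q \<in> carrier (base G) \<Longrightarrow> tgt G (ident G q) = q"
    and src_mult: "\<And>g h. (g, h) \<in> composable G \<Longrightarrow> src G (mult G g h) = src G g"
    and tgt_mult: "\<And>g h. (g, h) \<in> composable G \<Longrightarrow> tgt G (mult G g h) = tgt G h"
    and mult_assoc: "\<And>g h k. (g, h) \<in> composable G \<Longrightarrow> (h, k) \<in> composable G \<Longrightarrow>
           mult G (mult G g h) k = mult G g (mult G h k)"
    and mult_ident_left: "\<And>g. g \<in> carrier (arrows G) \<Longrightarrow> mult G (ident G (src G g)) g = g"
    and mult_ident_right: "\<And>g. g \<in> carrier (arrows G) \<Longrightarrow> mult G g (ident G (tgt G g)) = g"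
    and src_invert: "\<And>g. g \<in> carrier (arrows G) \<Longrightarrow> src G (invert G g) = tgt G g"
    and tgt_invert: "\<And>g. g \<in> carrier (arrows G) \<Longrightarrow> tgt G (invert G g) = src G g"
    and mult_invert_right:
      "\<And>g. g \<in> carrier (arrows G) \<Longrightarrow> mult G g (invert G g) = ident G (src G g)"
    and mult_invert_left:
      "\<And>g. g \<in> carrier (arrows G) \<Longrightarrow> mult G (invert G g) g = ident G (tgt G g)"

definition tangent_groupoid ::
  "('q, 'm::fd_inner, 'g, 'n::fd_inner) groupoid \<Rightarrow>
   ('q tangent, 'm \<times> 'm, 'g tangent, 'n \<times> 'n) groupoid" where
  "tangent_groupoid G =
     \<lparr> base = tangent_bundle (base G),
       arrows = tangent_bundle (arrows G),
       src = tangent_map (arrows G) (base G) (src G),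
       tgt = tangent_map (arrows G) (base G) (tgt G),
       ident = tangent_map (base G) (arrows G) (ident G),
       mult = (\<lambda>X Y. tangent_map_on (prod_manifold (arrows G) (arrows G)) (composable G) (arrows G)
                 (\<lambda>(g, h). mult G g h) (pair_tangent X Y)),
       invert = tangent_map (arrows G) (arrows G) (invert G) \<rparr>"


section \<open>The Lie algebroid and generalized discretization maps\<close>

text \<open>\<open>AG\<close> is the union of the fibres \<open>A\<^sub>qG\<close> inside \<open>TG\<close>. It is a disjoint union, since the identity
  section is injective, and an embedded submanifold of \<open>TG\<close>; smoothness of maps on \<open>AG\<close>, and the
  tangent bundle \<open>T(AG)\<close> inside \<open>TTG\<close>, refer to this submanifold structure.\<close>

definition algebroid_fibre ::
  "('q, 'm::fd_inner, 'g, 'n::fd_inner) groupoid \<Rightarrow> 'q \<Rightarrow> 'g tangent set" where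
  "algebroid_fibre G q =
     {v \<in> tangent_vectors (arrows G). foot v = ident G q \<and>
        tangent_map (arrows G) (base G) (src G) v = zero_tangent (base G) q}"

definition algebroid ::
  "('q, 'm::fd_inner, 'g, 'n::fd_inner) groupoid \<Rightarrow> 'g tangent set" where
  "algebroid G = (\<Union>q\<in>carrier (base G). algebroid_fibre G q)"

definition algebroid_zero ::
  "('q, 'm::fd_inner, 'g, 'n::fd_inner) groupoid \<Rightarrow> 'q \<Rightarrow> 'g tangent" where
  "algebroid_zero G q = zero_tangent (arrows G) (ident G q)"

text \<open>The velocity at \<open>t = 0\<close> of the curve \<open>t \<mapsto> t v\<close>, an element of \<open>T(A\<^sub>qG)\<close> inside \<open>TTG\<close>.\<close>

definition vertical_lift ::
  "('q, 'm::fd_inner, 'g, 'n::fd_inner) groupoid \<Rightarrow> 'g tangent \<Rightarrow> 'g tangent tangent" where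
  "vertical_lift G v =
     velocity (tangent_bundle (arrows G)) (\<lambda>t. scale_tangent (arrows G) t v)"

definition generalized_discretization_map ::
  "('q, 'm::fd_inner, 'g, 'n::fd_inner) groupoid \<Rightarrow> ('g tangent \<Rightarrow> 'g) \<Rightarrow> bool" where
  "generalized_discretization_map G \<R> \<longleftrightarrow>
     smooth_map_on (tangent_bundle (arrows G)) (algebroid G) (arrows G) \<R> \<and>
     (\<forall>q\<in>carrier (base G). \<R> (algebroid_zero G q) = ident G q) \<and>
     (\<forall>q\<in>carrier (base G). \<forall>v\<in>algebroid_fibre G q.
        let X = tangent_map_on (tangent_bundle (arrows G)) (algebroid_fibre G q) (arrows G) \<R>
                  (vertical_lift G v)
        in X = add_tangent (arrows G) v
                 (tangent_map (base G) (arrows G) (ident G)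
                   (tangent_map (arrows G) (base G) (src G) X)))"

abbreviation tangent_algebroid ::
  "('q, 'm::fd_inner, 'g, 'n::fd_inner) groupoid \<Rightarrow> 'g tangent tangent set" where
  "tangent_algebroid G \<equiv> tangent_on (tangent_bundle (arrows G)) (algebroid G)"

abbreviation algebroid_tangent_map ::
  "('q, 'm::fd_inner, 'g, 'n::fd_inner) groupoid \<Rightarrow> ('g tangent \<Rightarrow> 'g) \<Rightarrow>
   'g tangent tangent \<Rightarrow> 'g tangent" where
  "algebroid_tangent_map G \<R> \<equiv>
     tangent_map_on (tangent_bundle (arrows G)) (algebroid G) (arrows G) \<R>"

text \<open>The canonical isomorphism \<open>T(AG) \<rightarrow> A(TG)\<close> is the restriction of \<open>\<kappa>\<^sub>G\<close> to \<open>T(AG)\<close>; a map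
  defined on \<open>T(AG)\<close> is regarded as a map on \<open>A(TG)\<close> by composing it with the inverse.\<close>

definition via_canonical_iso ::
  "('q, 'm::fd_inner, 'g, 'n::fd_inner) groupoid \<Rightarrow> ('g tangent tangent \<Rightarrow> 'b) \<Rightarrow>
   'g tangent tangent \<Rightarrow> 'b" where
  "via_canonical_iso G F =
     F \<circ> inv_into (tangent_algebroid G) (canonical_involution (arrows G))"

end

theory Submission
  imports Defs
begin

text \<open>The algebroid and the discretization maps of a Lie groupoid can be described by the smooth idempotent
  map \<open>r = \<epsilon> \<circ> \<alpha>\<close> of the manifold of arrows. Its fixed points are the identities. Since \<open>T\<epsilon>\<close> is injective, \<open>AG\<close> consists of
  the tangent vectors at fixed points of \<open>r\<close> that \<open>Tr\<close> maps to zero, and the second condition on a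
  discretization map reads \<open>X = v + Tr X\<close>, where \<open>X\<close> is the derivative of \<open>\<R>\<close> along the vertical
  lift of \<open>v\<close> (\<open>generalized_discretization_map_iff\<close>). The idempotent of the tangent groupoid is
  \<open>Tr\<close>. So the claim is one about a manifold \<open>M\<close>, a smooth idempotent \<open>r\<close> and its kernel bundle
  (\<open>kernel_discretization_tangent\<close>).

  In a chart around a fixed point, \<open>r\<close> becomes an idempotent map \<open>\<rho>\<close> of an open set, and the kernel
  bundle becomes the set of all \<open>(x, y)\<close> with \<open>\<rho> x = x\<close> and \<open>d\<rho>(x) y = 0\<close>. It is the image of the
  smooth retraction \<open>\<pi> (x, y) = (\<rho> x, y - d\<rho>(\<rho> x) y)\<close>, which serves two purposes. First, the
  composition of \<open>\<pi>\<close> with a straight line is a curve in the kernel bundle. Such curves show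
  that the canonical involution maps the kernel bundle of \<open>Tr\<close> into the tangent bundle of the kernel
  bundle of \<open>r\<close> (\<open>canonical_involution_kernel\<close>). So the inverse of the canonical isomorphism is given by
  the canonical involution itself, and in coordinates \<open>T\<R>\<close>, regarded as a map on the kernel bundle of \<open>Tr\<close>, is
  \<open>((x, v), (x', v')) \<mapsto> (F(x, x'), dF(x, x')(v, v'))\<close>, where \<open>F\<close> expresses \<open>\<R>\<close>.

  Secondly, an equation that holds on the kernel bundle may be differentiated in the directions
  tangent to it, because composed with \<open>\<pi>\<close> it holds on an open set. The conditions on \<open>\<R>\<close> read
  \<open>F(x, 0) = x\<close> and \<open>dF(x, 0)(0, y) = y + d\<rho>(x) dF(x, 0)(0, y)\<close> for \<open>(x, y)\<close> in the kernel bundle.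
  Differentiating them in the tangent direction \<open>(v, v')\<close> at \<open>(x, x')\<close> gives the
  corresponding conditions for \<open>T\<R>\<close> at \<open>((x, v), (x', v'))\<close>, up to the order of differentiation
  in the second derivatives of \<open>F\<close> and \<open>\<rho>\<close> (\<open>discretization_calculus\<close>). The symmetry of second
  derivatives closes this gap; it is also the reason why the canonical involution does not depend on
  the chart (\<open>tangent_lift_flip\<close>).\<close>

section \<open>Calculus on finite-dimensional inner product spaces\<close>

text \<open>Gram--Schmidt yields an orthogonal spanning set, possibly with \<open>0\<close> in it; the corresponding
  summand is \<open>0\<close> because division by zero gives \<open>0\<close>.\<close>

lemma fd_inner_orthogonal_basis:
  "\<exists>B :: 'a::fd_inner set. finite B \<and> (\<forall>x. x = (\<Sum>b\<in>B. ((x \<bullet> b) / (b \<bullet> b)) *\<^sub>R b))"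
proof -
  obtain B0 :: "'a set" where B0: "finite B0" "span B0 = UNIV" using fd_inner_span by blast
  obtain B :: "'a set" where B: "finite B" "span B = UNIV" "pairwise orthogonal B"
    using basis_orthogonal[OF B0(1)] B0(2) by auto
  have "x = (\<Sum>b\<in>B. ((x \<bullet> b) / (b \<bullet> b)) *\<^sub>R b)" for x
  proof -
    have "x \<in> span B" using B by simp
    then obtain c where c: "x = (\<Sum>b\<in>B. c b *\<^sub>R b)"
      unfolding span_finite[OF B(1)] by blast
    have "((x \<bullet> b) / (b \<bullet> b)) *\<^sub>R b = c b *\<^sub>R b" if b: "b \<in> B" for b
    proof (cases "b = 0")
      case False
      have "x \<bullet> b = (\<Sum>a\<in>B. c a * (a \<bullet> b))"
        by (subst c) (simp add: inner_sum_left)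
      also have "\<dots> = (\<Sum>a\<in>B. if a = b then c b * (b \<bullet> b) else 0)"
      proof (rule sum.cong)
        fix a assume "a \<in> B"
        then show "c a * (a \<bullet> b) = (if a = b then c b * (b \<bullet> b) else 0)"
          using B(3) b by (auto simp: pairwise_def orthogonal_def)
      qed simp
      also have "\<dots> = c b * (b \<bullet> b)" using b B(1) by simp
      finally show ?thesis using False by simp
    qed simp
    then show ?thesis using c by (metis (no_types, lifting) sum.cong)
  qed
  then show ?thesis using B(1) by blast
qed

lemma linear_basis_expansion:
  fixes f :: "'a::real_inner \<Rightarrow> 'b::real_vector"
  assumes "linear f" and "\<And>x. x = (\<Sum>b\<in>B. ((x \<bullet> b) / (b \<bullet> b)) *\<^sub>R b)"
  shows "f x = (\<Sum>b\<in>B. ((x \<bullet> b) / (b \<bullet> b)) *\<^sub>R f b)"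
  by (subst assms(2)) (simp add: linear_sum[OF assms(1)] linear_cmul[OF assms(1)])

lemma has_derivative_frechet_derivative:
  "f differentiable (at x) \<Longrightarrow> (f has_derivative frechet_derivative f (at x)) (at x)"
  using frechet_derivative_works by blast

lemma frechet_derivative_linear:
  assumes "f differentiable (at x)"
  shows "linear (frechet_derivative f (at x))"
  using assms has_derivative_frechet_derivative has_derivative_linear by blast

subsection \<open>Closure properties of maps with finitely many derivatives\<close>

lemma Ck_on_cong:
  assumes "open S" "\<And>x. x \<in> S \<Longrightarrow> f x = g x" "Ck_on n S f"
  shows "Ck_on n S g"
  using assms(2,3)
proof (induction n arbitrary: f g)
  case 0
  then show ?case by (metis Ck_on.simps(1) continuous_on_cong)
next
  case (Suc n)
  have d: "f differentiable (at x)" if "x \<in> S" for x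
    using Suc.prems that by simp
  have eq: "frechet_derivative f (at x) = frechet_derivative g (at x)" if "x \<in> S" for x
    using frechet_derivative_transform_within_open[OF d[OF that] assms(1) that] Suc.prems by blast
  have "g differentiable (at x)" if "x \<in> S" for x
    using d[OF that] has_derivative_transform_within_open[OF _ assms(1) that] Suc.prems(1)
    unfolding differentiable_def by blast
  moreover have "Ck_on n S (\<lambda>x. frechet_derivative g (at x) v)" for v
    by (rule Suc.IH[of "\<lambda>x. frechet_derivative f (at x) v"]) (use eq Suc.prems in auto)
  ultimately show ?case by simp
qed

lemma Ck_on_subset: "Ck_on n S f \<Longrightarrow> T \<subseteq> S \<Longrightarrow> Ck_on n T f"
  by (induction n arbitrary: f) (auto intro: continuous_on_subset)

lemma Ck_on_Suc_imp: "Ck_on (Suc n) S f \<Longrightarrow> Ck_on n S f"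
proof (induction n arbitrary: f)
  case 0
  then show ?case
    by (auto intro!: continuous_at_imp_continuous_on differentiable_imp_continuous_within)
next
  case (Suc n)
  then show ?case by (metis Ck_on.simps(2))
qed

lemma Ck_on_const: "Ck_on n S (\<lambda>_. c)"
  by (induction n arbitrary: c) auto

lemma Ck_on_bounded_linear_compose:
  assumes L: "bounded_linear L" and S: "open S" and f: "Ck_on n S f"
  shows "Ck_on n S (\<lambda>x. L (f x))"
  using f
proof (induction n arbitrary: f)
  case 0
  then show ?case using L by (auto intro: bounded_linear.continuous_on)
next
  case (Suc n)
  have d: "((\<lambda>x. L (f x)) has_derivative (\<lambda>v. L (frechet_derivative f (at x) v))) (at x)"
    if "x \<in> S" for x
    using Suc.prems that
    by (intro bounded_linear.has_derivative[OF L] has_derivative_frechet_derivative) auto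
  have "Ck_on n S (\<lambda>x. frechet_derivative (\<lambda>x. L (f x)) (at x) v)" for v
    by (rule Ck_on_cong[OF S, of "\<lambda>x. L (frechet_derivative f (at x) v)"])
       (use Suc d in \<open>auto simp: frechet_derivative_at[OF d, symmetric]\<close>)
  then show ?case using d by (auto simp: differentiable_def)
qed

lemma Ck_on_add:
  assumes S: "open S" and "Ck_on n S f" "Ck_on n S g"
  shows "Ck_on n S (\<lambda>x. f x + g x)"
  using assms(2-)
proof (induction n arbitrary: f g)
  case 0
  then show ?case by (auto intro: continuous_intros)
next
  case (Suc n)
  have d: "((\<lambda>x. f x + g x) has_derivative
      (\<lambda>v. frechet_derivative f (at x) v + frechet_derivative g (at x) v)) (at x)"
    if "x \<in> S" for x
    using Suc.prems that by (intro has_derivative_add has_derivative_frechet_derivative) auto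
  have "Ck_on n S (\<lambda>x. frechet_derivative (\<lambda>x. f x + g x) (at x) v)" for v
    by (rule Ck_on_cong[OF S,
          of "\<lambda>x. frechet_derivative f (at x) v + frechet_derivative g (at x) v"])
       (use Suc d in \<open>auto simp: frechet_derivative_at[OF d, symmetric]\<close>)
  then show ?case using d by (auto simp: differentiable_def)
qed

lemma Ck_on_sum:
  assumes "open S" "\<And>i. i \<in> I \<Longrightarrow> Ck_on n S (f i)"
  shows "Ck_on n S (\<lambda>x. \<Sum>i\<in>I. f i x)"
  using assms(2)
  by (induction I rule: infinite_finite_induct) (auto intro: Ck_on_const Ck_on_add[OF assms(1)])

lemma Ck_on_bounded_bilinear:
  assumes P: "bounded_bilinear P" and S: "open S" and "Ck_on n S f" "Ck_on n S g"
  shows "Ck_on n S (\<lambda>x. P (f x) (g x))"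
  using assms(3-)
proof (induction n arbitrary: f g)
  case 0
  then show ?case using bounded_bilinear.continuous_on[OF P] by auto
next
  case (Suc n)
  have d: "((\<lambda>x. P (f x) (g x)) has_derivative
      (\<lambda>v. P (f x) (frechet_derivative g (at x) v) + P (frechet_derivative f (at x) v) (g x))) (at x)"
    if "x \<in> S" for x
    using Suc.prems that
    by (intro bounded_bilinear.FDERIV[OF P] has_derivative_frechet_derivative) auto
  have "Ck_on n S (\<lambda>x. frechet_derivative (\<lambda>x. P (f x) (g x)) (at x) v)" for v
    by (rule Ck_on_cong[OF S, of
          "\<lambda>x. P (f x) (frechet_derivative g (at x) v) + P (frechet_derivative f (at x) v) (g x)"])
       (use Suc.IH Suc.prems Ck_on_Suc_imp[OF Suc.prems(1)] Ck_on_Suc_imp[OF Suc.prems(2)] d S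
        in \<open>auto simp: frechet_derivative_at[OF d, symmetric] intro!: Ck_on_add\<close>)
  then show ?case using d by (auto simp: differentiable_def)
qed

text \<open>The direction of differentiation of \<open>f\<close> in the chain rule varies with the point. Expanding it in
  a basis turns the derivative of the composition into a sum of products of scalar functions with
  directional derivatives of \<open>f\<close> in fixed directions, composed with \<open>g\<close>, to which the induction
  hypothesis applies.\<close>

lemma Ck_on_compose:
  fixes f :: "'b::fd_inner \<Rightarrow> 'c::real_normed_vector" and g :: "'a::real_normed_vector \<Rightarrow> 'b"
  assumes S: "open S" and "Ck_on n T f" "Ck_on n S g" and sub: "g ` S \<subseteq> T"
  shows "Ck_on n S (\<lambda>x. f (g x))"
  using assms(2,3)
proof (induction n arbitrary: f)
  case 0
  then show ?case using sub by (auto intro: continuous_on_compose2)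
next
  case (Suc n)
  obtain B :: "'b set" where B: "finite B" "\<And>x. x = (\<Sum>b\<in>B. ((x \<bullet> b) / (b \<bullet> b)) *\<^sub>R b)"
    using fd_inner_orthogonal_basis by metis
  let ?dg = "\<lambda>x. frechet_derivative g (at x)" and ?df = "\<lambda>y. frechet_derivative f (at y)"
  have df: "f differentiable (at (g x))" if "x \<in> S" for x
    using Suc.prems that sub by auto
  have d: "((\<lambda>x. f (g x)) has_derivative (\<lambda>v. ?df (g x) (?dg x v))) (at x)" if "x \<in> S" for x
    using Suc.prems that df
    by (intro has_derivative_compose[of g _ _ _ f] has_derivative_frechet_derivative) auto
  have "Ck_on n S (\<lambda>x. \<Sum>b\<in>B. ((?dg x v \<bullet> b) / (b \<bullet> b)) *\<^sub>R ?df (g x) b)" for v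
  proof (rule Ck_on_sum[OF S], rule Ck_on_bounded_bilinear[OF bounded_bilinear_scaleR S])
    fix b :: 'b
    have "bounded_linear (\<lambda>x. (x \<bullet> b) / (b \<bullet> b))"
      by (rule bounded_linear_compose[OF bounded_linear_divide bounded_linear_inner_left])
    then show "Ck_on n S (\<lambda>x. (?dg x v \<bullet> b) / (b \<bullet> b))"
      by (rule Ck_on_bounded_linear_compose[OF _ S]) (use Suc.prems in auto)
    show "Ck_on n S (\<lambda>x. ?df (g x) b)"
      by (rule Suc.IH[of "\<lambda>y. ?df y b"]) (use Suc.prems Ck_on_Suc_imp in auto)
  qed
  then have "Ck_on n S (\<lambda>x. frechet_derivative (\<lambda>x. f (g x)) (at x) v)" for v
    by (rule Ck_on_cong[OF S, rotated, of _
            "\<lambda>x. \<Sum>b\<in>B. ((?dg x v \<bullet> b) / (b \<bullet> b)) *\<^sub>R ?df (g x) b"])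
       (auto simp: frechet_derivative_at[OF d, symmetric]
          linear_basis_expansion[OF frechet_derivative_linear[OF df] B(2), symmetric])
  then show ?case using d by (auto simp: differentiable_def)
qed

subsection \<open>Smooth maps\<close>

lemma smooth_on_cong:
  "open S \<Longrightarrow> (\<And>x. x \<in> S \<Longrightarrow> f x = g x) \<Longrightarrow> smooth_on S f \<Longrightarrow> smooth_on S g"
  unfolding smooth_on_def using Ck_on_cong by blast

lemma smooth_on_subset: "smooth_on S f \<Longrightarrow> T \<subseteq> S \<Longrightarrow> smooth_on T f"
  unfolding smooth_on_def using Ck_on_subset by blast

lemma smooth_on_continuous_on: "smooth_on S f \<Longrightarrow> continuous_on S f"
  unfolding smooth_on_def by (metis Ck_on.simps(1))

lemma smooth_on_differentiable: "smooth_on S f \<Longrightarrow> x \<in> S \<Longrightarrow> f differentiable (at x)"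
  unfolding smooth_on_def by (metis Ck_on.simps(2))

lemma smooth_on_has_derivative:
  "smooth_on S f \<Longrightarrow> x \<in> S \<Longrightarrow> (f has_derivative frechet_derivative f (at x)) (at x)"
  using smooth_on_differentiable has_derivative_frechet_derivative by blast

lemma smooth_on_directional_derivative:
  "smooth_on S f \<Longrightarrow> smooth_on S (\<lambda>x. frechet_derivative f (at x) v)"
  unfolding smooth_on_def by (metis Ck_on.simps(2))

lemma smooth_on_const [intro]: "smooth_on S (\<lambda>_. c)"
  unfolding smooth_on_def using Ck_on_const by blast

lemma smooth_on_ident [intro]: "smooth_on S (\<lambda>x. x)"
  unfolding smooth_on_def
proof
  show "Ck_on n S (\<lambda>x. x)" for n
    by (cases n) (auto simp: Ck_on_const)
qed

lemma smooth_on_bounded_linear_compose: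
  "bounded_linear L \<Longrightarrow> open S \<Longrightarrow> smooth_on S f \<Longrightarrow> smooth_on S (\<lambda>x. L (f x))"
  unfolding smooth_on_def using Ck_on_bounded_linear_compose by blast

lemma smooth_on_add: "open S \<Longrightarrow> smooth_on S f \<Longrightarrow> smooth_on S g \<Longrightarrow> smooth_on S (\<lambda>x. f x + g x)"
  unfolding smooth_on_def using Ck_on_add by blast

lemma smooth_on_diff:
  assumes "open S" "smooth_on S f" "smooth_on S g"
  shows "smooth_on S (\<lambda>x. f x - g x)"
  using smooth_on_add[OF assms(1,2)
      smooth_on_bounded_linear_compose[OF bounded_linear_minus[OF bounded_linear_ident] assms(1,3)]]
  by simp

lemma smooth_on_scaleR:
  "open S \<Longrightarrow> smooth_on S f \<Longrightarrow> smooth_on S g \<Longrightarrow> smooth_on S (\<lambda>x. f x *\<^sub>R g x)"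
  unfolding smooth_on_def using Ck_on_bounded_bilinear[OF bounded_bilinear_scaleR] by blast

lemma smooth_on_fst: "open S \<Longrightarrow> smooth_on S f \<Longrightarrow> smooth_on S (\<lambda>x. fst (f x))"
  by (rule smooth_on_bounded_linear_compose[OF bounded_linear_fst])

lemma smooth_on_snd: "open S \<Longrightarrow> smooth_on S f \<Longrightarrow> smooth_on S (\<lambda>x. snd (f x))"
  by (rule smooth_on_bounded_linear_compose[OF bounded_linear_snd])

lemma smooth_on_Pair:
  assumes "open S" "smooth_on S f" "smooth_on S g"
  shows "smooth_on S (\<lambda>x. (f x, g x))"
proof -
  have 1: "bounded_linear (\<lambda>x. (x, 0))" and 2: "bounded_linear (\<lambda>x. (0, x))"
    by (simp_all add: bounded_linear_Pair bounded_linear_ident bounded_linear_zero)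
  show ?thesis
    using smooth_on_add[OF assms(1) smooth_on_bounded_linear_compose[OF 1 assms(1,2)]
        smooth_on_bounded_linear_compose[OF 2 assms(1,3)]]
    by simp
qed

lemma smooth_on_compose:
  fixes f :: "'b::fd_inner \<Rightarrow> 'c::real_normed_vector" and g :: "'a::real_normed_vector \<Rightarrow> 'b"
  assumes "open S" "smooth_on T f" "smooth_on S g" "g ` S \<subseteq> T"
  shows "smooth_on S (\<lambda>x. f (g x))"
  using assms unfolding smooth_on_def using Ck_on_compose by blast

subsection \<open>Symmetry of second derivatives\<close>

lemma directional_mvt:
  fixes g :: "'a::real_normed_vector \<Rightarrow> real"
  assumes "0 < h" "\<And>s. 0 \<le> s \<Longrightarrow> s \<le> h \<Longrightarrow> g differentiable (at (x + s *\<^sub>R u))"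
  shows "\<exists>s. 0 < s \<and> s < h \<and> g (x + h *\<^sub>R u) - g x = h * frechet_derivative g (at (x + s *\<^sub>R u)) u"
proof -
  have d: "((\<lambda>s. g (x + s *\<^sub>R u)) has_real_derivative frechet_derivative g (at (x + s *\<^sub>R u)) u) (at s)"
    if "0 \<le> s" "s \<le> h" for s
  proof -
    note D = has_derivative_frechet_derivative[OF assms(2)[OF that]]
    have "((\<lambda>s. g (x + s *\<^sub>R u)) has_derivative
        (\<lambda>t. frechet_derivative g (at (x + s *\<^sub>R u)) (t *\<^sub>R u))) (at s)"
      by (rule has_derivative_compose[of "\<lambda>s. x + s *\<^sub>R u" "\<lambda>t. t *\<^sub>R u" s UNIV g, OF _ D])
         (auto intro!: derivative_eq_intros)
    then show ?thesis
      unfolding has_field_derivative_def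
      by (simp add: linear_cmul[OF has_derivative_linear[OF D]] mult.commute[of _ "frechet_derivative _ _ _"])
  qed
  from MVT2[OF assms(1) d] show ?thesis by force
qed

text \<open>The mean value theorem, first in the direction \<open>u\<close> and then in the direction \<open>v\<close>. The second
  difference on the left-hand side is symmetric in \<open>u\<close> and \<open>v\<close>.\<close>

lemma second_difference:
  fixes g :: "'a::real_normed_vector \<Rightarrow> real"
  assumes h: "0 < h" and "\<And>y. y \<in> S \<Longrightarrow> g differentiable (at y)"
    and "\<And>y. y \<in> S \<Longrightarrow> (\<lambda>y. frechet_derivative g (at y) u) differentiable (at y)"
    and S: "\<And>s t. 0 \<le> s \<Longrightarrow> s \<le> h \<Longrightarrow> 0 \<le> t \<Longrightarrow> t \<le> h \<Longrightarrow> x + s *\<^sub>R u + t *\<^sub>R v \<in> S"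
  shows "\<exists>s t. 0 < s \<and> s < h \<and> 0 < t \<and> t < h \<and>
     g (x + h *\<^sub>R u + h *\<^sub>R v) - g (x + h *\<^sub>R u) - g (x + h *\<^sub>R v) + g x =
     h\<^sup>2 * frechet_derivative (\<lambda>y. frechet_derivative g (at y) u) (at (x + s *\<^sub>R u + t *\<^sub>R v)) v"
proof -
  let ?k = "\<lambda>y. g (y + h *\<^sub>R v) - g y"
  have dk: "(?k has_derivative (\<lambda>w. frechet_derivative g (at (x + s *\<^sub>R u + h *\<^sub>R v)) w
      - frechet_derivative g (at (x + s *\<^sub>R u)) w)) (at (x + s *\<^sub>R u))" if "0 \<le> s" "s \<le> h" for s
  proof -
    have 1: "g differentiable (at (x + s *\<^sub>R u))" and 2: "g differentiable (at (x + s *\<^sub>R u + h *\<^sub>R v))"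
      using assms(2) S[OF that, of 0] S[OF that, of h] h by auto
    have "((\<lambda>y. g (y + h *\<^sub>R v)) has_derivative
        (\<lambda>w. frechet_derivative g (at (x + s *\<^sub>R u + h *\<^sub>R v)) w)) (at (x + s *\<^sub>R u))"
      by (rule has_derivative_compose[of "\<lambda>y. y + h *\<^sub>R v" "\<lambda>w. w" _ UNIV g,
            OF _ has_derivative_frechet_derivative[OF 2]])
         (auto intro!: derivative_eq_intros)
    then show ?thesis
      by (intro has_derivative_diff has_derivative_frechet_derivative[OF 1])
  qed
  have "\<exists>s. 0 < s \<and> s < h \<and> ?k (x + h *\<^sub>R u) - ?k x = h * frechet_derivative ?k (at (x + s *\<^sub>R u)) u"
    by (rule directional_mvt[OF h]) (use dk in \<open>auto simp: differentiable_def\<close>)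
  then obtain s where s: "0 < s" "s < h"
    "?k (x + h *\<^sub>R u) - ?k x = h * frechet_derivative ?k (at (x + s *\<^sub>R u)) u" by blast
  let ?m = "\<lambda>y. frechet_derivative g (at y) u"
  have "\<exists>t. 0 < t \<and> t < h \<and> ?m (x + s *\<^sub>R u + h *\<^sub>R v) - ?m (x + s *\<^sub>R u)
      = h * frechet_derivative ?m (at (x + s *\<^sub>R u + t *\<^sub>R v)) v"
    by (rule directional_mvt[OF h]) (use assms(3) S s in auto)
  then obtain t where t: "0 < t" "t < h" "?m (x + s *\<^sub>R u + h *\<^sub>R v) - ?m (x + s *\<^sub>R u)
      = h * frechet_derivative ?m (at (x + s *\<^sub>R u + t *\<^sub>R v)) v" by blast
  have "frechet_derivative ?k (at (x + s *\<^sub>R u)) u = ?m (x + s *\<^sub>R u + h *\<^sub>R v) - ?m (x + s *\<^sub>R u)"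
    using s by (subst frechet_derivative_at[OF dk, symmetric]) auto
  then have "?k (x + h *\<^sub>R u) - ?k x
      = h\<^sup>2 * frechet_derivative ?m (at (x + s *\<^sub>R u + t *\<^sub>R v)) v"
    using s(3) t(3) by (simp add: power2_eq_square)
  then show ?thesis using s(1,2) t(1,2) by (smt (verit))
qed

text \<open>Both second derivatives take a common value at two points of an arbitrarily small
  parallelogram at \<open>x\<close>, namely the second difference divided by \<open>h\<^sup>2\<close>; they agree at \<open>x\<close> by continuity.\<close>

lemma symmetric_second_derivative_real:
  fixes g :: "'a::real_normed_vector \<Rightarrow> real"
  assumes S: "open S" "x \<in> S" and g: "smooth_on S g"
  shows "frechet_derivative (\<lambda>y. frechet_derivative g (at y) u) (at x) v
       = frechet_derivative (\<lambda>y. frechet_derivative g (at y) v) (at x) u"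
proof (rule ccontr)
  let ?D = "\<lambda>u v x. frechet_derivative (\<lambda>y. frechet_derivative g (at y) u) (at x) v"
  assume ne: "?D u v x \<noteq> ?D v u x"
  define e where "e = \<bar>?D u v x - ?D v u x\<bar> / 2"
  have e: "0 < e" using ne by (simp add: e_def)
  have c: "\<exists>d>0. \<forall>y. dist y x < d \<longrightarrow> y \<in> S \<and> dist (?D u v y) (?D u v x) < e" for u v
  proof -
    have "continuous_on S (?D u v)"
      by (intro smooth_on_continuous_on smooth_on_directional_derivative g)
    then have "continuous (at x) (?D u v)" using S by (simp add: continuous_on_eq_continuous_at)
    then obtain d1 where "d1 > 0" "\<forall>y. dist y x < d1 \<longrightarrow> dist (?D u v y) (?D u v x) < e"
      using e unfolding continuous_at_eps_delta by (metis)
    moreover obtain d2 where "d2 > 0" "\<forall>y. dist y x < d2 \<longrightarrow> y \<in> S"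
      using S unfolding open_dist by blast
    ultimately show ?thesis by (intro exI[of _ "min d1 d2"]) auto
  qed
  obtain d where d: "d > 0" "\<And>y. dist y x < d \<Longrightarrow> y \<in> S"
      "\<And>y. dist y x < d \<Longrightarrow> dist (?D u v y) (?D u v x) < e"
      "\<And>y. dist y x < d \<Longrightarrow> dist (?D v u y) (?D v u x) < e"
  proof -
    obtain d1 d2 where "d1 > 0" "\<forall>y. dist y x < d1 \<longrightarrow> y \<in> S \<and> dist (?D u v y) (?D u v x) < e"
      "d2 > 0" "\<forall>y. dist y x < d2 \<longrightarrow> y \<in> S \<and> dist (?D v u y) (?D v u x) < e"
      using c by meson
    then show ?thesis by (intro that[of "min d1 d2"]) auto
  qed
  \<comment> \<open>small enough for the parallelogram spanned by \<open>h u\<close> and \<open>h v\<close> to stay in the \<open>d\<close>-ball\<close>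
  define h where "h = d / (2 * (norm u + norm v + 1))"
  have pos: "norm u + norm v + 1 > 0" by (smt (verit) norm_ge_zero)
  have h: "h > 0" using d(1) pos by (simp add: h_def)
  have near: "dist (x + s *\<^sub>R u + t *\<^sub>R v) x < d" if "0 \<le> s" "s \<le> h" "0 \<le> t" "t \<le> h" for s t
  proof -
    have "norm (s *\<^sub>R u + t *\<^sub>R v) \<le> s * norm u + t * norm v"
      using norm_triangle_ineq[of "s *\<^sub>R u" "t *\<^sub>R v"] that by simp
    also have "\<dots> \<le> h * norm u + h * norm v"
      using that by (intro add_mono mult_right_mono) auto
    also have "\<dots> \<le> h * (norm u + norm v + 1)" using h by (simp add: algebra_simps)
    also have "\<dots> = d / 2" using pos by (simp add: h_def field_simps)
    also have "\<dots> < d" using d(1) by simp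
    finally show ?thesis by (simp add: dist_norm add.assoc)
  qed
  have dg: "g differentiable (at y)" if "y \<in> S" for y
    using smooth_on_differentiable[OF g that] .
  have ddg: "(\<lambda>y. frechet_derivative g (at y) w) differentiable (at y)" if "y \<in> S" for y w
    using smooth_on_differentiable[OF smooth_on_directional_derivative[OF g] that] .
  obtain s t where st: "0 < s" "s < h" "0 < t" "t < h"
     "g (x + h *\<^sub>R u + h *\<^sub>R v) - g (x + h *\<^sub>R u) - g (x + h *\<^sub>R v) + g x
        = h\<^sup>2 * ?D u v (x + s *\<^sub>R u + t *\<^sub>R v)"
    using second_difference[of h S g u x v] h dg ddg d(2)[OF near] by auto
  have near': "dist (x + s *\<^sub>R v + t *\<^sub>R u) x < d" if "0 \<le> s" "s \<le> h" "0 \<le> t" "t \<le> h" for s t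
    using near[OF that(3,4,1,2)] by (simp add: add.commute add.left_commute add.assoc)
  obtain s' t' where st': "0 < s'" "s' < h" "0 < t'" "t' < h"
     "g (x + h *\<^sub>R v + h *\<^sub>R u) - g (x + h *\<^sub>R v) - g (x + h *\<^sub>R u) + g x
        = h\<^sup>2 * ?D v u (x + s' *\<^sub>R v + t' *\<^sub>R u)"
    using second_difference[of h S g v x u] h dg ddg d(2)[OF near'] by auto
  have "x + h *\<^sub>R v + h *\<^sub>R u = x + h *\<^sub>R u + h *\<^sub>R v" by (simp add: add.assoc add.commute)
  then have "h\<^sup>2 * ?D u v (x + s *\<^sub>R u + t *\<^sub>R v) = h\<^sup>2 * ?D v u (x + s' *\<^sub>R v + t' *\<^sub>R u)"
    using st(5) st'(5) by (simp add: algebra_simps)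
  then have "?D u v (x + s *\<^sub>R u + t *\<^sub>R v) = ?D v u (x + s' *\<^sub>R v + t' *\<^sub>R u)" using h by simp
  moreover have "dist (?D u v (x + s *\<^sub>R u + t *\<^sub>R v)) (?D u v x) < e"
    using d(3) near st by simp
  moreover have "dist (?D v u (x + s' *\<^sub>R v + t' *\<^sub>R u)) (?D v u x) < e"
    using d(4) near' st' by simp
  ultimately show False unfolding dist_real_def e_def by (simp add: abs_if split: if_splits)
qed

lemma frechet_derivative_inner_left:
  assumes "f differentiable (at x)"
  shows "frechet_derivative (\<lambda>y. f y \<bullet> c) (at x) v = frechet_derivative f (at x) v \<bullet> c"
  using frechet_derivative_at[OF bounded_linear.has_derivative[OF bounded_linear_inner_left
        has_derivative_frechet_derivative[OF assms], of c]] by metis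

lemma symmetric_second_derivative:
  fixes f :: "'a::real_normed_vector \<Rightarrow> 'b::real_inner"
  assumes S: "open S" "x \<in> S" and f: "smooth_on S f"
  shows "frechet_derivative (\<lambda>y. frechet_derivative f (at y) u) (at x) v
       = frechet_derivative (\<lambda>y. frechet_derivative f (at y) v) (at x) u"
proof -
  let ?D = "\<lambda>u v. frechet_derivative (\<lambda>y. frechet_derivative f (at y) u) (at x) v"
  have "?D u v \<bullet> c = ?D v u \<bullet> c" for c
  proof -
    have g: "smooth_on S (\<lambda>y. f y \<bullet> c)"
      by (rule smooth_on_bounded_linear_compose[OF bounded_linear_inner_left S(1) f])
    have "?D u v \<bullet> c = frechet_derivative (\<lambda>y. frechet_derivative (\<lambda>y. f y \<bullet> c) (at y) u) (at x) v"
      for u v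
    proof -
      have d: "(\<lambda>y. frechet_derivative f (at y) u) differentiable (at x)"
        by (rule smooth_on_differentiable[OF smooth_on_directional_derivative[OF f] S(2)])
      have "?D u v \<bullet> c = frechet_derivative (\<lambda>y. frechet_derivative f (at y) u \<bullet> c) (at x) v"
        by (simp add: frechet_derivative_inner_left[OF d])
      also have "\<dots> = frechet_derivative (\<lambda>y. frechet_derivative (\<lambda>y. f y \<bullet> c) (at y) u) (at x) v"
        using frechet_derivative_transform_within_open[of "\<lambda>y. frechet_derivative f (at y) u \<bullet> c" x S
            "\<lambda>y. frechet_derivative (\<lambda>y. f y \<bullet> c) (at y) u"] S d
          frechet_derivative_inner_left[OF smooth_on_differentiable[OF f]]
        by (simp add: bounded_linear_inner_left bounded_linear_imp_differentiable
            differentiable_compose[of "\<lambda>z. z \<bullet> c"])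
      finally show ?thesis .
    qed
    then show ?thesis using symmetric_second_derivative_real[OF S g] by metis
  qed
  then have "(?D u v - ?D v u) \<bullet> (?D u v - ?D v u) = 0" by (simp add: inner_diff_left)
  then show ?thesis by simp
qed

subsection \<open>Tangent lifts\<close>

text \<open>The tangent map of \<open>f\<close> in the coordinates (base point, component).\<close>

definition tangent_lift ::
  "('a::real_normed_vector \<Rightarrow> 'b::real_normed_vector) \<Rightarrow> 'a \<times> 'a \<Rightarrow> 'b \<times> 'b" where
  "tangent_lift f = (\<lambda>(x, v). (f x, frechet_derivative f (at x) v))"

text \<open>The outer derivative is taken in the first direction \<open>u\<close>.\<close>

definition second_derivative ::
  "('a::real_normed_vector \<Rightarrow> 'b::real_normed_vector) \<Rightarrow> 'a \<Rightarrow> 'a \<Rightarrow> 'a \<Rightarrow> 'b" where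
  "second_derivative f x u v = frechet_derivative (\<lambda>y. frechet_derivative f (at y) v) (at x) u"

text \<open>The derivative is linear in \<open>v\<close>, so an expansion of \<open>v\<close> in a basis reduces joint smoothness to
  that of the directional derivatives.\<close>

lemma smooth_on_derivative_apply:
  fixes f :: "'a::fd_inner \<Rightarrow> 'b::real_normed_vector"
  assumes S: "open S" and f: "smooth_on S f"
  shows "smooth_on (S \<times> UNIV) (\<lambda>(x, v). frechet_derivative f (at x) v)"
proof -
  obtain B :: "'a set" where B: "finite B" "\<And>x. x = (\<Sum>b\<in>B. ((x \<bullet> b) / (b \<bullet> b)) *\<^sub>R b)"
    using fd_inner_orthogonal_basis by metis
  have o: "open (S \<times> (UNIV :: 'a set))" using S by (simp add: open_Times)
  have "smooth_on (S \<times> UNIV)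
      (\<lambda>z. ((snd z \<bullet> b) / (b \<bullet> b)) *\<^sub>R frechet_derivative f (at (fst z)) b)" for b
  proof (rule smooth_on_scaleR[OF o])
    have "bounded_linear (\<lambda>z :: 'a \<times> 'a. (snd z \<bullet> b) / (b \<bullet> b))"
      by (intro bounded_linear_compose[OF bounded_linear_divide]
          bounded_linear_compose[OF bounded_linear_inner_left bounded_linear_snd])
    then show "smooth_on (S \<times> UNIV) (\<lambda>z :: 'a \<times> 'a. (snd z \<bullet> b) / (b \<bullet> b))"
      by (rule smooth_on_bounded_linear_compose[OF _ o smooth_on_ident])
    show "smooth_on (S \<times> UNIV) (\<lambda>z :: 'a \<times> 'a. frechet_derivative f (at (fst z)) b)"
      by (rule smooth_on_compose[OF o smooth_on_directional_derivative[OF f]])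
         (auto intro: smooth_on_fst[OF o])
  qed
  then have "smooth_on (S \<times> UNIV)
      (\<lambda>z. \<Sum>b\<in>B. ((snd z \<bullet> b) / (b \<bullet> b)) *\<^sub>R frechet_derivative f (at (fst z)) b)"
    unfolding smooth_on_def by (intro allI Ck_on_sum[OF o]) auto
  then show ?thesis
    by (rule smooth_on_cong[OF o, rotated])
       (use linear_basis_expansion[OF frechet_derivative_linear[OF smooth_on_differentiable[OF f]] B(2)]
        in auto)
qed

lemma smooth_on_tangent_lift:
  fixes f :: "'a::fd_inner \<Rightarrow> 'b::real_normed_vector"
  assumes S: "open S" and f: "smooth_on S f"
  shows "smooth_on (S \<times> UNIV) (tangent_lift f)"
proof -
  have o: "open (S \<times> (UNIV :: 'a set))" using S by (simp add: open_Times)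
  have "smooth_on (S \<times> UNIV) (\<lambda>z :: 'a \<times> 'a. f (fst z))"
    by (rule smooth_on_compose[OF o f]) (auto intro: smooth_on_fst[OF o])
  then show ?thesis
    using smooth_on_Pair[OF o _ smooth_on_derivative_apply[OF S f]]
    by (simp add: tangent_lift_def case_prod_unfold)
qed

lemma tangent_lift_compose:
  assumes "g differentiable (at x)" "f differentiable (at (g x))"
  shows "tangent_lift (\<lambda>x. f (g x)) (x, v) = tangent_lift f (tangent_lift g (x, v))"
  using frechet_derivative_compose[OF assms] by (simp add: tangent_lift_def o_def)

lemma tangent_lift_cong:
  assumes "open S" "x \<in> S" "\<And>x. x \<in> S \<Longrightarrow> f x = g x" "f differentiable (at x)"
  shows "tangent_lift f (x, v) = tangent_lift g (x, v)"
  using frechet_derivative_transform_within_open[OF assms(4,1,2,3)] assms(2,3)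
  by (simp add: tangent_lift_def)

text \<open>The derivative of a differentiable map on a product is the sum of the two partial derivatives.
  The second one is immediate because the map is linear in \<open>v\<close>.\<close>

lemma has_derivative_derivative_apply:
  fixes f :: "'a::fd_inner \<Rightarrow> 'b::real_normed_vector"
  assumes S: "open S" "x \<in> S" and f: "smooth_on S f"
  shows "((\<lambda>(x, v). frechet_derivative f (at x) v) has_derivative
     (\<lambda>(x', v'). second_derivative f x x' v + frechet_derivative f (at x) v')) (at (x, v))"
proof -
  let ?g = "\<lambda>z. frechet_derivative f (at (fst z)) (snd z)"
  have "(\<lambda>(x, v). frechet_derivative f (at x) v) = ?g" by auto
  with smooth_on_has_derivative[OF smooth_on_derivative_apply[OF S(1) f], of "(x, v)"]
  have g: "(?g has_derivative frechet_derivative ?g (at (x, v))) (at (x, v))" using S by simp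
  note lin = has_derivative_linear[OF g]
  have "frechet_derivative ?g (at (x, v)) (x', v')
      = second_derivative f x x' v + frechet_derivative f (at x) v'" for x' v'
  proof -
    have "((\<lambda>y. ?g (y, v)) has_derivative (\<lambda>x'. frechet_derivative ?g (at (x, v)) (x', 0))) (at x)"
      by (rule has_derivative_compose[of "\<lambda>y. (y, v)" "\<lambda>y'. (y', 0)" x UNIV ?g, OF _ g])
         (auto intro!: derivative_eq_intros)
    then have 1: "frechet_derivative ?g (at (x, v)) (x', 0) = second_derivative f x x' v"
      unfolding second_derivative_def by (auto dest: frechet_derivative_at intro: fun_cong)
    have "((\<lambda>w. ?g (x, w)) has_derivative (\<lambda>v'. frechet_derivative ?g (at (x, v)) (0, v'))) (at v)"
      by (rule has_derivative_compose[of "\<lambda>w. (x, w)" "\<lambda>w'. (0, w')" v UNIV ?g, OF _ g])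
         (auto intro!: derivative_eq_intros)
    moreover have "((\<lambda>w. ?g (x, w)) has_derivative frechet_derivative f (at x)) (at v)"
      using bounded_linear_imp_has_derivative[OF has_derivative_bounded_linear[OF
            smooth_on_has_derivative[OF f S(2)]]] by simp
    ultimately have 2: "frechet_derivative ?g (at (x, v)) (0, v') = frechet_derivative f (at x) v'"
      by (rule has_derivative_unique[THEN fun_cong])
    show ?thesis using linear_add[OF lin, of "(x', 0)" "(0, v')"] 1 2 by simp
  qed
  then have "frechet_derivative ?g (at (x, v)) =
     (\<lambda>(x', v'). second_derivative f x x' v + frechet_derivative f (at x) v')" by auto
  with g show ?thesis by (simp add: case_prod_unfold)
qed

lemma has_derivative_derivative_apply_along:
  fixes f :: "'a::fd_inner \<Rightarrow> 'b::real_normed_vector"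
  assumes S: "open S" "a z \<in> S" and f: "smooth_on S f"
    and a: "(a has_derivative a') (at z)" and b: "(b has_derivative b') (at z)"
  shows "((\<lambda>z. frechet_derivative f (at (a z)) (b z)) has_derivative
     (\<lambda>h. second_derivative f (a z) (a' h) (b z) + frechet_derivative f (at (a z)) (b' h))) (at z)"
  using has_derivative_compose[OF has_derivative_Pair[OF a b] has_derivative_derivative_apply[OF S f]]
  by simp

lemma has_derivative_tangent_lift:
  fixes f :: "'a::fd_inner \<Rightarrow> 'b::real_normed_vector"
  assumes S: "open S" "x \<in> S" and f: "smooth_on S f"
  shows "(tangent_lift f has_derivative (\<lambda>(x', v'). (frechet_derivative f (at x) x',
     second_derivative f x x' v + frechet_derivative f (at x) v'))) (at (x, v))"
proof -
  have 1: "((\<lambda>z. f (fst z)) has_derivative (\<lambda>z. frechet_derivative f (at x) (fst z))) (at (x, v))"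
    by (rule has_derivative_compose[of fst fst "(x, v)" UNIV f])
       (auto intro!: derivative_eq_intros smooth_on_has_derivative[OF f S(2)])
  show ?thesis
    using has_derivative_Pair[OF 1 has_derivative_derivative_apply[OF S f, of v]]
    by (simp add: tangent_lift_def case_prod_unfold)
qed

lemma tangent_lift_tangent_lift:
  fixes f :: "'a::fd_inner \<Rightarrow> 'b::real_normed_vector"
  assumes "open S" "x \<in> S" "smooth_on S f"
  shows "tangent_lift (tangent_lift f) ((x, v), (x', v')) =
     ((f x, frechet_derivative f (at x) v),
      (frechet_derivative f (at x) x', second_derivative f x x' v + frechet_derivative f (at x) v'))"
  using frechet_derivative_at[OF has_derivative_tangent_lift[OF assms, of v], symmetric]
  by (simp add: tangent_lift_def)

lemma second_derivative_commute:
  fixes f :: "'a::real_normed_vector \<Rightarrow> 'b::real_inner"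
  assumes "open S" "x \<in> S" "smooth_on S f"
  shows "second_derivative f x u v = second_derivative f x v u"
  unfolding second_derivative_def by (rule symmetric_second_derivative[OF assms])

text \<open>The canonical involution of a second tangent bundle in coordinates.\<close>

definition flip :: "('a \<times> 'a) \<times> ('a \<times> 'a) \<Rightarrow> ('a \<times> 'a) \<times> ('a \<times> 'a)" where
  "flip = (\<lambda>((x, v), (x', v')). ((x, x'), (v, v')))"

lemma flip_simp [simp]: "flip ((x, v), (x', v')) = ((x, x'), (v, v'))"
  by (simp add: flip_def)

lemma flip_flip [simp]: "flip (flip z) = z"
  by (simp add: flip_def case_prod_unfold)

text \<open>The two sides differ in the order of the directions in a second derivative. This naturality
  makes the canonical involution independent of the chart.\<close>

lemma tangent_lift_flip:
  fixes f :: "'a::fd_inner \<Rightarrow> 'b::real_inner"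
  assumes S: "open S" "fst (fst z) \<in> S" "smooth_on S f"
  shows "tangent_lift (tangent_lift f) (flip z) = flip (tangent_lift (tangent_lift f) z)"
proof -
  obtain x v x' v' where "z = ((x, v), (x', v'))" by (metis surj_pair)
  then show ?thesis
    using assms by (simp add: tangent_lift_tangent_lift[of S] second_derivative_commute[of S x f v x'])
qed

section \<open>Smooth maps in charts\<close>

text \<open>The conditions on the charts of a manifold, which are the ones that coordinate computations rely
  on and which pass to the tangent bundle by a formula for the transition maps.\<close>

definition smooth_atlas :: "('a, 'e::fd_inner) atlas \<Rightarrow> bool" where
  "smooth_atlas M \<longleftrightarrow>
     (\<forall>(U, \<phi>)\<in>M. inj_on \<phi> U \<and> open (\<phi> ` U)) \<and>
     (\<forall>(U, \<phi>)\<in>M. \<forall>(V, \<psi>)\<in>M. open (\<phi> ` (U \<inter> V)) \<and>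
        smooth_on (\<phi> ` (U \<inter> V)) (\<psi> \<circ> inv_into U \<phi>))"

lemma smooth_manifold_imp_smooth_atlas: "smooth_manifold M \<Longrightarrow> smooth_atlas M"
  by (auto simp: smooth_manifold_def smooth_atlas_def)

lemma smooth_atlasD:
  assumes "smooth_atlas M" "(U, \<phi>) \<in> M"
  shows "inj_on \<phi> U" "open (\<phi> ` U)"
    "(V, \<psi>) \<in> M \<Longrightarrow> open (\<phi> ` (U \<inter> V))"
    "(V, \<psi>) \<in> M \<Longrightarrow> smooth_on (\<phi> ` (U \<inter> V)) (\<psi> \<circ> inv_into U \<phi>)"
  using assms unfolding smooth_atlas_def by fast+

lemma carrierE:
  assumes "p \<in> carrier M"
  obtains U \<phi> where "(U, \<phi>) \<in> M" "p \<in> U"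
  using assms by (auto simp: carrier_def)

lemma carrierI: "(U, \<phi>) \<in> M \<Longrightarrow> p \<in> U \<Longrightarrow> p \<in> carrier M"
  by (force simp: carrier_def)

text \<open>In the charts \<open>\<phi>\<close> and \<open>\<psi>\<close>, the map \<open>F\<close> extends the expression of \<open>f\<close> from the image of \<open>S\<close> to the
  open set \<open>W\<close>.\<close>

definition local_expression ::
  "('a, 'e::fd_inner) atlas \<Rightarrow> 'a set \<Rightarrow> ('b, 'f::fd_inner) atlas \<Rightarrow> ('a \<Rightarrow> 'b) \<Rightarrow>
   'a set \<Rightarrow> ('a \<Rightarrow> 'e) \<Rightarrow> 'b set \<Rightarrow> ('b \<Rightarrow> 'f) \<Rightarrow> 'e set \<Rightarrow> ('e \<Rightarrow> 'f) \<Rightarrow> bool" where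
  "local_expression M S N f U \<phi> V \<psi> W F \<longleftrightarrow>
     (U, \<phi>) \<in> M \<and> (V, \<psi>) \<in> N \<and> open W \<and> W \<subseteq> \<phi> ` U \<and> smooth_on W F \<and>
     (\<forall>x\<in>S \<inter> U. \<phi> x \<in> W \<longrightarrow> f x \<in> V \<and> \<psi> (f x) = F (\<phi> x))"

lemma local_expressionD:
  assumes "local_expression M S N f U \<phi> V \<psi> W F"
  shows "(U, \<phi>) \<in> M" "(V, \<psi>) \<in> N" "open W" "W \<subseteq> \<phi> ` U" "smooth_on W F"
    "x \<in> S \<Longrightarrow> x \<in> U \<Longrightarrow> \<phi> x \<in> W \<Longrightarrow> f x \<in> V"
    "x \<in> S \<Longrightarrow> x \<in> U \<Longrightarrow> \<phi> x \<in> W \<Longrightarrow> \<psi> (f x) = F (\<phi> x)"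
  using assms unfolding local_expression_def by auto

lemma smooth_map_on_iff_local_expression:
  "smooth_map_on M S N f \<longleftrightarrow>
     (\<forall>p\<in>S. \<exists>U \<phi> V \<psi> W F. p \<in> U \<and> \<phi> p \<in> W \<and> local_expression M S N f U \<phi> V \<psi> W F)"
  unfolding smooth_map_on_def local_expression_def
  by (rule ball_cong[OF refl], unfold Bex_def split_paired_Ex case_prod_conv) blast

lemma local_expression_exI:
  assumes "local_expression M S N f U \<phi> V \<psi> W F" "p \<in> U" "\<phi> p \<in> W"
  shows "\<exists>U \<phi> V \<psi> W F. p \<in> U \<and> \<phi> p \<in> W \<and> local_expression M S N f U \<phi> V \<psi> W F"
  by (intro exI[of _ U] exI[of _ \<phi>] exI[of _ V] exI[of _ \<psi>] exI[of _ W] exI[of _ F] conjI assms)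

lemma smooth_map_onE:
  assumes "smooth_map_on M S N f" "p \<in> S"
  obtains U \<phi> V \<psi> W F where "p \<in> U" "\<phi> p \<in> W" "local_expression M S N f U \<phi> V \<psi> W F"
  using assms unfolding smooth_map_on_iff_local_expression by meson

lemma local_expression_subset:
  "local_expression M S N f U \<phi> V \<psi> W F \<Longrightarrow> T \<subseteq> S \<Longrightarrow> local_expression M T N f U \<phi> V \<psi> W F"
  unfolding local_expression_def by blast

lemma local_expression_cong:
  "local_expression M S N f U \<phi> V \<psi> W F \<Longrightarrow> (\<And>x. x \<in> S \<Longrightarrow> f x = g x) \<Longrightarrow>
   local_expression M S N g U \<phi> V \<psi> W F"
  unfolding local_expression_def by auto

lemma local_expression_restrict:
  "local_expression M S N f U \<phi> V \<psi> W F \<Longrightarrow> open W' \<Longrightarrow> W' \<subseteq> W \<Longrightarrow>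
   local_expression M S N f U \<phi> V \<psi> W' F"
  unfolding local_expression_def using smooth_on_subset by blast

lemma smooth_map_on_subset: "smooth_map_on M S N f \<Longrightarrow> T \<subseteq> S \<Longrightarrow> smooth_map_on M T N f"
  unfolding smooth_map_on_iff_local_expression using local_expression_subset by (meson subsetD)

lemma smooth_map_on_cong:
  "smooth_map_on M S N f \<Longrightarrow> (\<And>x. x \<in> S \<Longrightarrow> f x = g x) \<Longrightarrow> smooth_map_on M S N g"
  unfolding smooth_map_on_iff_local_expression using local_expression_cong by meson

lemma smooth_map_on_carrier:
  assumes "smooth_map_on M S N f" "p \<in> S"
  shows "f p \<in> carrier N" "p \<in> carrier M"
  using assms unfolding smooth_map_on_iff_local_expression
  by (metis carrierI local_expressionD(1,2,6))+

lemma open_preimage_in: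
  "open W \<Longrightarrow> continuous_on W F \<Longrightarrow> open W' \<Longrightarrow> open {z \<in> W. F z \<in> W'}"
  using continuous_on_open_vimage[of W F] by (simp add: vimage_def Int_def conj_commute)

lemma local_expression_compose:
  assumes f: "local_expression M S N f U \<phi> V \<psi> W F"
    and g: "local_expression N T K g V \<psi> X \<theta> Y H" and sub: "f ` S \<subseteq> T"
  shows "local_expression M S K (\<lambda>x. g (f x)) U \<phi> X \<theta> {z \<in> W. F z \<in> Y} (\<lambda>z. H (F z))"
proof -
  note f' = local_expressionD[OF f] and g' = local_expressionD[OF g]
  have o: "open {z \<in> W. F z \<in> Y}"
    using open_preimage_in[OF f'(3) smooth_on_continuous_on[OF f'(5)] g'(3)] .
  have "smooth_on {z \<in> W. F z \<in> Y} (\<lambda>z. H (F z))"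
    by (rule smooth_on_compose[OF o g'(5) smooth_on_subset[OF f'(5)]]) auto
  then show ?thesis
    unfolding local_expression_def using f' g' o sub by auto
qed

lemma local_expression_transition:
  assumes M: "smooth_atlas M" and "(U, \<phi>) \<in> M" "(V, \<psi>) \<in> M"
  shows "local_expression M S M (\<lambda>x. x) U \<phi> V \<psi> (\<phi> ` (U \<inter> V)) (\<psi> \<circ> inv_into U \<phi>)"
proof -
  note c = smooth_atlasD[OF M assms(2)]
  have "x \<in> V \<and> \<psi> x = (\<psi> \<circ> inv_into U \<phi>) (\<phi> x)" if "x \<in> U" "\<phi> x \<in> \<phi> ` (U \<inter> V)" for x
    using c(1) that by (auto dest: inj_onD)
  then show ?thesis
    unfolding local_expression_def using assms c(3,4)[OF assms(3)] by auto
qed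

text \<open>The definition of smoothness provides an expression in some charts; transition maps carry it to
  any other ones.\<close>

lemma smooth_map_on_local_expression:
  assumes M: "smooth_atlas M" and N: "smooth_atlas N" and f: "smooth_map_on M S N f"
    and p: "p \<in> S" and U: "(U, \<phi>) \<in> M" "p \<in> U" and V: "(V, \<psi>) \<in> N" "f p \<in> V"
  obtains W F where "\<phi> p \<in> W" "local_expression M S N f U \<phi> V \<psi> W F"
proof -
  obtain U0 \<phi>0 V0 \<psi>0 W0 F0 where 0: "p \<in> U0" "\<phi>0 p \<in> W0"
    and e: "local_expression M S N f U0 \<phi>0 V0 \<psi>0 W0 F0"
    using f p by (rule smooth_map_onE)
  note e' = local_expressionD[OF e]
  have e1: "local_expression M S N f U \<phi> V0 \<psi>0
      {z \<in> \<phi> ` (U \<inter> U0). (\<phi>0 \<circ> inv_into U \<phi>) z \<in> W0} (\<lambda>z. F0 ((\<phi>0 \<circ> inv_into U \<phi>) z))"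
    using local_expression_compose[OF local_expression_transition[OF M U(1) e'(1)] e] by auto
  let ?W1 = "{z \<in> \<phi> ` (U \<inter> U0). (\<phi>0 \<circ> inv_into U \<phi>) z \<in> W0}"
  have i: "inv_into U \<phi> (\<phi> p) = p" using smooth_atlasD(1)[OF M U(1)] U(2) by simp
  have m1: "\<phi> p \<in> ?W1" using 0 U(2) i by auto
  note e1' = local_expressionD[OF e1]
  have fp: "\<psi>0 (f p) = F0 ((\<phi>0 \<circ> inv_into U \<phi>) (\<phi> p))" "f p \<in> V0"
    using e1'(6,7)[OF p U(2) m1] by auto
  show ?thesis
    by (rule that[OF _ local_expression_compose[OF e1 local_expression_transition[OF N e'(2) V(1), of UNIV]]])
       (use m1 fp V(2) in \<open>auto intro!: image_eqI[of _ _ "f p"]\<close>)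
qed

lemma smooth_map_on_compose:
  assumes M: "smooth_atlas M" and N: "smooth_atlas N"
    and f: "smooth_map_on M S N f" and g: "smooth_map_on N T K g" and sub: "f ` S \<subseteq> T"
  shows "smooth_map_on M S K (\<lambda>x. g (f x))"
  unfolding smooth_map_on_iff_local_expression
proof
  fix p assume p: "p \<in> S"
  then have "f p \<in> T" using sub by auto
  with g obtain V \<psi> X \<theta> Y H
    where g': "f p \<in> V" "\<psi> (f p) \<in> Y" "local_expression N T K g V \<psi> X \<theta> Y H"
    by (rule smooth_map_onE)
  obtain U \<phi> where U: "(U, \<phi>) \<in> M" "p \<in> U"
    using smooth_map_on_carrier(2)[OF f p] by (rule carrierE)
  obtain W F where W: "\<phi> p \<in> W" "local_expression M S N f U \<phi> V \<psi> W F"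
    using smooth_map_on_local_expression[OF M N f p U local_expressionD(1)[OF g'(3)] g'(1)] by blast
  have m: "\<phi> p \<in> {z \<in> W. F z \<in> Y}"
    using W g' local_expressionD(7)[OF W(2) p U(2) W(1)] by auto
  show "\<exists>U \<phi> V \<psi> W F. p \<in> U \<and> \<phi> p \<in> W \<and> local_expression M S K (\<lambda>x. g (f x)) U \<phi> V \<psi> W F"
    by (rule local_expression_exI[OF local_expression_compose[OF W(2) g'(3) sub] U(2) m])
qed

section \<open>Curves and velocities\<close>

lemma smooth_atlas_real_line: "smooth_atlas real_line"
proof -
  have "smooth_on UNIV ((\<lambda>t. t) \<circ> inv_into UNIV (\<lambda>t :: real. t))"
    by (rule smooth_on_cong[OF open_UNIV _ smooth_on_ident]) (simp add: inv_into_f_f)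
  then show ?thesis by (simp add: smooth_atlas_def real_line_def)
qed

lemma curve_in_chart:
  assumes M: "smooth_atlas M" and \<gamma>: "curve_in M S \<gamma>" and U: "(U, \<phi>) \<in> M" "\<gamma> 0 \<in> U"
  obtains e where "e > 0" "\<And>t. \<bar>t\<bar> < e \<Longrightarrow> \<gamma> t \<in> S" "\<And>t. \<bar>t\<bar> < e \<Longrightarrow> \<gamma> t \<in> U"
    "smooth_on {-e<..<e} (\<phi> \<circ> \<gamma>)"
proof -
  obtain e0 where e0: "e0 > 0" "\<gamma> ` {-e0<..<e0} \<subseteq> S" "smooth_map_on real_line {-e0<..<e0} M \<gamma>"
    using \<gamma> unfolding curve_in_def by blast
  have l: "(UNIV, \<lambda>t. t) \<in> real_line" by (simp add: real_line_def)
  obtain W F where W: "0 \<in> W"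
    "local_expression real_line {-e0<..<e0} M \<gamma> UNIV (\<lambda>t. t) U \<phi> W F"
    using smooth_map_on_local_expression[OF smooth_atlas_real_line M e0(3) _ l _ U] e0(1) by auto
  note W' = local_expressionD[OF W(2)]
  obtain e1 where e1: "e1 > 0" "\<And>t. \<bar>t\<bar> < e1 \<Longrightarrow> t \<in> W"
    using W'(3) W(1) unfolding open_dist by (force simp: dist_real_def)
  let ?e = "min e0 e1"
  have in_W: "t \<in> W" "t \<in> {-e0<..<e0}" if "\<bar>t\<bar> < ?e" for t using e1(2) that by auto
  have ab: "\<bar>t\<bar> < ?e" if "t \<in> {-?e<..<?e}" for t using that by (auto simp only: abs_less_iff greaterThanLessThan_iff)
  have "smooth_on {-?e<..<?e} (\<phi> \<circ> \<gamma>)"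
  proof (rule smooth_on_cong[OF open_greaterThanLessThan])
    show "smooth_on {-?e<..<?e} F"
      by (rule smooth_on_subset[OF W'(5)]) (use in_W(1) ab in blast)
    show "F t = (\<phi> \<circ> \<gamma>) t" if "t \<in> {-?e<..<?e}" for t
      using W'(7)[of t] in_W[OF ab[OF that]] by simp
  qed
  moreover have "\<gamma> t \<in> S" "\<gamma> t \<in> U" if "\<bar>t\<bar> < ?e" for t
    using e0(2) in_W[OF that] W'(6)[of t] by auto
  ultimately show ?thesis using that[of ?e] e0(1) e1(1) by auto
qed

lemma curve_inI:
  assumes "(U, \<phi>) \<in> M" "e > 0" "\<And>t. \<bar>t\<bar> < e \<Longrightarrow> \<gamma> t \<in> S" "\<And>t. \<bar>t\<bar> < e \<Longrightarrow> \<gamma> t \<in> U"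
    "smooth_on {-e<..<e} (\<phi> \<circ> \<gamma>)"
  shows "curve_in M S \<gamma>"
proof -
  have "local_expression real_line {-e<..<e} M \<gamma> UNIV (\<lambda>t. t) U \<phi> {-e<..<e} (\<phi> \<circ> \<gamma>)"
    using assms unfolding local_expression_def by (auto simp: real_line_def abs_less_iff)
  then have "smooth_map_on real_line {-e<..<e} M \<gamma>"
    unfolding smooth_map_on_iff_local_expression
    by (intro ballI local_expression_exI) (auto intro: UNIV_I)
  then show ?thesis
    unfolding curve_in_def using assms(2,3) by (intro exI[of _ e]) (auto simp: abs_less_iff)
qed

lemma curve_in_carrier:
  assumes "curve_in M S \<gamma>"
  shows "curve_in M (carrier M) \<gamma>" "\<gamma> 0 \<in> carrier M" "\<gamma> 0 \<in> S"
proof -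
  obtain e where e: "e > 0" "\<gamma> ` {-e<..<e} \<subseteq> S" "smooth_map_on real_line {-e<..<e} M \<gamma>"
    using assms unfolding curve_in_def by blast
  have "\<gamma> ` {-e<..<e} \<subseteq> carrier M" using smooth_map_on_carrier(1)[OF e(3)] by blast
  then show "curve_in M (carrier M) \<gamma>" "\<gamma> 0 \<in> carrier M" "\<gamma> 0 \<in> S"
    using e unfolding curve_in_def by auto
qed

lemma curve_in_compose:
  assumes M: "smooth_atlas M"
    and \<gamma>: "curve_in M S \<gamma>" and f: "smooth_map_on M S N f" and sub: "f ` S \<subseteq> T"
  shows "curve_in N T (f \<circ> \<gamma>)"
proof -
  obtain e where e: "e > 0" "\<gamma> ` {-e<..<e} \<subseteq> S" "smooth_map_on real_line {-e<..<e} M \<gamma>"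
    using \<gamma> unfolding curve_in_def by blast
  show ?thesis
    unfolding curve_in_def using e sub smooth_map_on_compose[OF smooth_atlas_real_line M e(3) f e(2)]
    by (intro exI[of _ e]) (auto simp: o_def)
qed

lemma curve_in_cong:
  assumes "curve_in M S \<gamma>" "e > 0" "\<And>t. \<bar>t\<bar> < e \<Longrightarrow> \<gamma> t = \<delta> t"
  shows "curve_in M S \<delta>"
proof -
  obtain e0 where e0: "e0 > 0" "\<gamma> ` {-e0<..<e0} \<subseteq> S" "smooth_map_on real_line {-e0<..<e0} M \<gamma>"
    using assms unfolding curve_in_def by blast
  let ?e = "min e e0"
  have "smooth_map_on real_line {-?e<..<?e} M \<delta>"
    by (rule smooth_map_on_cong[OF smooth_map_on_subset[OF e0(3)]])
       (use assms(3) in \<open>auto simp: abs_less_iff\<close>)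
  moreover have "\<delta> ` {-?e<..<?e} \<subseteq> S"
  proof clarify
    fix t assume t: "t \<in> {-?e<..<?e}"
    then have "\<gamma> t = \<delta> t" by (intro assms(3)) (auto simp: abs_less_iff)
    moreover have "\<gamma> t \<in> S" using e0(2) t by auto
    ultimately show "\<delta> t \<in> S" by simp
  qed
  ultimately show ?thesis unfolding curve_in_def using assms(2) e0(1) by (intro exI[of _ ?e]) auto
qed

lemma curve_in_has_vector_derivative:
  assumes "smooth_atlas M" "curve_in M S \<gamma>" "(U, \<phi>) \<in> M" "\<gamma> 0 \<in> U"
  shows "((\<phi> \<circ> \<gamma>) has_vector_derivative vector_derivative (\<phi> \<circ> \<gamma>) (at 0)) (at 0)"
proof -
  obtain e where "e > 0" "smooth_on {-e<..<e} (\<phi> \<circ> \<gamma>)"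
    using curve_in_chart[OF assms] by metis
  then show ?thesis using smooth_on_differentiable[of "{-e<..<e}" "\<phi> \<circ> \<gamma>" 0]
    by (simp add: vector_derivative_works)
qed

lemma has_vector_derivative_compose:
  assumes c: "(c has_vector_derivative c') (at t)" and F: "(F has_derivative F') (at (c t))"
  shows "((\<lambda>s. F (c s)) has_vector_derivative F' c') (at t)"
proof -
  have "((\<lambda>s. F (c s)) has_derivative (\<lambda>s. F' (s *\<^sub>R c'))) (at t)"
    by (rule has_derivative_compose[OF c[unfolded has_vector_derivative_def] F])
  then show ?thesis
    unfolding has_vector_derivative_def by (simp add: linear_cmul[OF has_derivative_linear[OF F]])
qed

text \<open>The chain rule in charts. Transition maps, as expressions of the identity, give the
  transformation of velocities.\<close>

lemma local_expression_vector_derivative: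
  assumes M: "smooth_atlas M" and f: "local_expression M S N f U \<phi> V \<psi> W F"
    and \<gamma>: "curve_in M S \<gamma>" "\<gamma> 0 \<in> U" "\<phi> (\<gamma> 0) \<in> W"
  shows "vector_derivative (\<psi> \<circ> (f \<circ> \<gamma>)) (at 0) =
    frechet_derivative F (at (\<phi> (\<gamma> 0))) (vector_derivative (\<phi> \<circ> \<gamma>) (at 0))"
proof -
  note f' = local_expressionD[OF f]
  obtain e where e: "e > 0" "\<And>t. \<bar>t\<bar> < e \<Longrightarrow> \<gamma> t \<in> S" "\<And>t. \<bar>t\<bar> < e \<Longrightarrow> \<gamma> t \<in> U"
    "smooth_on {-e<..<e} (\<phi> \<circ> \<gamma>)" using curve_in_chart[OF M \<gamma>(1) f'(1) \<gamma>(2)] by metis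
  have d: "((\<lambda>s. F ((\<phi> \<circ> \<gamma>) s)) has_vector_derivative
      frechet_derivative F (at (\<phi> (\<gamma> 0))) (vector_derivative (\<phi> \<circ> \<gamma>) (at 0))) (at 0)"
    by (rule has_vector_derivative_compose[OF curve_in_has_vector_derivative[OF M \<gamma>(1) f'(1) \<gamma>(2)]])
       (use smooth_on_has_derivative[OF f'(5) \<gamma>(3)] in simp)
  have o: "open {t \<in> {-e<..<e}. (\<phi> \<circ> \<gamma>) t \<in> W}"
    by (rule open_preimage_in[OF _ smooth_on_continuous_on[OF e(4)] f'(3)]) simp
  have "((\<psi> \<circ> (f \<circ> \<gamma>)) has_vector_derivative
      frechet_derivative F (at (\<phi> (\<gamma> 0))) (vector_derivative (\<phi> \<circ> \<gamma>) (at 0))) (at 0)"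
    by (rule has_vector_derivative_transform_within_open[OF d o])
       (use e \<gamma>(3) f'(7) in \<open>auto simp: abs_less_iff\<close>)
  then show ?thesis by (rule vector_derivative_at)
qed

lemma foot_velocity: "curve_in M S \<gamma> \<Longrightarrow> foot (velocity M \<gamma>) = \<gamma> 0"
  unfolding foot_def
  by (rule the_equality) (auto simp: velocity_def intro!: bexI[of _ \<gamma>] dest: curve_in_carrier(1))

lemma velocity_self: "curve_in M S \<gamma> \<Longrightarrow> \<gamma> \<in> velocity M \<gamma>"
  by (auto simp: velocity_def dest: curve_in_carrier(1))

lemma tangent_component_velocity:
  assumes "curve_in M S \<gamma>" "(U, \<phi>) \<in> M" "\<gamma> 0 \<in> U"
  shows "tangent_component \<phi> (velocity M \<gamma>) = vector_derivative (\<phi> \<circ> \<gamma>) (at 0)"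
  unfolding tangent_component_def
  by (rule the_equality) (use assms velocity_self in \<open>auto simp: velocity_def\<close>)

lemma tangent_coords_velocity:
  assumes "curve_in M S \<gamma>" "(U, \<phi>) \<in> M" "\<gamma> 0 \<in> U"
  shows "tangent_coords \<phi> (velocity M \<gamma>) = (\<phi> (\<gamma> 0), vector_derivative (\<phi> \<circ> \<gamma>) (at 0))"
  unfolding tangent_coords_def
  using tangent_component_velocity[OF assms] foot_velocity[OF assms(1)] by simp

text \<open>Agreement in one chart suffices, since the velocities in any other chart are obtained by
  applying the same derivative of a transition map.\<close>

lemma velocity_eq_iff:
  assumes M: "smooth_atlas M" and \<gamma>: "curve_in M S \<gamma>" and \<delta>: "curve_in M T \<delta>"
    and U: "(U, \<phi>) \<in> M" "\<gamma> 0 \<in> U"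
  shows "velocity M \<gamma> = velocity M \<delta> \<longleftrightarrow>
    \<gamma> 0 = \<delta> 0 \<and> vector_derivative (\<phi> \<circ> \<gamma>) (at 0) = vector_derivative (\<phi> \<circ> \<delta>) (at 0)"
proof
  assume eq: "velocity M \<gamma> = velocity M \<delta>"
  then have "\<gamma> 0 = \<delta> 0" using foot_velocity \<gamma> \<delta> by metis
  then show "\<gamma> 0 = \<delta> 0 \<and> vector_derivative (\<phi> \<circ> \<gamma>) (at 0) = vector_derivative (\<phi> \<circ> \<delta>) (at 0)"
    using eq tangent_component_velocity \<gamma> \<delta> U by metis
next
  assume eq: "\<gamma> 0 = \<delta> 0 \<and> vector_derivative (\<phi> \<circ> \<gamma>) (at 0) = vector_derivative (\<phi> \<circ> \<delta>) (at 0)"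
  have "vector_derivative (\<psi> \<circ> \<gamma>) (at 0) = vector_derivative (\<psi> \<circ> \<delta>) (at 0)"
    if V: "(V, \<psi>) \<in> M" "\<gamma> 0 \<in> V" for V \<psi>
    using local_expression_vector_derivative[OF M local_expression_transition[OF M U(1) V(1)] \<gamma>]
      local_expression_vector_derivative[OF M local_expression_transition[OF M U(1) V(1)] \<delta>]
      eq U(2) V(2) by (simp add: o_def)
  then show "velocity M \<gamma> = velocity M \<delta>"
    unfolding velocity_def using eq by auto
qed

lemma velocity_mem: "curve_in M S \<gamma> \<Longrightarrow> velocity M \<gamma> \<in> tangent_on M S"
  by (auto simp: tangent_on_def)

lemma tangent_onE:
  assumes "v \<in> tangent_on M S"
  obtains \<gamma> where "curve_in M S \<gamma>" "v = velocity M \<gamma>"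
  using assms by (auto simp: tangent_on_def)

lemma foot_mem:
  assumes "v \<in> tangent_on M S"
  shows "foot v \<in> S" "foot v \<in> carrier M"
  using assms by (metis tangent_onE foot_velocity curve_in_carrier(2,3))+

lemma tangent_on_subset: "tangent_on M S \<subseteq> tangent_vectors M"
  unfolding tangent_on_def using curve_in_carrier(1) by blast

lemma mem_tangent_vector:
  assumes "v \<in> tangent_vectors M" "\<gamma> \<in> v"
  shows "curve_in M (carrier M) \<gamma>" "v = velocity M \<gamma>"
proof -
  obtain \<delta> where \<delta>: "curve_in M (carrier M) \<delta>" "v = velocity M \<delta>" using assms(1) by (rule tangent_onE)
  then have \<gamma>: "curve_in M (carrier M) \<gamma>" "\<gamma> 0 = \<delta> 0"
    "\<And>U \<phi>. (U, \<phi>) \<in> M \<Longrightarrow> \<delta> 0 \<in> U \<Longrightarrow>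
      vector_derivative (\<phi> \<circ> \<gamma>) (at 0) = vector_derivative (\<phi> \<circ> \<delta>) (at 0)"
    using assms(2) by (auto simp: velocity_def)
  then have "velocity M \<delta> = velocity M \<gamma>"
    unfolding velocity_def by (intro Collect_cong conj_cong refl ball_cong) auto
  then show "curve_in M (carrier M) \<gamma>" "v = velocity M \<gamma>" using \<gamma>(1) \<delta>(2) by simp_all
qed

lemma velocity_cong:
  assumes M: "smooth_atlas M" and \<gamma>: "curve_in M S \<gamma>" and e: "e > 0" "\<And>t. \<bar>t\<bar> < e \<Longrightarrow> \<gamma> t = \<delta> t"
  shows "velocity M \<gamma> = velocity M \<delta>"
proof -
  obtain U \<phi> where U: "(U, \<phi>) \<in> M" "\<gamma> 0 \<in> U" using curve_in_carrier(2)[OF \<gamma>] by (rule carrierE)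
  have "((\<phi> \<circ> \<delta>) has_vector_derivative vector_derivative (\<phi> \<circ> \<gamma>) (at 0)) (at 0)"
    by (rule has_vector_derivative_transform_within_open[OF
          curve_in_has_vector_derivative[OF M \<gamma> U], of "{-e<..<e}"])
       (use e in \<open>auto simp: abs_less_iff\<close>)
  then show ?thesis
    using velocity_eq_iff[OF M \<gamma> curve_in_cong[OF \<gamma> e] U] e by (simp add: vector_derivative_at)
qed

lemma tangent_ext:
  assumes M: "smooth_atlas M" and v: "v \<in> tangent_vectors M" and w: "w \<in> tangent_vectors M"
    and U: "(U, \<phi>) \<in> M" "foot v \<in> U" "foot w \<in> U" and eq: "tangent_coords \<phi> v = tangent_coords \<phi> w"
  shows "v = w"
proof -
  obtain \<gamma> where \<gamma>: "curve_in M (carrier M) \<gamma>" "v = velocity M \<gamma>" using v by (rule tangent_onE)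
  obtain \<delta> where \<delta>: "curve_in M (carrier M) \<delta>" "w = velocity M \<delta>" using w by (rule tangent_onE)
  have 0: "\<gamma> 0 \<in> U" "\<delta> 0 \<in> U" using U \<gamma> \<delta> foot_velocity by metis+
  have "\<phi> (\<gamma> 0) = \<phi> (\<delta> 0)" "vector_derivative (\<phi> \<circ> \<gamma>) (at 0) = vector_derivative (\<phi> \<circ> \<delta>) (at 0)"
    using eq tangent_coords_velocity[OF \<gamma>(1) U(1) 0(1)] tangent_coords_velocity[OF \<delta>(1) U(1) 0(2)] \<gamma> \<delta>
    by auto
  then show ?thesis
    using velocity_eq_iff[OF M \<gamma>(1) \<delta>(1) U(1) 0(1)] smooth_atlasD(1)[OF M U(1)] 0 \<gamma>(2) \<delta>(2)
    by (auto dest: inj_onD)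
qed

text \<open>Curves in \<open>S\<close> are built from their coordinates. The curve in the chart may have values outside the
  image of the chart, as long as this does not happen near \<open>0\<close>.\<close>

lemma curve_from_coords:
  assumes M: "smooth_atlas M" and U: "(U, \<phi>) \<in> M" and c: "e > 0" "smooth_on {-e<..<e} c"
    "\<And>t. \<bar>t\<bar> < e \<Longrightarrow> c t \<in> \<phi> ` U" "\<And>t. \<bar>t\<bar> < e \<Longrightarrow> inv_into U \<phi> (c t) \<in> S"
  shows "curve_in M S (inv_into U \<phi> \<circ> c)"
    and "tangent_coords \<phi> (velocity M (inv_into U \<phi> \<circ> c)) = (c 0, vector_derivative c (at 0))"
    and "foot (velocity M (inv_into U \<phi> \<circ> c)) = inv_into U \<phi> (c 0)"
proof -
  have eq: "c t = (\<phi> \<circ> (inv_into U \<phi> \<circ> c)) t" if "\<bar>t\<bar> < e" for t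
    using c(3)[OF that] by (simp add: f_inv_into_f)
  have s: "smooth_on {-e<..<e} (\<phi> \<circ> (inv_into U \<phi> \<circ> c))"
    by (rule smooth_on_cong[OF _ _ c(2)]) (use eq in \<open>auto simp: abs_less_iff\<close>)
  show cu: "curve_in M S (inv_into U \<phi> \<circ> c)"
    by (rule curve_inI[OF U c(1) _ _ s]) (use c(3,4) in \<open>auto intro: inv_into_into\<close>)
  have "(c has_vector_derivative vector_derivative c (at 0)) (at 0)"
    using smooth_on_differentiable[OF c(2), of 0] c(1) by (simp add: vector_derivative_works)
  then have "((\<phi> \<circ> (inv_into U \<phi> \<circ> c)) has_vector_derivative vector_derivative c (at 0)) (at 0)"
    by (rule has_vector_derivative_transform_within_open[of _ _ _ "{-e<..<e}"])
       (use eq c(1) in \<open>auto simp: abs_less_iff\<close>)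
  then show "tangent_coords \<phi> (velocity M (inv_into U \<phi> \<circ> c)) = (c 0, vector_derivative c (at 0))"
    using tangent_coords_velocity[OF cu U] c(1) inv_into_into[OF c(3)[of 0]] f_inv_into_f[OF c(3)[of 0]]
    by (simp add: vector_derivative_at)
  show "foot (velocity M (inv_into U \<phi> \<circ> c)) = inv_into U \<phi> (c 0)"
    using foot_velocity[OF cu] by simp
qed

lemma smooth_on_line: "smooth_on T (\<lambda>t :: real. x + t *\<^sub>R y)"
proof -
  have "smooth_on UNIV (\<lambda>t :: real. x + t *\<^sub>R y)"
    by (intro smooth_on_add smooth_on_bounded_linear_compose[OF bounded_linear_scaleR_left]) auto
  then show ?thesis by (rule smooth_on_subset) auto
qed

lemma vector_derivative_line: "vector_derivative (\<lambda>t :: real. x + t *\<^sub>R y) (at 0) = y"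
  by (rule vector_derivative_at) (auto intro!: derivative_eq_intros)

lemma line_in_open:
  fixes x :: "'e::real_normed_vector"
  assumes "open A" "x \<in> A"
  obtains e where "e > 0" "\<And>t :: real. \<bar>t\<bar> < e \<Longrightarrow> x + t *\<^sub>R y \<in> A"
proof -
  have "open ((\<lambda>t :: real. x + t *\<^sub>R y) -` A)"
    by (rule open_vimage[OF assms(1)]) (intro continuous_intros)
  moreover have "(0 :: real) \<in> (\<lambda>t. x + t *\<^sub>R y) -` A" using assms(2) by simp
  ultimately obtain e where e: "e > 0" "\<forall>t. dist t 0 < e \<longrightarrow> t \<in> (\<lambda>t :: real. x + t *\<^sub>R y) -` A"
    unfolding open_dist by metis
  show ?thesis by (rule that[OF e(1)]) (use e(2) in simp)
qed

lemma tangent_vector_exists: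
  assumes M: "smooth_atlas M" and U: "(U, \<phi>) \<in> M" and x: "x \<in> \<phi> ` U"
  obtains v where "v \<in> tangent_vectors M" "foot v \<in> U" "tangent_coords \<phi> v = (x, y)"
proof -
  obtain e where e: "e > 0" "\<And>t :: real. \<bar>t\<bar> < e \<Longrightarrow> x + t *\<^sub>R y \<in> \<phi> ` U"
    using line_in_open[OF smooth_atlasD(2)[OF M U] x] by blast
  have c: "inv_into U \<phi> (x + t *\<^sub>R y) \<in> carrier M" if "\<bar>t\<bar> < e" for t :: real
    using carrierI[OF U inv_into_into[OF e(2)[OF that]]] .
  note cu = curve_from_coords[OF M U e(1) smooth_on_line e(2) c]
  show ?thesis
    by (rule that[OF velocity_mem[OF cu(1)]])
       (use cu(2,3) x in \<open>auto simp: vector_derivative_line inv_into_into\<close>)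
qed

section \<open>The tangent functor\<close>

definition tangent_domain :: "('a, 'e::fd_inner) atlas \<Rightarrow> 'a set \<Rightarrow> 'a tangent set" where
  "tangent_domain M U = {v \<in> tangent_vectors M. foot v \<in> U}"

lemma mem_tangent_bundle: "(U, \<phi>) \<in> M \<Longrightarrow> (tangent_domain M U, tangent_coords \<phi>) \<in> tangent_bundle M"
  by (auto simp: tangent_bundle_def tangent_domain_def)

lemma tangent_bundleE:
  assumes "(A, \<Phi>) \<in> tangent_bundle M"
  obtains U \<phi> where "(U, \<phi>) \<in> M" "A = tangent_domain M U" "\<Phi> = tangent_coords \<phi>"
  using assms by (auto simp: tangent_bundle_def tangent_domain_def)

lemma carrier_tangent_bundle: "carrier (tangent_bundle M) = tangent_vectors M"
proof -
  have "v \<in> carrier (tangent_bundle M)" if v: "v \<in> tangent_vectors M" for v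
  proof -
    obtain U \<phi> where "(U, \<phi>) \<in> M" "foot v \<in> U" using foot_mem(2)[OF v] by (rule carrierE)
    then show ?thesis using carrierI[OF mem_tangent_bundle] v by (auto simp: tangent_domain_def)
  qed
  then show ?thesis by (auto elim!: carrierE tangent_bundleE simp: tangent_domain_def)
qed

lemma inj_on_tangent_coords:
  "smooth_atlas M \<Longrightarrow> (U, \<phi>) \<in> M \<Longrightarrow> inj_on (tangent_coords \<phi>) (tangent_domain M U)"
  by (rule inj_onI, unfold tangent_domain_def mem_Collect_eq) (metis tangent_ext)

lemma image_tangent_coords:
  assumes M: "smooth_atlas M" and U: "(U, \<phi>) \<in> M" and "A \<subseteq> U"
  shows "tangent_coords \<phi> ` tangent_domain M A = \<phi> ` A \<times> UNIV"
proof (intro equalityI subsetI)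
  fix z assume "z \<in> tangent_coords \<phi> ` tangent_domain M A"
  then show "z \<in> \<phi> ` A \<times> UNIV" by (auto simp: tangent_domain_def tangent_coords_def)
next
  fix z assume "z \<in> \<phi> ` A \<times> (UNIV :: 'b set)"
  then obtain p y where z: "z = (\<phi> p, y)" "p \<in> A" by auto
  obtain v where v: "v \<in> tangent_vectors M" "foot v \<in> U" "tangent_coords \<phi> v = (\<phi> p, y)"
    using tangent_vector_exists[OF M U, of "\<phi> p" y] z assms(3) by blast
  then have "foot v = p"
    using smooth_atlasD(1)[OF M U] z(2) assms(3) by (auto simp: tangent_coords_def dest: inj_onD)
  then show "z \<in> tangent_coords \<phi> ` tangent_domain M A"
    using v z by (auto simp: tangent_domain_def intro!: image_eqI[of _ _ v])
qed

lemma local_expression_tangent_coords: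
  assumes M: "smooth_atlas M" and f: "local_expression M S N f U \<phi> V \<psi> W F"
    and \<gamma>: "curve_in M S \<gamma>" "\<gamma> 0 \<in> U" "\<phi> (\<gamma> 0) \<in> W" and c: "curve_in N T (f \<circ> \<gamma>)"
  shows "tangent_coords \<psi> (velocity N (f \<circ> \<gamma>)) = tangent_lift F (tangent_coords \<phi> (velocity M \<gamma>))"
proof -
  note f' = local_expressionD[OF f]
  show ?thesis
    using local_expression_vector_derivative[OF M f \<gamma>] f'(6,7)[OF curve_in_carrier(3)[OF \<gamma>(1)] \<gamma>(2,3)]
      tangent_coords_velocity[OF \<gamma>(1) f'(1) \<gamma>(2)] tangent_coords_velocity[OF c f'(2)]
    by (simp add: tangent_lift_def)
qed

lemma tangent_coords_transition:
  assumes M: "smooth_atlas M" and v: "v \<in> tangent_vectors M"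
    and U: "(U, \<phi>) \<in> M" "foot v \<in> U" and V: "(V, \<psi>) \<in> M" "foot v \<in> V"
  shows "tangent_coords \<psi> v = tangent_lift (\<psi> \<circ> inv_into U \<phi>) (tangent_coords \<phi> v)"
proof -
  obtain \<gamma> where \<gamma>: "curve_in M (carrier M) \<gamma>" "v = velocity M \<gamma>" using v by (rule tangent_onE)
  then show ?thesis
    using local_expression_tangent_coords[OF M local_expression_transition[OF M U(1) V(1)] \<gamma>(1),
        of "carrier M"] U(2) V(2) foot_velocity[OF \<gamma>(1)] by (simp add: o_def)
qed

text \<open>The transition maps of the tangent bundle are the tangent lifts of those of the manifold.\<close>

lemma smooth_atlas_tangent_bundle:
  assumes M: "smooth_atlas M"
  shows "smooth_atlas (tangent_bundle M)"
proof -
  have 1: "inj_on \<Phi> A \<and> open (\<Phi> ` A)" if A: "(A, \<Phi>) \<in> tangent_bundle M" for A \<Phi>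
  proof -
    obtain U \<phi> where U: "(U, \<phi>) \<in> M" "A = tangent_domain M U" "\<Phi> = tangent_coords \<phi>"
      using A by (rule tangent_bundleE)
    then show ?thesis
      using inj_on_tangent_coords[OF M U(1)] image_tangent_coords[OF M U(1), of U]
        smooth_atlasD(2)[OF M U(1)] by (simp add: open_Times)
  qed
  have 2: "open (\<Phi> ` (A \<inter> B)) \<and> smooth_on (\<Phi> ` (A \<inter> B)) (\<Psi> \<circ> inv_into A \<Phi>)"
    if A: "(A, \<Phi>) \<in> tangent_bundle M" and B: "(B, \<Psi>) \<in> tangent_bundle M" for A \<Phi> B \<Psi>
  proof -
    obtain U \<phi> where U: "(U, \<phi>) \<in> M" "A = tangent_domain M U" "\<Phi> = tangent_coords \<phi>"
      using A by (rule tangent_bundleE)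
    obtain V \<psi> where V: "(V, \<psi>) \<in> M" "B = tangent_domain M V" "\<Psi> = tangent_coords \<psi>"
      using B by (rule tangent_bundleE)
    have "A \<inter> B = tangent_domain M (U \<inter> V)" using U V by (auto simp: tangent_domain_def)
    then have im: "\<Phi> ` (A \<inter> B) = \<phi> ` (U \<inter> V) \<times> UNIV"
      using image_tangent_coords[OF M U(1), of "U \<inter> V"] U(3) by simp
    have o: "open (\<phi> ` (U \<inter> V) \<times> (UNIV :: 'b set))"
      using smooth_atlasD(3)[OF M U(1) V(1)] by (simp add: open_Times)
    have "smooth_on (\<Phi> ` (A \<inter> B)) (\<Psi> \<circ> inv_into A \<Phi>)"
    proof (rule smooth_on_cong)
      show "open (\<Phi> ` (A \<inter> B))" using im o by simp
      show "smooth_on (\<Phi> ` (A \<inter> B)) (tangent_lift (\<psi> \<circ> inv_into U \<phi>))"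
        unfolding im by (rule smooth_on_tangent_lift[OF smooth_atlasD(3,4)[OF M U(1) V(1)]])
      fix z assume "z \<in> \<Phi> ` (A \<inter> B)"
      then obtain v where v: "v \<in> A" "v \<in> B" "z = \<Phi> v" by blast
      then have "inv_into A \<Phi> z = v" using 1[OF A] by simp
      then show "tangent_lift (\<psi> \<circ> inv_into U \<phi>) z = (\<Psi> \<circ> inv_into A \<Phi>) z"
        using tangent_coords_transition[OF M _ U(1) _ V(1), of v] v U V by (simp add: tangent_domain_def)
    qed
    then show ?thesis using im o by simp
  qed
  show ?thesis unfolding smooth_atlas_def using 1 2 by fast
qed

text \<open>The description in the definition of tangent maps is unique: all curves in \<open>S\<close> with
  the same velocity give the same result, because the extension \<open>F\<close> of \<open>f\<close> in a chart determines the
  velocity of the image curve.\<close>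

lemma tangent_map_on_velocity:
  assumes M: "smooth_atlas M" and N: "smooth_atlas N" and f: "smooth_map_on M S N f"
    and \<gamma>: "curve_in M S \<gamma>"
  shows "tangent_map_on M S N f (velocity M \<gamma>) = velocity N (f \<circ> \<gamma>)"
  unfolding tangent_map_on_def
proof (rule the_equality)
  show "\<exists>\<gamma>'\<in>velocity M \<gamma>. curve_in M S \<gamma>' \<and> velocity N (f \<circ> \<gamma>) = velocity N (f \<circ> \<gamma>')"
    using \<gamma> velocity_self by blast
next
  fix w assume "\<exists>\<gamma>'\<in>velocity M \<gamma>. curve_in M S \<gamma>' \<and> w = velocity N (f \<circ> \<gamma>')"
  then obtain \<delta> where \<delta>: "\<delta> \<in> velocity M \<gamma>" "curve_in M S \<delta>" "w = velocity N (f \<circ> \<delta>)" by blast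
  have eq: "velocity M \<gamma> = velocity M \<delta>"
    using mem_tangent_vector(2)[OF _ \<delta>(1)] velocity_mem[OF curve_in_carrier(1)[OF \<gamma>]] by blast
  have c: "curve_in N (f ` S) (f \<circ> \<gamma>)" "curve_in N (f ` S) (f \<circ> \<delta>)"
    using curve_in_compose[OF M _ f] \<gamma> \<delta>(2) by blast+
  have 0: "\<gamma> 0 \<in> S" "\<gamma> 0 \<in> carrier M" "f (\<gamma> 0) \<in> carrier N" "\<delta> 0 = \<gamma> 0"
    using curve_in_carrier(2,3)[OF \<gamma>] curve_in_carrier(2)[OF c(1)] \<delta>(1) by (auto simp: velocity_def)
  obtain U \<phi> where U: "(U, \<phi>) \<in> M" "\<gamma> 0 \<in> U" using 0(2) by (rule carrierE)
  obtain V \<psi> where V: "(V, \<psi>) \<in> N" "f (\<gamma> 0) \<in> V" using 0(3) by (rule carrierE)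
  obtain W F where W: "\<phi> (\<gamma> 0) \<in> W" "local_expression M S N f U \<phi> V \<psi> W F"
    using smooth_map_on_local_expression[OF M N f 0(1) U V] by blast
  have "tangent_coords \<psi> (velocity N (f \<circ> \<gamma>)) = tangent_coords \<psi> (velocity N (f \<circ> \<delta>))"
    using local_expression_tangent_coords[OF M W(2) \<gamma> U(2) W(1) c(1)]
      local_expression_tangent_coords[OF M W(2) \<delta>(2) _ _ c(2)] 0(4) U(2) W(1) eq by simp
  then show "w = velocity N (f \<circ> \<gamma>)"
    using tangent_ext[OF N _ _ V(1)] velocity_mem[OF curve_in_carrier(1)[OF c(1)]]
      velocity_mem[OF curve_in_carrier(1)[OF c(2)]] foot_velocity[OF c(1)] foot_velocity[OF c(2)]
      V(2) 0(4) \<delta>(3) by (metis comp_apply)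
qed

lemma tangent_map_on_mem:
  assumes M: "smooth_atlas M" and N: "smooth_atlas N" and f: "smooth_map_on M S N f"
    and v: "v \<in> tangent_on M S"
  shows "f ` S \<subseteq> T \<Longrightarrow> tangent_map_on M S N f v \<in> tangent_on N T"
    and "foot (tangent_map_on M S N f v) = f (foot v)"
    and "tangent_map_on M S N f v \<in> tangent_vectors N"
proof -
  obtain \<gamma> where \<gamma>: "curve_in M S \<gamma>" "v = velocity M \<gamma>" using v by (rule tangent_onE)
  have c: "curve_in N T (f \<circ> \<gamma>)" if "f ` S \<subseteq> T" for T
    using curve_in_compose[OF M \<gamma>(1) f that] .
  show "tangent_map_on M S N f v \<in> tangent_on N T" if "f ` S \<subseteq> T"
    using tangent_map_on_velocity[OF M N f \<gamma>(1)] \<gamma>(2) velocity_mem[OF c[OF that]] by simp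
  show "foot (tangent_map_on M S N f v) = f (foot v)"
    "tangent_map_on M S N f v \<in> tangent_vectors N"
    using tangent_map_on_velocity[OF M N f \<gamma>(1)] \<gamma>(2) foot_velocity[OF \<gamma>(1)]
      foot_velocity[OF c[OF subset_refl]] velocity_mem[OF curve_in_carrier(1)[OF c[OF subset_refl]]]
    by auto
qed

lemma tangent_map_on_coords:
  assumes M: "smooth_atlas M" and N: "smooth_atlas N" and f: "smooth_map_on M S N f"
    and v: "v \<in> tangent_on M S" "foot v \<in> U" "\<phi> (foot v) \<in> W"
    and W: "local_expression M S N f U \<phi> V \<psi> W F"
  shows "tangent_coords \<psi> (tangent_map_on M S N f v) = tangent_lift F (tangent_coords \<phi> v)"
proof -
  obtain \<gamma> where \<gamma>: "curve_in M S \<gamma>" "v = velocity M \<gamma>" using v(1) by (rule tangent_onE)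
  show ?thesis
    using tangent_map_on_velocity[OF M N f \<gamma>(1)] \<gamma>(2) foot_velocity[OF \<gamma>(1)] v(2,3)
      local_expression_tangent_coords[OF M W \<gamma>(1) _ _ curve_in_compose[OF M \<gamma>(1) f subset_refl]]
    by simp
qed

text \<open>Since \<open>F\<close> extends the expression of \<open>f\<close> to an open set, its tangent lift makes sense on an open
  set, too, and extends the expression of the tangent map. This gives smoothness of tangent maps on
  \<open>TS\<close> without reference to charts of \<open>S\<close>.\<close>

lemma local_expression_tangent:
  assumes M: "smooth_atlas M" and N: "smooth_atlas N" and f: "smooth_map_on M S N f"
    and W: "local_expression M S N f U \<phi> V \<psi> W F"
  shows "local_expression (tangent_bundle M) (tangent_on M S) (tangent_bundle N)
    (tangent_map_on M S N f) (tangent_domain M U) (tangent_coords \<phi>)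
    (tangent_domain N V) (tangent_coords \<psi>) (W \<times> UNIV) (tangent_lift F)"
proof -
  note W' = local_expressionD[OF W]
  have "tangent_map_on M S N f v \<in> tangent_domain N V \<and>
      tangent_coords \<psi> (tangent_map_on M S N f v) = tangent_lift F (tangent_coords \<phi> v)"
    if v: "v \<in> tangent_on M S" "v \<in> tangent_domain M U" "tangent_coords \<phi> v \<in> W \<times> UNIV" for v
  proof -
    have 1: "foot v \<in> U" "\<phi> (foot v) \<in> W" "foot v \<in> S"
      using v foot_mem(1)[OF v(1)] by (auto simp: tangent_domain_def tangent_coords_def)
    then show ?thesis
      using tangent_map_on_mem(2,3)[OF M N f v(1)] tangent_map_on_coords[OF M N f v(1) 1(1,2) W] W'(6)
      by (simp add: tangent_domain_def)
  qed
  then show ?thesis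
    unfolding local_expression_def
    using mem_tangent_bundle[OF W'(1)] mem_tangent_bundle[OF W'(2)] W'(3,4)
      smooth_on_tangent_lift[OF W'(3,5)] image_tangent_coords[OF M W'(1), of U]
    by (auto simp: open_Times)
qed

lemma smooth_map_on_tangent_map:
  assumes M: "smooth_atlas M" and N: "smooth_atlas N" and f: "smooth_map_on M S N f"
  shows "smooth_map_on (tangent_bundle M) (tangent_on M S) (tangent_bundle N) (tangent_map_on M S N f)"
  unfolding smooth_map_on_iff_local_expression
proof
  fix v assume v: "v \<in> tangent_on M S"
  obtain U \<phi> V \<psi> W F where W: "foot v \<in> U" "\<phi> (foot v) \<in> W" "local_expression M S N f U \<phi> V \<psi> W F"
    using f foot_mem(1)[OF v] by (rule smooth_map_onE)
  have "v \<in> tangent_domain M U" "tangent_coords \<phi> v \<in> W \<times> UNIV"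
    using v W tangent_on_subset by (auto simp: tangent_domain_def tangent_coords_def)
  then show "\<exists>A \<Phi> B \<Psi> Y H. v \<in> A \<and> \<Phi> v \<in> Y \<and> local_expression (tangent_bundle M) (tangent_on M S)
      (tangent_bundle N) (tangent_map_on M S N f) A \<Phi> B \<Psi> Y H"
    by (rule local_expression_exI[OF local_expression_tangent[OF M N f W(3)]])
qed

lemma tangent_map_on_cong:
  assumes M: "smooth_atlas M" and N: "smooth_atlas N" and f: "smooth_map_on M S N f"
    and g: "\<And>x. x \<in> S \<Longrightarrow> f x = g x" and v: "v \<in> tangent_on M S"
  shows "tangent_map_on M S N f v = tangent_map_on M S N g v"
proof -
  obtain \<gamma> where \<gamma>: "curve_in M S \<gamma>" "v = velocity M \<gamma>" using v by (rule tangent_onE)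
  obtain e where e: "e > 0" "\<gamma> ` {-e<..<e} \<subseteq> S" using \<gamma>(1) unfolding curve_in_def by blast
  have "velocity N (f \<circ> \<gamma>) = velocity N (g \<circ> \<gamma>)"
    by (rule velocity_cong[OF N curve_in_compose[OF M \<gamma>(1) f subset_refl] e(1)])
       (use e(2) g in \<open>auto simp: abs_less_iff image_subset_iff\<close>)
  then show ?thesis
    using tangent_map_on_velocity[OF M N f \<gamma>(1)] \<gamma>(2)
      tangent_map_on_velocity[OF M N smooth_map_on_cong[OF f g] \<gamma>(1)] by simp
qed

lemma tangent_map_on_compose:
  assumes M: "smooth_atlas M" and N: "smooth_atlas N" and K: "smooth_atlas K"
    and f: "smooth_map_on M S N f" and g: "smooth_map_on N T K g" and sub: "f ` S \<subseteq> T"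
    and v: "v \<in> tangent_on M S"
  shows "tangent_map_on N T K g (tangent_map_on M S N f v) = tangent_map_on M S K (\<lambda>x. g (f x)) v"
proof -
  obtain \<gamma> where \<gamma>: "curve_in M S \<gamma>" "v = velocity M \<gamma>" using v by (rule tangent_onE)
  show ?thesis
    using tangent_map_on_velocity[OF M N f \<gamma>(1)] \<gamma>(2)
      tangent_map_on_velocity[OF N K g curve_in_compose[OF M \<gamma>(1) f sub]]
      tangent_map_on_velocity[OF M K smooth_map_on_compose[OF M N f g sub] \<gamma>(1)]
    by (simp add: o_def)
qed

lemma smooth_map_on_ident:
  assumes "S \<subseteq> carrier M" "smooth_atlas M"
  shows "smooth_map_on M S M (\<lambda>x. x)"
  unfolding smooth_map_on_iff_local_expression
proof
  fix p assume "p \<in> S"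
  then obtain U \<phi> where U: "(U, \<phi>) \<in> M" "p \<in> U" using assms(1) by (meson carrierE subsetD)
  then show "\<exists>U \<phi> V \<psi> W F. p \<in> U \<and> \<phi> p \<in> W \<and> local_expression M S M (\<lambda>x. x) U \<phi> V \<psi> W F"
    by (intro local_expression_exI[OF local_expression_transition[OF assms(2) U(1) U(1)]]) auto
qed

lemma tangent_map_on_ident:
  assumes M: "smooth_atlas M" and f: "\<And>x. x \<in> carrier M \<Longrightarrow> f x = x" and v: "v \<in> tangent_vectors M"
  shows "tangent_map M M f v = v"
proof -
  obtain \<gamma> where \<gamma>: "curve_in M (carrier M) \<gamma>" "v = velocity M \<gamma>" using v by (rule tangent_onE)
  have i: "smooth_map M M (\<lambda>x. x)" by (rule smooth_map_on_ident[OF subset_refl M])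
  show ?thesis
    using tangent_map_on_cong[OF M M i f[symmetric] v] tangent_map_on_velocity[OF M M i \<gamma>(1)] \<gamma>(2)
    by (simp add: o_def)
qed

section \<open>Linear structure and canonical involution in coordinates\<close>

lemma curve_in_const:
  assumes "p \<in> S" "p \<in> carrier M"
  shows "curve_in M S (\<lambda>_. p)"
proof -
  obtain U \<phi> where "(U, \<phi>) \<in> M" "p \<in> U" using assms(2) by (rule carrierE)
  then show ?thesis using assms(1) by (intro curve_inI[of U \<phi> M 1]) (auto simp: o_def)
qed

lemma zero_tangent:
  assumes "p \<in> carrier M"
  shows "zero_tangent M p \<in> tangent_vectors M" "foot (zero_tangent M p) = p"
    "(U, \<phi>) \<in> M \<Longrightarrow> p \<in> U \<Longrightarrow> tangent_coords \<phi> (zero_tangent M p) = (\<phi> p, 0)"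
proof -
  have c: "curve_in M (carrier M) (\<lambda>_. p)" by (rule curve_in_const[OF assms assms])
  then show "zero_tangent M p \<in> tangent_vectors M" "foot (zero_tangent M p) = p"
    unfolding zero_tangent_def using velocity_mem[OF c] foot_velocity[OF c] by simp_all
  show "(U, \<phi>) \<in> M \<Longrightarrow> p \<in> U \<Longrightarrow> tangent_coords \<phi> (zero_tangent M p) = (\<phi> p, 0)"
    unfolding zero_tangent_def using tangent_coords_velocity[OF c] by (simp add: o_def)
qed

lemma tangent_map_zero:
  assumes "smooth_atlas M" "smooth_atlas N" "smooth_map M N f" "p \<in> carrier M"
  shows "tangent_map M N f (zero_tangent M p) = zero_tangent N (f p)"
  using tangent_map_on_velocity[OF assms(1-3) curve_in_const[OF assms(4,4)]]
  by (simp add: zero_tangent_def o_def)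

lemma tangent_component_eq_snd: "tangent_component \<phi> v = snd (tangent_coords \<phi> v)"
  by (simp add: tangent_coords_def)

text \<open>The linear map \<open>D\<close> is the derivative of the transition map at \<open>p\<close>. It carries the
  vector space operations, defined by their expression in all charts, from one chart to the others.\<close>

lemma tangent_component_transition:
  assumes M: "smooth_atlas M" and U: "(U, \<phi>) \<in> M" "p \<in> U" and V: "(V, \<psi>) \<in> M" "p \<in> V"
  obtains D where "linear D"
    "\<And>v. v \<in> tangent_vectors M \<Longrightarrow> foot v = p \<Longrightarrow> tangent_component \<psi> v = D (tangent_component \<phi> v)"
proof -
  have "(\<psi> \<circ> inv_into U \<phi>) differentiable at (\<phi> p)"
    by (rule smooth_on_differentiable[OF smooth_atlasD(4)[OF M U(1) V(1)]]) (use U V in auto)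
  note l = frechet_derivative_linear[OF this]
  have "tangent_component \<psi> v
      = frechet_derivative (\<psi> \<circ> inv_into U \<phi>) (at (\<phi> p)) (tangent_component \<phi> v)"
    if v: "v \<in> tangent_vectors M" "foot v = p" for v
  proof -
    have "tangent_coords \<psi> v = tangent_lift (\<psi> \<circ> inv_into U \<phi>) (tangent_coords \<phi> v)"
      by (rule tangent_coords_transition[OF M v(1) U(1) _ V(1)]) (use U V v in auto)
    then show ?thesis using v(2) by (simp add: tangent_coords_def tangent_lift_def)
  qed
  then show ?thesis by (rule that[OF l])
qed

lemma add_tangent_eqI:
  assumes M: "smooth_atlas M" and v: "v \<in> tangent_vectors M" "w \<in> tangent_vectors M" "foot w = foot v"
    and U: "(U, \<phi>) \<in> M" "foot v \<in> U"
    and u: "u \<in> tangent_vectors M" "foot u = foot v"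
      "tangent_component \<phi> u = tangent_component \<phi> v + tangent_component \<phi> w"
  shows "add_tangent M v w = u"
  unfolding add_tangent_def
proof (rule the_equality)
  have "tangent_component \<psi> u = tangent_component \<psi> v + tangent_component \<psi> w"
    if V: "(V, \<psi>) \<in> M" "foot v \<in> V" for V \<psi>
  proof -
    obtain D where "linear D" "\<And>w. w \<in> tangent_vectors M \<Longrightarrow> foot w = foot v \<Longrightarrow>
      tangent_component \<psi> w = D (tangent_component \<phi> w)"
      using tangent_component_transition[OF M U V] by blast
    then show ?thesis using v u by (simp add: linear_add)
  qed
  then show "u \<in> tangent_vectors M \<and> foot u = foot v \<and> (\<forall>(U, \<phi>)\<in>M. foot v \<in> U \<longrightarrow>
      tangent_component \<phi> u = tangent_component \<phi> v + tangent_component \<phi> w)"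
    using u by auto
next
  fix u' assume u': "u' \<in> tangent_vectors M \<and> foot u' = foot v \<and> (\<forall>(U, \<phi>)\<in>M. foot v \<in> U \<longrightarrow>
      tangent_component \<phi> u' = tangent_component \<phi> v + tangent_component \<phi> w)"
  then show "u' = u"
    by (intro tangent_ext[OF M _ u(1) U(1)]) (use u U in \<open>auto simp: tangent_coords_def\<close>)
qed

lemma scale_tangent_eqI:
  assumes M: "smooth_atlas M" and v: "v \<in> tangent_vectors M"
    and U: "(U, \<phi>) \<in> M" "foot v \<in> U"
    and u: "u \<in> tangent_vectors M" "foot u = foot v"
      "tangent_component \<phi> u = c *\<^sub>R tangent_component \<phi> v"
  shows "scale_tangent M c v = u"
  unfolding scale_tangent_def
proof (rule the_equality)
  have "tangent_component \<psi> u = c *\<^sub>R tangent_component \<psi> v"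
    if V: "(V, \<psi>) \<in> M" "foot v \<in> V" for V \<psi>
  proof -
    obtain D where "linear D" "\<And>w. w \<in> tangent_vectors M \<Longrightarrow> foot w = foot v \<Longrightarrow>
      tangent_component \<psi> w = D (tangent_component \<phi> w)"
      using tangent_component_transition[OF M U V] by blast
    then show ?thesis using v u by (simp add: linear_cmul)
  qed
  then show "u \<in> tangent_vectors M \<and> foot u = foot v \<and> (\<forall>(U, \<phi>)\<in>M. foot v \<in> U \<longrightarrow>
      tangent_component \<phi> u = c *\<^sub>R tangent_component \<phi> v)"
    using u by auto
next
  fix u' assume u': "u' \<in> tangent_vectors M \<and> foot u' = foot v \<and> (\<forall>(U, \<phi>)\<in>M. foot v \<in> U \<longrightarrow>
      tangent_component \<phi> u' = c *\<^sub>R tangent_component \<phi> v)"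
  then show "u' = u"
    by (intro tangent_ext[OF M _ u(1) U(1)]) (use u U in \<open>auto simp: tangent_coords_def\<close>)
qed

lemma tangent_vector_exists_at:
  assumes M: "smooth_atlas M" and U: "(U, \<phi>) \<in> M" and p: "p \<in> U"
  obtains v where "v \<in> tangent_vectors M" "foot v = p" "tangent_coords \<phi> v = (\<phi> p, y)"
proof -
  obtain v where v: "v \<in> tangent_vectors M" "foot v \<in> U" "tangent_coords \<phi> v = (\<phi> p, y)"
    using tangent_vector_exists[OF M U, of "\<phi> p" y] p by blast
  then have "foot v = p"
    using smooth_atlasD(1)[OF M U] p by (auto simp: tangent_coords_def dest: inj_onD)
  then show ?thesis using that v by blast
qed

lemma scale_tangent:
  assumes M: "smooth_atlas M" and v: "v \<in> tangent_vectors M" and U: "(U, \<phi>) \<in> M" "foot v \<in> U"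
  shows "scale_tangent M c v \<in> tangent_vectors M" "foot (scale_tangent M c v) = foot v"
    "tangent_coords \<phi> (scale_tangent M c v) = (\<phi> (foot v), c *\<^sub>R tangent_component \<phi> v)"
proof -
  obtain u where u: "u \<in> tangent_vectors M" "foot u = foot v"
    "tangent_coords \<phi> u = (\<phi> (foot v), c *\<^sub>R tangent_component \<phi> v)"
    using tangent_vector_exists_at[OF M U] by blast
  then have "scale_tangent M c v = u"
    by (intro scale_tangent_eqI[OF M v U]) (auto simp: tangent_coords_def)
  then show "scale_tangent M c v \<in> tangent_vectors M" "foot (scale_tangent M c v) = foot v"
    "tangent_coords \<phi> (scale_tangent M c v) = (\<phi> (foot v), c *\<^sub>R tangent_component \<phi> v)"
    using u by auto
qed

text \<open>The identity of \<open>M\<close> is expressed by the transition map, so its second tangent map, which is the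
  identity again, is expressed by the second tangent lift of the transition map.\<close>

lemma tangent_coords_transition2:
  assumes M: "smooth_atlas M" and \<xi>: "\<xi> \<in> tangent_vectors (tangent_bundle M)"
    and U: "(U, \<phi>) \<in> M" "foot (foot \<xi>) \<in> U" and V: "(V, \<psi>) \<in> M" "foot (foot \<xi>) \<in> V"
  shows "tangent_coords (tangent_coords \<psi>) \<xi> =
    tangent_lift (tangent_lift (\<psi> \<circ> inv_into U \<phi>)) (tangent_coords (tangent_coords \<phi>) \<xi>)"
proof -
  let ?id = "\<lambda>x. x"
  note TM = smooth_atlas_tangent_bundle[OF M]
  have i: "smooth_map M M ?id" by (rule smooth_map_on_ident[OF subset_refl M])
  have foot: "foot \<xi> \<in> tangent_vectors M" using foot_mem(1)[OF \<xi>] by (simp add: carrier_tangent_bundle)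
  have Ti: "tangent_map M M ?id v = v" if "v \<in> tangent_vectors M" for v
    using tangent_map_on_ident[OF M _ that] by simp
  have TTi: "tangent_map (tangent_bundle M) (tangent_bundle M) (tangent_map M M ?id) \<xi> = \<xi>"
    by (rule tangent_map_on_ident[OF TM _ \<xi>]) (simp add: Ti carrier_tangent_bundle)
  note e = local_expression_tangent[OF M M i local_expression_transition[OF M U(1) V(1)]]
  have s: "smooth_map (tangent_bundle M) (tangent_bundle M) (tangent_map M M ?id)"
    using smooth_map_on_tangent_map[OF M M i] by (simp add: carrier_tangent_bundle)
  have "tangent_coords (tangent_coords \<psi>)
      (tangent_map (tangent_bundle M) (tangent_bundle M) (tangent_map M M ?id) \<xi>) =
    tangent_lift (tangent_lift (\<psi> \<circ> inv_into U \<phi>)) (tangent_coords (tangent_coords \<phi>) \<xi>)"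
    by (rule tangent_map_on_coords[OF TM TM s \<xi> _ _ e[folded carrier_tangent_bundle]])
       (use foot U V in \<open>auto simp: tangent_domain_def tangent_coords_def\<close>)
  then show ?thesis by (simp add: TTi)
qed

lemma mem_tangent_domain2:
  assumes "\<xi> \<in> tangent_vectors (tangent_bundle M)" "foot (foot \<xi>) \<in> U"
  shows "foot \<xi> \<in> tangent_domain M U"
  using foot_mem(1)[OF assms(1)] assms(2) by (simp add: tangent_domain_def carrier_tangent_bundle)

lemma tangent_ext2:
  assumes M: "smooth_atlas M" and "\<xi> \<in> tangent_vectors (tangent_bundle M)"
    "\<eta> \<in> tangent_vectors (tangent_bundle M)" and "(U, \<phi>) \<in> M" "foot (foot \<xi>) \<in> U" "foot (foot \<eta>) \<in> U"
    "tangent_coords (tangent_coords \<phi>) \<xi> = tangent_coords (tangent_coords \<phi>) \<eta>"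
  shows "\<xi> = \<eta>"
  using tangent_ext[OF smooth_atlas_tangent_bundle[OF M] assms(2,3) mem_tangent_bundle[OF assms(4)]]
    mem_tangent_domain2[OF assms(2,5)] mem_tangent_domain2[OF assms(3,6)] assms(7) by blast

text \<open>The vector with the flipped coordinates in one chart has flipped coordinates in all of
  them by naturality of the flip under transition maps.\<close>

lemma canonical_involution:
  assumes M: "smooth_atlas M" and \<xi>: "\<xi> \<in> tangent_vectors (tangent_bundle M)"
  shows "canonical_involution M \<xi> \<in> tangent_vectors (tangent_bundle M)"
    and "foot (foot (canonical_involution M \<xi>)) = foot (foot \<xi>)"
    and "(U, \<phi>) \<in> M \<Longrightarrow> foot (foot \<xi>) \<in> U \<Longrightarrow>
      tangent_coords (tangent_coords \<phi>) (canonical_involution M \<xi>) =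
      flip (tangent_coords (tangent_coords \<phi>) \<xi>)"
proof -
  note TM = smooth_atlas_tangent_bundle[OF M]
  let ?P = "\<lambda>\<eta>. \<eta> \<in> tangent_vectors (tangent_bundle M) \<and> foot (foot \<eta>) = foot (foot \<xi>) \<and>
     (\<forall>(U, \<phi>)\<in>M. foot (foot \<xi>) \<in> U \<longrightarrow>
       tangent_coords (tangent_coords \<phi>) \<eta> = flip (tangent_coords (tangent_coords \<phi>) \<xi>))"
  have "foot (foot \<xi>) \<in> carrier M"
    using foot_mem(1)[OF \<xi>] foot_mem(1) by (auto simp: carrier_tangent_bundle)
  then obtain U \<phi> where U: "(U, \<phi>) \<in> M" "foot (foot \<xi>) \<in> U" by (rule carrierE)
  obtain x v x' v' where \<xi>': "tangent_coords (tangent_coords \<phi>) \<xi> = ((x, v), (x', v'))"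
    by (metis surj_pair)
  have x: "x = \<phi> (foot (foot \<xi>))" using \<xi>' by (simp add: tangent_coords_def)
  have "(x, x') \<in> tangent_coords \<phi> ` tangent_domain M U"
    using image_tangent_coords[OF M U(1) subset_refl] x U(2) by simp
  then obtain \<eta> where \<eta>: "\<eta> \<in> tangent_vectors (tangent_bundle M)" "foot \<eta> \<in> tangent_domain M U"
      "tangent_coords (tangent_coords \<phi>) \<eta> = ((x, x'), (v, v'))"
    using tangent_vector_exists[OF TM mem_tangent_bundle[OF U(1)]] by blast
  have \<eta>U: "foot (foot \<eta>) \<in> U" using \<eta>(2) by (simp add: tangent_domain_def)
  have "\<phi> (foot (foot \<eta>)) = x" using \<eta>(3) by (simp add: tangent_coords_def)
  then have ff: "foot (foot \<eta>) = foot (foot \<xi>)"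
    using smooth_atlasD(1)[OF M U(1)] U(2) \<eta>U x by (auto dest: inj_onD)
  have "tangent_coords (tangent_coords \<psi>) \<eta> = flip (tangent_coords (tangent_coords \<psi>) \<xi>)"
    if V: "(V, \<psi>) \<in> M" "foot (foot \<xi>) \<in> V" for V \<psi>
  proof -
    have eq: "tangent_coords (tangent_coords \<phi>) \<eta> = flip (tangent_coords (tangent_coords \<phi>) \<xi>)"
      using \<eta>(3) \<xi>' by simp
    have "fst (fst (tangent_coords (tangent_coords \<phi>) \<xi>)) \<in> \<phi> ` (U \<inter> V)"
      using x \<xi>' U V by simp
    then show ?thesis
      using tangent_lift_flip[OF smooth_atlasD(3)[OF M U(1) V(1)] _ smooth_atlasD(4)[OF M U(1) V(1)]]
        tangent_coords_transition2[OF M \<xi> U V]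
        tangent_coords_transition2[OF M \<eta>(1) U(1) \<eta>U V(1)] eq ff V(2) by simp
  qed
  then have P: "?P \<eta>" using \<eta>(1) ff by auto
  have "canonical_involution M \<xi> = (THE \<eta>. ?P \<eta>)"
    by (simp add: canonical_involution_def flip_def case_prod_unfold)
  also have "\<dots> = \<eta>"
  proof (rule the_equality[where P = ?P, OF P])
    fix \<eta>' assume P': "?P \<eta>'"
    show "\<eta>' = \<eta>"
    proof (rule tangent_ext2[OF M _ \<eta>(1) U(1)])
      have "tangent_coords (tangent_coords \<phi>) \<eta>' = flip (tangent_coords (tangent_coords \<phi>) \<xi>)"
        using P' U by fast
      then show "tangent_coords (tangent_coords \<phi>) \<eta>' = tangent_coords (tangent_coords \<phi>) \<eta>"
        using \<eta>(3) \<xi>' by simp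
    qed (use P P' U in auto)
  qed
  finally have "?P (canonical_involution M \<xi>)" using P by simp
  then show "canonical_involution M \<xi> \<in> tangent_vectors (tangent_bundle M)"
    "foot (foot (canonical_involution M \<xi>)) = foot (foot \<xi>)"
    "(U, \<phi>) \<in> M \<Longrightarrow> foot (foot \<xi>) \<in> U \<Longrightarrow>
      tangent_coords (tangent_coords \<phi>) (canonical_involution M \<xi>) =
      flip (tangent_coords (tangent_coords \<phi>) \<xi>)" for U \<phi> by auto
qed

lemma canonical_involution_involutive:
  assumes M: "smooth_atlas M" and \<xi>: "\<xi> \<in> tangent_vectors (tangent_bundle M)"
  shows "canonical_involution M (canonical_involution M \<xi>) = \<xi>"
proof -
  note k = canonical_involution[OF M \<xi>]
  note kk = canonical_involution[OF M k(1)]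
  have "foot (foot \<xi>) \<in> carrier M"
    using foot_mem(1)[OF \<xi>] foot_mem(1) by (auto simp: carrier_tangent_bundle)
  then obtain U \<phi> where U: "(U, \<phi>) \<in> M" "foot (foot \<xi>) \<in> U" by (rule carrierE)
  show ?thesis
    by (rule tangent_ext2[OF M kk(1) \<xi> U(1)]) (use k(2,3) kk(2,3) U in auto)
qed

section \<open>Idempotent maps\<close>

subsection \<open>Calculus of an idempotent map of an open set\<close>

text \<open>The chain rule for \<open>\<rho> \<circ> \<rho> = \<rho>\<close> at a fixed point: the derivative is a projection.\<close>

lemma idempotent_derivative:
  assumes W: "open W" "smooth_on W \<rho>" "\<And>z. z \<in> W \<Longrightarrow> \<rho> z \<in> W" "\<And>z. z \<in> W \<Longrightarrow> \<rho> (\<rho> z) = \<rho> z"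
    and z: "z \<in> W" "\<rho> z = z"
  shows "frechet_derivative \<rho> (at z) (frechet_derivative \<rho> (at z) y) = frechet_derivative \<rho> (at z) y"
proof -
  have d: "\<rho> differentiable (at z)" using smooth_on_differentiable[OF W(2) z(1)] .
  have "tangent_lift (\<lambda>z. \<rho> (\<rho> z)) (z, y) = tangent_lift \<rho> (z, y)"
    by (rule tangent_lift_cong[OF W(1) z(1) W(4)])
       (use d z(2) differentiable_compose[of \<rho> \<rho> z UNIV] in auto)
  then show ?thesis
    using tangent_lift_compose[of \<rho> z \<rho> y] d z(2) by (simp add: tangent_lift_def)
qed

text \<open>At a fixed point \<open>x\<close> of \<open>\<rho>\<close>, the map \<open>1 - d\<rho>(x)\<close> is the projection onto the kernel of \<open>d\<rho>(x)\<close>. So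
  this is a retraction onto the set of all \<open>(x, y)\<close> with \<open>\<rho> x = x\<close> and \<open>d\<rho>(x) y = 0\<close>, which is defined
  near this set.\<close>

definition kernel_retraction :: "('e::real_normed_vector \<Rightarrow> 'e) \<Rightarrow> 'e \<times> 'e \<Rightarrow> 'e \<times> 'e" where
  "kernel_retraction \<rho> = (\<lambda>(x, y). (\<rho> x, y - frechet_derivative \<rho> (at (\<rho> x)) y))"

lemma kernel_retraction_mem:
  assumes W: "open W" "smooth_on W \<rho>" "\<And>z. z \<in> W \<Longrightarrow> \<rho> z \<in> W" "\<And>z. z \<in> W \<Longrightarrow> \<rho> (\<rho> z) = \<rho> z"
    and z: "fst z \<in> W"
  shows "fst (kernel_retraction \<rho> z) \<in> W"
    "tangent_lift \<rho> (kernel_retraction \<rho> z) = (fst (kernel_retraction \<rho> z), 0)"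
proof -
  obtain x y where xy: "z = (x, y)" "x \<in> W" using z by (cases z) auto
  have d: "\<rho> differentiable (at (\<rho> x))" using smooth_on_differentiable[OF W(2) W(3)[OF xy(2)]] .
  show "fst (kernel_retraction \<rho> z) \<in> W" using xy W(3) by (simp add: kernel_retraction_def)
  show "tangent_lift \<rho> (kernel_retraction \<rho> z) = (fst (kernel_retraction \<rho> z), 0)"
    using xy W(4)[OF xy(2)] idempotent_derivative[OF W W(3)[OF xy(2)] W(4)[OF xy(2)]]
    by (simp add: kernel_retraction_def tangent_lift_def linear_diff[OF frechet_derivative_linear[OF d]])
qed

lemma smooth_on_kernel_retraction:
  fixes \<rho> :: "'e::fd_inner \<Rightarrow> 'e"
  assumes W: "open W" "smooth_on W \<rho>" "\<And>z. z \<in> W \<Longrightarrow> \<rho> z \<in> W"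
  shows "smooth_on (W \<times> UNIV) (kernel_retraction \<rho>)"
proof -
  have o: "open (W \<times> (UNIV :: 'e set))" using W(1) by (simp add: open_Times)
  have 1: "smooth_on (W \<times> UNIV) (\<lambda>z :: 'e \<times> 'e. \<rho> (fst z))"
    by (rule smooth_on_compose[OF o W(2)]) (auto intro: smooth_on_fst[OF o])
  have "smooth_on (W \<times> UNIV) (\<lambda>z :: 'e \<times> 'e. (\<lambda>(x, v). frechet_derivative \<rho> (at x) v) (\<rho> (fst z), snd z))"
    by (rule smooth_on_compose[OF o smooth_on_derivative_apply[OF W(1,2)]])
       (use W(3) in \<open>auto intro!: smooth_on_Pair[OF o 1] smooth_on_snd[OF o]\<close>)
  then have "smooth_on (W \<times> UNIV) (\<lambda>z. (\<rho> (fst z), snd z - frechet_derivative \<rho> (at (\<rho> (fst z))) (snd z)))"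
    by (intro smooth_on_Pair[OF o 1] smooth_on_diff[OF o] smooth_on_snd[OF o]) auto
  then show ?thesis by (simp add: kernel_retraction_def case_prod_unfold)
qed

text \<open>By hypothesis, \<open>((x, v), (x', v'))\<close> lies in the kernel bundle of the idempotent
  \<^const>\<open>tangent_lift\<close> \<open>\<rho>\<close>. Then its flip is fixed by the tangent lift of the retraction, that is,
  it is tangent to the kernel bundle of \<open>\<rho>\<close>: the condition that the derivative of
  \<open>(x, y) \<mapsto> d\<rho>(\<rho> x) y\<close> vanishes in the direction \<open>(v, v')\<close> at \<open>(x, x')\<close> is the second half of the
  hypothesis, with the directions of the second derivative exchanged.\<close>

lemma kernel_retraction_tangent:
  fixes \<rho> :: "'e::fd_inner \<Rightarrow> 'e"
  assumes W: "open W" "smooth_on W \<rho>" and x: "x \<in> W"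
    and t: "tangent_lift (tangent_lift \<rho>) ((x, v), (x', v')) = ((x, v), 0)"
  shows "tangent_lift (kernel_retraction \<rho>) ((x, x'), (v, v')) = ((x, x'), (v, v'))"
    and "kernel_retraction \<rho> differentiable at (x, x')"
proof -
  let ?d = "frechet_derivative \<rho> (at x)"
  have c: "\<rho> x = x" "?d v = v" "?d x' = 0" "second_derivative \<rho> x x' v + ?d v' = 0"
    using t by (auto simp: tangent_lift_tangent_lift[OF W(1) x W(2)] zero_prod_def)
  have 1: "((\<lambda>z. \<rho> (fst z)) has_derivative (\<lambda>z. ?d (fst z))) (at (x, x'))"
    by (rule has_derivative_compose[of fst fst "(x, x')" UNIV \<rho>])
       (auto intro!: derivative_eq_intros smooth_on_has_derivative[OF W(2) x])
  have 3: "((\<lambda>z. frechet_derivative \<rho> (at (\<rho> (fst z))) (snd z)) has_derivative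
     (\<lambda>z. second_derivative \<rho> x (?d (fst z)) x' + ?d (snd z))) (at (x, x'))"
    using has_derivative_derivative_apply_along[of W "\<lambda>z. \<rho> (fst z)" "(x, x')" \<rho>, OF W(1) _ W(2) 1
        has_derivative_snd[OF has_derivative_ident]] c(1) x by simp
  have k: "(kernel_retraction \<rho> has_derivative
      (\<lambda>z. (?d (fst z), snd z - (second_derivative \<rho> x (?d (fst z)) x' + ?d (snd z))))) (at (x, x'))"
    using has_derivative_Pair[OF 1 has_derivative_diff[OF has_derivative_snd[OF has_derivative_ident] 3]]
    by (simp add: kernel_retraction_def case_prod_unfold)
  then show "kernel_retraction \<rho> differentiable at (x, x')" by (auto simp: differentiable_def)
  show "tangent_lift (kernel_retraction \<rho>) ((x, x'), (v, v')) = ((x, x'), (v, v'))"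
    using frechet_derivative_at[OF k, symmetric] c second_derivative_commute[OF W(1) x W(2), of x' v]
    by (simp add: tangent_lift_def kernel_retraction_def)
qed

lemma derivative_zero_along_retraction:
  assumes "open N" "z \<in> N" and Q: "\<And>w. w \<in> N \<Longrightarrow> Q (\<pi> w) = 0"
    and \<pi>: "\<pi> differentiable at z" "tangent_lift \<pi> (z, h) = (z, h)"
    and Q': "(Q has_derivative Q') (at z)"
  shows "Q' h = 0"
proof -
  have pz: "\<pi> z = z" "frechet_derivative \<pi> (at z) h = h" using \<pi>(2) by (auto simp: tangent_lift_def)
  have "((\<lambda>w. Q (\<pi> w)) has_derivative (\<lambda>h. Q' (frechet_derivative \<pi> (at z) h))) (at z)"
    using has_derivative_compose[OF has_derivative_frechet_derivative[OF \<pi>(1)], of Q Q'] pz(1) Q' by simp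
  then have "((\<lambda>w. 0) has_derivative (\<lambda>h. Q' (frechet_derivative \<pi> (at z) h))) (at z)"
    by (rule has_derivative_transform_within_open[OF _ assms(1,2)]) (rule Q)
  then have "(\<lambda>h. Q' (frechet_derivative \<pi> (at z) h)) = (\<lambda>h. 0)"
    by (rule has_derivative_unique) simp
  then show ?thesis using pz(2) by metis
qed

text \<open>Here \<open>F\<close> expresses a map \<open>R\<close> on the kernel bundle of \<open>\<rho>\<close>, and \<open>F0\<close> and \<open>F1\<close> are the two conditions
  of a discretization. The map \<open>z \<mapsto> tangent_lift F (flip z)\<close> expresses \<open>TR\<close>, and the conclusions are
  the two conditions for it, with the idempotent \<^const>\<open>tangent_lift\<close> \<open>\<rho>\<close>. The first one and
  the first component of the second one come from \<open>F0\<close> differentiated along \<open>v\<close> and from \<open>F1\<close> at \<open>x'\<close>;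
  the second component is \<open>F1\<close> differentiated at \<open>(x, x')\<close> in the direction \<open>(v, v')\<close>.\<close>

lemma discretization_calculus:
  fixes \<rho> :: "'e::fd_inner \<Rightarrow> 'e" and F :: "'e \<times> 'e \<Rightarrow> 'e"
  assumes W: "open W" "smooth_on W \<rho>" "\<And>z. z \<in> W \<Longrightarrow> \<rho> z \<in> W" "\<And>z. z \<in> W \<Longrightarrow> \<rho> (\<rho> z) = \<rho> z"
    and Y: "open Y" "smooth_on Y F"
    and F0: "\<And>z. z \<in> W \<Longrightarrow> (z, 0) \<in> Y \<Longrightarrow> \<rho> z = z \<Longrightarrow> F (z, 0) = z"
    and F1: "\<And>z y. z \<in> W \<Longrightarrow> (z, 0) \<in> Y \<Longrightarrow> tangent_lift \<rho> (z, y) = (z, 0) \<Longrightarrow>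
      frechet_derivative F (at (z, 0)) (0, y) =
        y + frechet_derivative \<rho> (at z) (frechet_derivative F (at (z, 0)) (0, y))"
    and x: "x \<in> W" "(x, 0) \<in> Y"
    and t: "tangent_lift (tangent_lift \<rho>) ((x, v), (x', v')) = ((x, v), 0)"
  shows "tangent_lift F ((x, 0), (v, 0)) = (x, v)"
    and "frechet_derivative (\<lambda>z. tangent_lift F (flip z)) (at ((x, v), 0)) (0, (x', v')) =
      (x', v') + frechet_derivative (tangent_lift \<rho>) (at (x, v))
        (frechet_derivative (\<lambda>z. tangent_lift F (flip z)) (at ((x, v), 0)) (0, (x', v')))"
proof -
  let ?d = "frechet_derivative \<rho> (at x)" and ?D = "frechet_derivative F (at (x, 0))"
  let ?X1 = "?D (0, x')" and ?X2 = "second_derivative F (x, 0) (0, x') (v, 0) + ?D (0, v')"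
  have c: "\<rho> x = x" "?d v = v" "?d x' = 0" "second_derivative \<rho> x x' v + ?d v' = 0"
    using t by (auto simp: tangent_lift_tangent_lift[OF W(1) x(1) W(2)] zero_prod_def)
  have d\<rho>: "(\<rho> has_derivative ?d) (at x)" and dF: "(F has_derivative ?D) (at (x, 0))"
    using smooth_on_has_derivative[OF W(2) x(1)] smooth_on_has_derivative[OF Y(2) x(2)] by auto
  have cont: "continuous_on W \<rho>" using smooth_on_continuous_on[OF W(2)] .
  \<comment> \<open>By \<open>F0\<close>, the map \<open>z \<mapsto> F (\<rho> z, 0)\<close> coincides with \<open>\<rho>\<close> near \<open>x\<close>, so their derivatives agree on \<open>v\<close>.\<close>
  have d0: "((\<lambda>z. (\<rho> z, 0)) has_derivative (\<lambda>h. (?d h, 0))) (at x)"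
    by (intro has_derivative_Pair d\<rho>) auto
  have "((\<lambda>z. F (\<rho> z, 0)) has_derivative (\<lambda>h. ?D (?d h, 0))) (at x)"
    using has_derivative_compose[OF d0, of F ?D] c(1) dF by simp
  moreover have "((\<lambda>z. F (\<rho> z, 0)) has_derivative ?d) (at x)"
  proof (rule has_derivative_transform_within_open[OF d\<rho>])
    have "open {z \<in> W. (\<rho> z, 0 :: 'e) \<in> Y}"
      by (rule open_preimage_in[OF W(1) _ Y(1)]) (intro continuous_intros cont)
    then show "open {z \<in> W. (\<rho> z, 0 :: 'e) \<in> Y}" .
  qed (use x c W F0 in auto)
  ultimately have "(\<lambda>h. ?D (?d h, 0)) = ?d" by (rule has_derivative_unique)
  then have "?D (v, 0) = v" using c(2) by metis
  then show "tangent_lift F ((x, 0), (v, 0)) = (x, v)"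
    using F0[OF x c(1)] by (simp add: tangent_lift_def)
  have fl: "(flip has_derivative flip) (at ((x, v), 0 :: 'e \<times> 'e))"
    unfolding flip_def case_prod_unfold
    by (auto intro!: derivative_eq_intros)
  have "((\<lambda>z. tangent_lift F (flip z)) has_derivative
      (\<lambda>h. (\<lambda>(a, b). (?D a, second_derivative F (x, 0) a (v, 0) + ?D b)) (flip h))) (at ((x, v), 0))"
    using has_derivative_compose[OF fl, of "tangent_lift F"]
      has_derivative_tangent_lift[OF Y(1) x(2) Y(2), of "(v, 0)"]
    by (simp add: zero_prod_def)
  note X = frechet_derivative_at[OF this, symmetric]
  \<comment> \<open>\<open>F1\<close> says that \<open>Q\<close> vanishes on the kernel bundle of \<open>\<rho>\<close>, the image of the retraction. The
    derivative of \<open>Q\<close> at \<open>(x, x')\<close> vanishes in the direction \<open>(v, v')\<close>, which is tangent to it.\<close>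
  define Q where "Q = (\<lambda>z :: 'e \<times> 'e. frechet_derivative F (at (fst z, 0)) (0, snd z) - snd z -
     frechet_derivative \<rho> (at (fst z)) (frechet_derivative F (at (fst z, 0)) (0, snd z)))"
  have "((\<lambda>z. (fst z, 0)) has_derivative (\<lambda>h. (fst h, 0))) (at (x, x'))"
    "((\<lambda>z. (0, snd z)) has_derivative (\<lambda>h. (0, snd h))) (at (x, x'))"
    by (auto intro!: derivative_eq_intros)
  from has_derivative_derivative_apply_along[OF Y(1) _ Y(2) this]
  have G: "((\<lambda>z. frechet_derivative F (at (fst z, 0)) (0, snd z)) has_derivative
      (\<lambda>h. second_derivative F (x, 0) (fst h, 0) (0, x') + ?D (0, snd h))) (at (x, x'))"
    using x(2) by simp
  have P: "((\<lambda>z. frechet_derivative \<rho> (at (fst z)) (frechet_derivative F (at (fst z, 0)) (0, snd z)))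
      has_derivative (\<lambda>h. second_derivative \<rho> x (fst h) ?X1 +
        ?d (second_derivative F (x, 0) (fst h, 0) (0, x') + ?D (0, snd h)))) (at (x, x'))"
    using has_derivative_derivative_apply_along[OF W(1) _ W(2)
        has_derivative_fst[OF has_derivative_ident] G] x(1) by simp
  let ?N = "{z \<in> W \<times> UNIV. (\<rho> (fst z), 0 :: 'e) \<in> Y}"
  have "open ?N"
    by (rule open_preimage_in[OF _ _ Y(1)])
       (auto intro!: continuous_intros continuous_on_compose2[OF cont] open_Times W(1))
  moreover have "(x, x') \<in> ?N" using x c by simp
  moreover have "Q (kernel_retraction \<rho> w) = 0" if w: "w \<in> ?N" for w
  proof -
    have "fst w \<in> W" "(fst (kernel_retraction \<rho> w), 0) \<in> Y"
      using w by (auto simp: kernel_retraction_def case_prod_unfold)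
    then show ?thesis
      using F1[of "fst (kernel_retraction \<rho> w)" "snd (kernel_retraction \<rho> w)"]
        kernel_retraction_mem[OF W, of w]
      unfolding Q_def diff_diff_eq right_minus_eq by (simp only: prod.collapse)
  qed
  moreover have "(Q has_derivative (\<lambda>h. second_derivative F (x, 0) (fst h, 0) (0, x') + ?D (0, snd h)
      - snd h - (second_derivative \<rho> x (fst h) ?X1 +
        ?d (second_derivative F (x, 0) (fst h, 0) (0, x') + ?D (0, snd h))))) (at (x, x'))"
    unfolding Q_def by (intro has_derivative_diff G P has_derivative_snd has_derivative_ident)
  ultimately have "second_derivative F (x, 0) (v, 0) (0, x') + ?D (0, v') - v' -
      (second_derivative \<rho> x v ?X1 + ?d (second_derivative F (x, 0) (v, 0) (0, x') + ?D (0, v'))) = 0"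
    using derivative_zero_along_retraction[of ?N "(x, x')" Q "kernel_retraction \<rho>" "(v, v')"]
      kernel_retraction_tangent[OF W(1,2) x(1) t] by fastforce
  then have e2: "?X2 = v' + (second_derivative \<rho> x ?X1 v + ?d ?X2)"
    using second_derivative_commute[OF Y(1) x(2) Y(2), of "(v, 0)" "(0, x')"]
      second_derivative_commute[OF W(1) x(1) W(2), of v ?X1] by (simp add: algebra_simps)
  have e1: "?X1 = x' + ?d ?X1"
    by (rule F1[OF x]) (simp add: tangent_lift_def c)
  have X': "frechet_derivative (\<lambda>z. tangent_lift F (flip z)) (at ((x, v), 0)) (0, (x', v')) = (?X1, ?X2)"
    unfolding X by (simp add: zero_prod_def)
  show "frechet_derivative (\<lambda>z. tangent_lift F (flip z)) (at ((x, v), 0)) (0, (x', v')) =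
      (x', v') + frechet_derivative (tangent_lift \<rho>) (at (x, v))
        (frechet_derivative (\<lambda>z. tangent_lift F (flip z)) (at ((x, v), 0)) (0, (x', v')))"
    unfolding X' using e1 e2 frechet_derivative_at[OF has_derivative_tangent_lift[OF W(1) x(1) W(2), of v], symmetric]
    by simp
qed

subsection \<open>Smooth idempotent maps of a manifold\<close>

definition kernel_fibre :: "('a, 'e::fd_inner) atlas \<Rightarrow> ('a \<Rightarrow> 'a) \<Rightarrow> 'a \<Rightarrow> 'a tangent set" where
  "kernel_fibre M r p =
     {v \<in> tangent_vectors M. foot v = p \<and> tangent_map M M r v = zero_tangent M p}"

definition kernel_bundle :: "('a, 'e::fd_inner) atlas \<Rightarrow> ('a \<Rightarrow> 'a) \<Rightarrow> 'a tangent set" where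
  "kernel_bundle M r = (\<Union>p\<in>{p \<in> carrier M. r p = p}. kernel_fibre M r p)"

text \<open>For \<open>r = \<epsilon> \<circ> \<alpha>\<close> on the arrows of a Lie groupoid, these are the generalized discretization maps.\<close>

definition kernel_discretization ::
  "('a, 'e::fd_inner) atlas \<Rightarrow> ('a \<Rightarrow> 'a) \<Rightarrow> ('a tangent \<Rightarrow> 'a) \<Rightarrow> bool" where
  "kernel_discretization M r R \<longleftrightarrow>
     smooth_map_on (tangent_bundle M) (kernel_bundle M r) M R \<and>
     (\<forall>p\<in>carrier M. r p = p \<longrightarrow> R (zero_tangent M p) = p) \<and>
     (\<forall>p\<in>carrier M. r p = p \<longrightarrow> (\<forall>v\<in>kernel_fibre M r p.
        let X = tangent_map_on (tangent_bundle M) (kernel_fibre M r p) M R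
                  (velocity (tangent_bundle M) (\<lambda>t. scale_tangent M t v))
        in X = add_tangent M v (tangent_map M M r X)))"

lemma kernel_fibre_subset_bundle: "p \<in> carrier M \<Longrightarrow> r p = p \<Longrightarrow> kernel_fibre M r p \<subseteq> kernel_bundle M r"
  by (auto simp: kernel_bundle_def)

lemma kernel_bundle_iff:
  "v \<in> kernel_bundle M r \<longleftrightarrow> v \<in> tangent_vectors M \<and> r (foot v) = foot v \<and>
     tangent_map M M r v = zero_tangent M (foot v)"
  using foot_mem(2) by (auto simp: kernel_bundle_def kernel_fibre_def)

locale smooth_idempotent =
  fixes M :: "('a, 'e::fd_inner) atlas" and r :: "'a \<Rightarrow> 'a"
  assumes M: "smooth_atlas M" and r: "smooth_map M M r"
    and idem: "p \<in> carrier M \<Longrightarrow> r (r p) = r p"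
begin

lemmas TM = smooth_atlas_tangent_bundle[OF M]

lemma idempotent_chart:
  assumes p: "p \<in> carrier M" "r p = p"
  obtains U \<phi> W \<rho> where "p \<in> U" "\<phi> p \<in> W" "local_expression M (carrier M) M r U \<phi> U \<phi> W \<rho>"
    "\<forall>z\<in>W. \<rho> z \<in> W \<and> \<rho> (\<rho> z) = \<rho> z"
proof -
  obtain U \<phi> where U: "(U, \<phi>) \<in> M" "p \<in> U" using p(1) by (rule carrierE)
  have "r p \<in> U" using U p by simp
  then obtain W0 \<rho> where W0: "\<phi> p \<in> W0" and e: "local_expression M (carrier M) M r U \<phi> U \<phi> W0 \<rho>"
    using smooth_map_on_local_expression[OF M M r p(1) U U(1)] by blast
  note e' = local_expressionD[OF e]
  \<comment> \<open>\<open>\<rho>\<close> is idempotent wherever its square is defined, and it maps this set into itself.\<close>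
  define W where "W = {z \<in> W0. \<rho> z \<in> W0}"
  have id: "\<rho> (\<rho> z) = \<rho> z" if z: "z \<in> W" for z
  proof -
    obtain x where x: "x \<in> U" "z = \<phi> x" using z e'(4) by (auto simp: W_def)
    have xc: "x \<in> carrier M" using carrierI[OF U(1) x(1)] .
    have zW: "\<phi> x \<in> W0" using z x by (simp add: W_def)
    have rx: "r x \<in> U" "\<phi> (r x) = \<rho> z" using e'(6,7)[OF xc x(1) zW] x(2) by auto
    have "\<phi> (r x) \<in> W0" using rx z by (simp add: W_def)
    then have "\<phi> (r (r x)) = \<rho> (\<phi> (r x))" using e'(7)[OF carrierI[OF U(1) rx(1)] rx(1)] by blast
    then show ?thesis using rx(2) idem[OF xc] by simp
  qed
  have o: "open W" unfolding W_def
    by (rule open_preimage_in[OF e'(3) smooth_on_continuous_on[OF e'(5)] e'(3)])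
  show ?thesis
  proof (rule that[OF U(2) _ local_expression_restrict[OF e o]])
    have "\<rho> (\<phi> p) = \<phi> p" using e'(7)[OF p(1) U(2) W0] p(2) by simp
    then show "\<phi> p \<in> W" using W0 by (simp add: W_def)
    show "\<forall>z\<in>W. \<rho> z \<in> W \<and> \<rho> (\<rho> z) = \<rho> z" using id by (auto simp: W_def)
  qed (auto simp: W_def)
qed

text \<open>The equation comprises both conditions on a member of the kernel bundle: its first component says
  that the foot is a fixed point, the second one that the vector is in the kernel.\<close>

lemma kernel_bundle_coords:
  assumes e: "local_expression M (carrier M) M r U \<phi> U \<phi> W \<rho>"
    and v: "v \<in> tangent_vectors M" "foot v \<in> U" "\<phi> (foot v) \<in> W"
  shows "v \<in> kernel_bundle M r \<longleftrightarrow> tangent_lift \<rho> (tangent_coords \<phi> v) = (\<phi> (foot v), 0)"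
proof -
  note e' = local_expressionD[OF e]
  have c: "tangent_coords \<phi> (tangent_map M M r v) = tangent_lift \<rho> (tangent_coords \<phi> v)"
    by (rule tangent_map_on_coords[OF M M r v e])
  have T: "tangent_map M M r v \<in> tangent_vectors M" "foot (tangent_map M M r v) = r (foot v)"
    using tangent_map_on_mem[OF M M r v(1)] by auto
  have fv: "foot v \<in> carrier M" using carrierI[OF e'(1) v(2)] .
  have rU: "r (foot v) \<in> U" using e'(6)[OF fv v(2,3)] .
  note z = zero_tangent[OF fv]
  show ?thesis
  proof
    assume "v \<in> kernel_bundle M r"
    then show "tangent_lift \<rho> (tangent_coords \<phi> v) = (\<phi> (foot v), 0)"
      using c z(3)[OF e'(1) v(2)] by (simp add: kernel_bundle_iff)
  next
    assume eq: "tangent_lift \<rho> (tangent_coords \<phi> v) = (\<phi> (foot v), 0)"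
    have "tangent_map M M r v = zero_tangent M (foot v)"
      by (rule tangent_ext[OF M T(1) z(1) e'(1)]) (use T z v rU eq c e'(1) in auto)
    moreover from this have "r (foot v) = foot v" using T(2) z(2) by simp
    ultimately show "v \<in> kernel_bundle M r" using v(1) by (simp add: kernel_bundle_iff)
  qed
qed

lemma zero_in_kernel_fibre:
  assumes p: "p \<in> carrier M" "r p = p"
  shows "zero_tangent M p \<in> kernel_fibre M r p"
  using tangent_map_zero[OF M M r p(1)] zero_tangent[OF p(1)] p(2) by (simp add: kernel_fibre_def)

text \<open>In coordinates the curve is a straight line in a fibre. It stays in the kernel because the
  derivative of \<open>r\<close> is linear.\<close>

lemma vertical_curve:
  assumes p: "p \<in> carrier M" "r p = p" and v: "v \<in> kernel_fibre M r p"
  shows "curve_in (tangent_bundle M) (kernel_fibre M r p) (\<lambda>t. scale_tangent M t v)"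
    and "scale_tangent M 0 v = zero_tangent M p"
    and "(U, \<phi>) \<in> M \<Longrightarrow> p \<in> U \<Longrightarrow>
      tangent_coords (tangent_coords \<phi>) (velocity (tangent_bundle M) (\<lambda>t. scale_tangent M t v)) =
      ((\<phi> p, 0), (0, tangent_component \<phi> v))"
proof -
  have v': "v \<in> tangent_vectors M" "foot v = p" using v by (auto simp: kernel_fibre_def)
  have s: "scale_tangent M t v \<in> tangent_vectors M" "foot (scale_tangent M t v) = p"
    "tangent_coords \<phi> (scale_tangent M t v) = (\<phi> p, t *\<^sub>R tangent_component \<phi> v)"
    if "(U, \<phi>) \<in> M" "p \<in> U" for U \<phi> t
    using scale_tangent[OF M v'(1)] v'(2) that by auto
  obtain U0 \<phi>0 W \<rho> where e: "p \<in> U0" "\<phi>0 p \<in> W" "local_expression M (carrier M) M r U0 \<phi>0 U0 \<phi>0 W \<rho>"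
      "\<forall>z\<in>W. \<rho> z \<in> W \<and> \<rho> (\<rho> z) = \<rho> z"
    by (rule idempotent_chart[OF p])
  note e' = local_expressionD[OF e(3)]
  have l: "linear (frechet_derivative \<rho> (at (\<phi>0 p)))"
    by (rule frechet_derivative_linear[OF smooth_on_differentiable[OF e'(5) e(2)]])
  have v0: "tangent_lift \<rho> (\<phi>0 p, tangent_component \<phi>0 v) = (\<phi>0 p, 0)"
    using kernel_bundle_coords[OF e(3) v'(1)] v'(2) e kernel_fibre_subset_bundle[of p M r, OF p] v
    by (auto simp: tangent_coords_def)
  have k: "scale_tangent M t v \<in> kernel_fibre M r p" for t
  proof -
    have "scale_tangent M t v \<in> kernel_bundle M r"
      using kernel_bundle_coords[OF e(3) s(1)[OF e'(1) e(1)]] s(2,3)[OF e'(1) e(1)] e v0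
      by (simp add: tangent_lift_def linear_cmul[OF l])
    then show ?thesis using s(2)[OF e'(1) e(1)] by (simp add: kernel_bundle_iff kernel_fibre_def)
  qed
  have sm: "smooth_on {-1<..<1} (tangent_coords \<phi> \<circ> (\<lambda>t. scale_tangent M t v))"
    and vd: "vector_derivative (tangent_coords \<phi> \<circ> (\<lambda>t. scale_tangent M t v)) (at 0)
      = (0, tangent_component \<phi> v)"
    if U: "(U, \<phi>) \<in> M" "p \<in> U" for U \<phi>
  proof -
    have "tangent_coords \<phi> \<circ> (\<lambda>t. scale_tangent M t v) =
        (\<lambda>t. (\<phi> p, 0) + t *\<^sub>R (0, tangent_component \<phi> v))"
      using s(3)[OF U] by (auto simp: o_def)
    then show "smooth_on {-1<..<1} (tangent_coords \<phi> \<circ> (\<lambda>t. scale_tangent M t v))"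
      "vector_derivative (tangent_coords \<phi> \<circ> (\<lambda>t. scale_tangent M t v)) (at 0)
        = (0, tangent_component \<phi> v)"
      using smooth_on_line[of "{-1<..<1}" "(\<phi> p, 0)" "(0, tangent_component \<phi> v)"]
        vector_derivative_line[of "(\<phi> p, 0)" "(0, tangent_component \<phi> v)"] by simp_all
  qed
  show c: "curve_in (tangent_bundle M) (kernel_fibre M r p) (\<lambda>t. scale_tangent M t v)"
    by (rule curve_inI[OF mem_tangent_bundle[OF e'(1)] zero_less_one k _ sm[OF e'(1) e(1)]])
       (use s[OF e'(1) e(1)] e(1) in \<open>auto simp: tangent_domain_def\<close>)
  show 0: "scale_tangent M 0 v = zero_tangent M p"
    by (rule tangent_ext[OF M s(1)[OF e'(1) e(1)] zero_tangent(1)[OF p(1)] e'(1)])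
       (use s[OF e'(1) e(1)] e e' zero_tangent[OF p(1)] in auto)
  show "tangent_coords (tangent_coords \<phi>) (velocity (tangent_bundle M) (\<lambda>t. scale_tangent M t v)) =
      ((\<phi> p, 0), (0, tangent_component \<phi> v))" if U: "(U, \<phi>) \<in> M" "p \<in> U" for U \<phi>
    using tangent_coords_velocity[OF c mem_tangent_bundle[OF U(1)]] vd[OF U] s[OF U] U(2)
    by (simp add: tangent_domain_def)
qed

end

subsection \<open>The tangent idempotent\<close>

text \<open>Here \<open>r'\<close> need only agree with \<open>Tr\<close> on tangent vectors, which leaves room for \<open>T\<epsilon> \<circ> T\<alpha>\<close>, a
  map that may differ from \<open>T(\<epsilon> \<circ> \<alpha>)\<close> elsewhere.\<close>

locale tangent_idempotent = smooth_idempotent +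
  fixes r' :: "'a tangent \<Rightarrow> 'a tangent"
  assumes r': "v \<in> tangent_vectors M \<Longrightarrow> r' v = tangent_map M M r v"
begin

lemma smooth_tangent_map: "smooth_map (tangent_bundle M) (tangent_bundle M) (tangent_map M M r)"
  using smooth_map_on_tangent_map[OF M M r] by (simp add: carrier_tangent_bundle)

sublocale tangent: smooth_idempotent "tangent_bundle M" r'
proof
  show "smooth_atlas (tangent_bundle M)" by (rule TM)
  show "smooth_map (tangent_bundle M) (tangent_bundle M) r'"
    by (rule smooth_map_on_cong[OF smooth_tangent_map]) (simp add: carrier_tangent_bundle r')
  fix v assume v: "v \<in> carrier (tangent_bundle M)"
  then have v: "v \<in> tangent_vectors M" by (simp add: carrier_tangent_bundle)
  have rc: "r ` carrier M \<subseteq> carrier M" using smooth_map_on_carrier(1)[OF r] by blast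
  have "tangent_map M M r (tangent_map M M r v) = tangent_map M M r v"
    using tangent_map_on_compose[OF M M M r r rc v]
      tangent_map_on_cong[OF M M r idem[symmetric] v] by simp
  then show "r' (r' v) = r' v" using r' v tangent_map_on_mem(3)[OF M M r v] by simp
qed

lemma tangent_local_expression:
  assumes "local_expression M (carrier M) M r U \<phi> U \<phi> W \<rho>"
  shows "local_expression (tangent_bundle M) (carrier (tangent_bundle M)) (tangent_bundle M) r'
    (tangent_domain M U) (tangent_coords \<phi>) (tangent_domain M U) (tangent_coords \<phi>)
    (W \<times> UNIV) (tangent_lift \<rho>)"
  by (rule local_expression_cong[OF local_expression_tangent[OF M M r assms, folded carrier_tangent_bundle]])
     (simp add: carrier_tangent_bundle r')

lemma kernel_bundle_coords2:
  assumes e: "local_expression M (carrier M) M r U \<phi> U \<phi> W \<rho>"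
    and \<xi>: "\<xi> \<in> kernel_bundle (tangent_bundle M) r'" "foot (foot \<xi>) \<in> U" "\<phi> (foot (foot \<xi>)) \<in> W"
  shows "tangent_lift (tangent_lift \<rho>) (tangent_coords (tangent_coords \<phi>) \<xi>)
    = (tangent_coords \<phi> (foot \<xi>), 0)"
proof -
  have "\<xi> \<in> tangent_vectors (tangent_bundle M)" using \<xi>(1) by (simp add: kernel_bundle_iff)
  then show ?thesis
    using tangent.kernel_bundle_coords[OF tangent_local_expression[OF e], of \<xi>]
      mem_tangent_domain2[of \<xi> M U] \<xi> by (simp add: tangent_coords_def)
qed

lemma foot_foot_fixed:
  assumes w: "w \<in> tangent_vectors M" "r' w = w"
  shows "foot w \<in> carrier M" "r (foot w) = foot w"
  using w foot_mem(2)[OF w(1)] tangent_map_on_mem(2)[OF M M r w(1)] r'[OF w(1)] by auto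

text \<open>A member of \<open>T\<close> of the kernel bundle is the velocity of a curve in this bundle. Such
  a curve is the image of the line through \<open>(x, x')\<close> in the direction \<open>(v, v')\<close> under the retraction,
  whose derivative fixes \<open>(v, v')\<close>.\<close>

lemma canonical_involution_kernel:
  assumes \<xi>: "\<xi> \<in> kernel_bundle (tangent_bundle M) r'"
  shows "canonical_involution M \<xi> \<in> tangent_on (tangent_bundle M) (kernel_bundle M r)"
proof -
  have \<xi>': "\<xi> \<in> tangent_vectors (tangent_bundle M)" "r' (foot \<xi>) = foot \<xi>"
    using \<xi> by (simp_all add: kernel_bundle_iff)
  have f\<xi>: "foot \<xi> \<in> tangent_vectors M" using foot_mem(1)[OF \<xi>'(1)] by (simp add: carrier_tangent_bundle)
  note ff = foot_foot_fixed[OF f\<xi> \<xi>'(2)]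
  obtain U \<phi> W \<rho> where U: "foot (foot \<xi>) \<in> U" "\<phi> (foot (foot \<xi>)) \<in> W"
    and e: "local_expression M (carrier M) M r U \<phi> U \<phi> W \<rho>"
    and W': "\<forall>z\<in>W. \<rho> z \<in> W \<and> \<rho> (\<rho> z) = \<rho> z"
    by (rule idempotent_chart[OF ff])
  have W: "\<And>z. z \<in> W \<Longrightarrow> \<rho> z \<in> W" "\<And>z. z \<in> W \<Longrightarrow> \<rho> (\<rho> z) = \<rho> z" using W' by auto
  note e' = local_expressionD[OF e]
  obtain x v x' v' where c: "tangent_coords (tangent_coords \<phi>) \<xi> = ((x, v), (x', v'))"
    by (metis surj_pair)
  have x: "x = \<phi> (foot (foot \<xi>))" "(x, v) = tangent_coords \<phi> (foot \<xi>)"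
    using c by (simp_all add: tangent_coords_def)
  have t: "tangent_lift (tangent_lift \<rho>) ((x, v), (x', v')) = ((x, v), 0)"
    using kernel_bundle_coords2[OF e \<xi> U] c x by simp
  have xW: "x \<in> W" using x U by simp
  let ?\<pi> = "kernel_retraction \<rho>" and ?A = "tangent_domain M U" and ?\<Phi> = "tangent_coords \<phi>"
  note \<pi> = kernel_retraction_tangent[OF e'(3,5) xW t]
  have o: "open (W \<times> (UNIV :: 'b set))" using e'(3) by (simp add: open_Times)
  obtain d where d: "d > 0" "\<And>s :: real. \<bar>s\<bar> < d \<Longrightarrow> (x, x') + s *\<^sub>R (v, v') \<in> W \<times> UNIV"
    using line_in_open[OF o, of "(x, x')" "(v, v')"] xW by auto
  \<comment> \<open>a curve in the kernel bundle whose velocity is the flip of \<open>\<xi>\<close>\<close>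
  let ?c = "\<lambda>s :: real. ?\<pi> ((x, x') + s *\<^sub>R (v, v'))"
  have s: "smooth_on {-d<..<d} ?c"
    by (rule smooth_on_compose[OF _ smooth_on_kernel_retraction[OF e'(3,5) W(1)] smooth_on_line])
       (use d(2) in \<open>auto simp: abs_less_iff\<close>)
  have m: "?c s \<in> ?\<Phi> ` ?A" "inv_into ?A ?\<Phi> (?c s) \<in> kernel_bundle M r" if s: "\<bar>s\<bar> < d" for s
  proof -
    have k: "fst (?c s) \<in> W" "tangent_lift \<rho> (?c s) = (fst (?c s), 0)"
      using kernel_retraction_mem[OF e'(3,5) W, of "(x, x') + s *\<^sub>R (v, v')"] d(2)[OF s] by auto
    then have "fst (?c s) \<in> \<phi> ` U" using e'(4) by blast
    then have "?c s \<in> \<phi> ` U \<times> UNIV" by (simp add: mem_Times_iff)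
    then show im: "?c s \<in> ?\<Phi> ` ?A" using image_tangent_coords[OF M e'(1) subset_refl] by simp
    define u where "u = inv_into ?A ?\<Phi> (?c s)"
    have u: "u \<in> ?A" "?\<Phi> u = ?c s" using im by (simp_all add: u_def inv_into_into f_inv_into_f)
    then have "\<phi> (foot u) = fst (?c s)" by (metis fst_conv tangent_coords_def)
    then show "u \<in> kernel_bundle M r"
      using kernel_bundle_coords[OF e, of u] u k by (simp add: tangent_domain_def)
  qed
  note cu = curve_from_coords[OF TM mem_tangent_bundle[OF e'(1)] d(1) s m]
  let ?\<eta> = "velocity (tangent_bundle M) (inv_into ?A ?\<Phi> \<circ> ?c)"
  have \<pi>1: "?\<pi> (x, x') = (x, x')" "frechet_derivative ?\<pi> (at (x, x')) (v, v') = (v, v')"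
    using \<pi>(1) by (auto simp: tangent_lift_def)
  have "((\<lambda>s :: real. (x, x') + s *\<^sub>R (v, v')) has_vector_derivative (v, v')) (at 0)"
    by (auto intro!: derivative_eq_intros)
  from has_vector_derivative_compose[OF this, of ?\<pi> "frechet_derivative ?\<pi> (at (x, x'))"]
  have "(?c has_vector_derivative (v, v')) (at 0)"
    using has_derivative_frechet_derivative[OF \<pi>(2)] \<pi>1(2) by simp
  then have \<eta>: "tangent_coords ?\<Phi> ?\<eta> = ((x, x'), (v, v'))"
    using cu(2) \<pi>1(1) by (simp add: vector_derivative_at)
  note k = canonical_involution[OF M \<xi>'(1)]
  have \<eta>m: "?\<eta> \<in> tangent_vectors (tangent_bundle M)"
    using velocity_mem[OF cu(1)] tangent_on_subset by blast
  have "foot ?\<eta> \<in> ?A" using cu(3) m(1)[of 0] d(1) by (simp add: inv_into_into)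
  then have "?\<eta> = canonical_involution M \<xi>"
    by (intro tangent_ext2[OF M \<eta>m k(1) e'(1)])
       (use \<eta> k(2) k(3)[OF e'(1) U(1)] U c in \<open>auto simp: tangent_domain_def\<close>)
  then show ?thesis using velocity_mem[OF cu(1)] by simp
qed

text \<open>The canonical isomorphism is the restriction of an involution, which maps the kernel bundle of
  \<open>Tr\<close> back into its domain.\<close>

lemma inv_canonical_involution:
  assumes \<xi>: "\<xi> \<in> kernel_bundle (tangent_bundle M) r'"
  shows "inv_into (tangent_on (tangent_bundle M) (kernel_bundle M r)) (canonical_involution M) \<xi> =
    canonical_involution M \<xi>"
proof (rule inv_into_f_eq)
  show "inj_on (canonical_involution M) (tangent_on (tangent_bundle M) (kernel_bundle M r))"
    by (rule inj_on_inverseI[of _ "canonical_involution M"])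
       (use canonical_involution_involutive[OF M] tangent_on_subset in blast)
  show "canonical_involution M \<xi> \<in> tangent_on (tangent_bundle M) (kernel_bundle M r)"
    by (rule canonical_involution_kernel[OF \<xi>])
  show "canonical_involution M (canonical_involution M \<xi>) = \<xi>"
    using canonical_involution_involutive[OF M] \<xi> by (simp add: kernel_bundle_iff)
qed

definition tangent_discretization :: "('a tangent \<Rightarrow> 'a) \<Rightarrow> 'a tangent tangent \<Rightarrow> 'a tangent" where
  "tangent_discretization R =
     tangent_map_on (tangent_bundle M) (kernel_bundle M r) M R \<circ>
     inv_into (tangent_on (tangent_bundle M) (kernel_bundle M r)) (canonical_involution M)"

lemma linear_flip: "bounded_linear flip"
  unfolding flip_def case_prod_unfold
  by (intro bounded_linear_Pair bounded_linear_fst_comp bounded_linear_snd_comp bounded_linear_fst bounded_linear_snd)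

text \<open>On the kernel bundle of \<open>Tr\<close>, the map is \<open>TR\<close> composed with the canonical involution. In
  coordinates these are a tangent lift and the flip.\<close>

lemma tangent_discretization_local_expression:
  assumes R: "smooth_map_on (tangent_bundle M) (kernel_bundle M r) M R"
    and e: "local_expression (tangent_bundle M) (kernel_bundle M r) M R
      (tangent_domain M U) (tangent_coords \<phi>) V \<psi> Y F" and U: "(U, \<phi>) \<in> M"
  shows "local_expression (tangent_bundle (tangent_bundle M)) (kernel_bundle (tangent_bundle M) r')
    (tangent_bundle M) (tangent_discretization R)
    (tangent_domain (tangent_bundle M) (tangent_domain M U)) (tangent_coords (tangent_coords \<phi>))
    (tangent_domain M V) (tangent_coords \<psi>) (flip -` (Y \<times> UNIV)) (\<lambda>z. tangent_lift F (flip z))"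
proof -
  note e' = local_expressionD[OF e]
  note t = local_expressionD[OF local_expression_tangent[OF TM M R e]]
  have o: "open (flip -` (Y \<times> (UNIV :: ('b \<times> 'b) set)))"
    by (rule open_vimage[OF t(3)]) (rule linear_continuous_on[OF linear_flip])
  have sm: "smooth_on (flip -` (Y \<times> UNIV)) (\<lambda>z. tangent_lift F (flip z))"
    by (rule smooth_on_compose[OF o t(5)
          smooth_on_bounded_linear_compose[OF linear_flip o smooth_on_ident]]) auto
  have "Y \<subseteq> \<phi> ` U \<times> UNIV" using e'(4) image_tangent_coords[OF M U subset_refl] by simp
  then have im: "flip -` (Y \<times> UNIV) \<subseteq> tangent_coords (tangent_coords \<phi>) `
      tangent_domain (tangent_bundle M) (tangent_domain M U)"
    using image_tangent_coords[OF TM mem_tangent_bundle[OF U] subset_refl]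
      image_tangent_coords[OF M U subset_refl] by (auto simp: flip_def)
  have "tangent_discretization R \<xi> \<in> tangent_domain M V \<and>
      tangent_coords \<psi> (tangent_discretization R \<xi>) =
        tangent_lift F (flip (tangent_coords (tangent_coords \<phi>) \<xi>))"
    if \<xi>: "\<xi> \<in> kernel_bundle (tangent_bundle M) r'"
      "\<xi> \<in> tangent_domain (tangent_bundle M) (tangent_domain M U)"
      "tangent_coords (tangent_coords \<phi>) \<xi> \<in> flip -` (Y \<times> UNIV)" for \<xi>
  proof -
    have \<xi>': "\<xi> \<in> tangent_vectors (tangent_bundle M)" "foot (foot \<xi>) \<in> U"
      using \<xi>(2) by (auto simp: tangent_domain_def)
    note k = canonical_involution[OF M \<xi>'(1)]
    have "canonical_involution M \<xi> \<in> tangent_domain (tangent_bundle M) (tangent_domain M U)"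
      using mem_tangent_domain2[OF k(1)] k(1,2) \<xi>'(2) by (simp add: tangent_domain_def[of "tangent_bundle M"])
    then show ?thesis
      using t(6,7)[OF canonical_involution_kernel[OF \<xi>(1)]] k(3)[OF U \<xi>'(2)] \<xi>(3)
      by (simp add: tangent_discretization_def inv_canonical_involution[OF \<xi>(1)])
  qed
  then show ?thesis
    unfolding local_expression_def using o sm im t(2) mem_tangent_bundle[OF mem_tangent_bundle[OF U]] by auto
qed

lemma smooth_tangent_discretization:
  assumes R: "smooth_map_on (tangent_bundle M) (kernel_bundle M r) M R"
  shows "smooth_map_on (tangent_bundle (tangent_bundle M)) (kernel_bundle (tangent_bundle M) r')
    (tangent_bundle M) (tangent_discretization R)"
  unfolding smooth_map_on_iff_local_expression
proof
  fix \<xi> assume \<xi>: "\<xi> \<in> kernel_bundle (tangent_bundle M) r'"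
  then have \<xi>': "\<xi> \<in> tangent_vectors (tangent_bundle M)" by (simp add: kernel_bundle_iff)
  note k = canonical_involution[OF M \<xi>']
  obtain A \<Phi> V \<psi> Y F where A: "foot (canonical_involution M \<xi>) \<in> A"
    "\<Phi> (foot (canonical_involution M \<xi>)) \<in> Y"
    and e: "local_expression (tangent_bundle M) (kernel_bundle M r) M R A \<Phi> V \<psi> Y F"
    using R foot_mem(1)[OF canonical_involution_kernel[OF \<xi>]] by (rule smooth_map_onE)
  obtain U \<phi> where U: "(U, \<phi>) \<in> M" "A = tangent_domain M U" "\<Phi> = tangent_coords \<phi>"
    using local_expressionD(1)[OF e] by (rule tangent_bundleE)
  have fU: "foot (foot \<xi>) \<in> U" using A(1) k(2) U(2) by (simp add: tangent_domain_def)
  have "flip (tangent_coords (tangent_coords \<phi>) \<xi>) \<in> Y \<times> UNIV"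
    using k(3)[OF U(1) fU, symmetric] A(2) U(3) by (simp add: tangent_coords_def[of "tangent_coords \<phi>"])
  moreover have "\<xi> \<in> tangent_domain (tangent_bundle M) (tangent_domain M U)"
    using mem_tangent_domain2[OF \<xi>' fU] \<xi>' by (simp add: tangent_domain_def[of "tangent_bundle M"])
  ultimately show "\<exists>A \<Phi> B \<Psi> Y H. \<xi> \<in> A \<and> \<Phi> \<xi> \<in> Y \<and>
      local_expression (tangent_bundle (tangent_bundle M)) (kernel_bundle (tangent_bundle M) r')
        (tangent_bundle M) (tangent_discretization R) A \<Phi> B \<Psi> Y H"
    by (intro local_expression_exI[OF
          tangent_discretization_local_expression[OF R e[unfolded U(2,3)] U(1)]]) auto
qed

end

lemma (in smooth_idempotent) vertical_derivative:
  assumes p: "p \<in> carrier M" "r p = p" and v: "v \<in> kernel_fibre M r p"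
    and R: "smooth_map_on (tangent_bundle M) (kernel_bundle M r) M R"
  defines "X \<equiv> tangent_map_on (tangent_bundle M) (kernel_fibre M r p) M R
      (velocity (tangent_bundle M) (\<lambda>t. scale_tangent M t v))"
  shows "X \<in> tangent_vectors M" "foot X = R (zero_tangent M p)"
    and "local_expression (tangent_bundle M) (kernel_bundle M r) M R
        (tangent_domain M U) (tangent_coords \<phi>) V \<psi> Y F \<Longrightarrow> (U, \<phi>) \<in> M \<Longrightarrow> p \<in> U \<Longrightarrow>
      (\<phi> p, 0) \<in> Y \<Longrightarrow>
      tangent_coords \<psi> X = tangent_lift F ((\<phi> p, 0), (0, tangent_component \<phi> v))"
proof -
  note c = vertical_curve[OF p v]
  let ?w = "velocity (tangent_bundle M) (\<lambda>t. scale_tangent M t v)"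
  have sub: "kernel_fibre M r p \<subseteq> kernel_bundle M r" by (rule kernel_fibre_subset_bundle[of p M r, OF p])
  note R' = smooth_map_on_subset[OF R sub]
  have w: "?w \<in> tangent_on (tangent_bundle M) (kernel_fibre M r p)" by (rule velocity_mem[OF c(1)])
  have f: "foot ?w = zero_tangent M p" using foot_velocity[OF c(1)] c(2) by simp
  show "X \<in> tangent_vectors M" "foot X = R (zero_tangent M p)"
    unfolding X_def using tangent_map_on_mem(2,3)[OF TM M R' w] f by simp_all
  assume e: "local_expression (tangent_bundle M) (kernel_bundle M r) M R
      (tangent_domain M U) (tangent_coords \<phi>) V \<psi> Y F" and U: "(U, \<phi>) \<in> M" "p \<in> U" "(\<phi> p, 0) \<in> Y"
  show "tangent_coords \<psi> X = tangent_lift F ((\<phi> p, 0), (0, tangent_component \<phi> v))"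
    unfolding X_def c(3)[OF U(1,2), symmetric]
    by (rule tangent_map_on_coords[OF TM M R' w _ _ local_expression_subset[OF e sub]])
       (use f zero_tangent[OF p(1)] U in \<open>auto simp: tangent_domain_def\<close>)
qed

text \<open>The conditions of a discretization, restated for its expression \<open>F\<close> in a chart. The chart
  \<open>\<phi>\<close> can be used for both the domain and the target, since \<open>R\<close> maps the zero vector at \<open>p\<close> to \<open>p\<close>.\<close>

lemma (in smooth_idempotent) discretization_coords:
  assumes R: "kernel_discretization M r R" and p: "p \<in> carrier M" "r p = p"
  obtains U \<phi> W \<rho> Y F where "p \<in> U" "\<phi> p \<in> W" "local_expression M (carrier M) M r U \<phi> U \<phi> W \<rho>"
    "\<forall>z\<in>W. \<rho> z \<in> W \<and> \<rho> (\<rho> z) = \<rho> z" "(\<phi> p, 0) \<in> Y"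
    "local_expression (tangent_bundle M) (kernel_bundle M r) M R
      (tangent_domain M U) (tangent_coords \<phi>) U \<phi> Y F"
    "\<forall>z\<in>W. (z, 0) \<in> Y \<longrightarrow> \<rho> z = z \<longrightarrow> F (z, 0) = z"
    "\<forall>z\<in>W. \<forall>y. (z, 0) \<in> Y \<longrightarrow> tangent_lift \<rho> (z, y) = (z, 0) \<longrightarrow>
      frechet_derivative F (at (z, 0)) (0, y) =
        y + frechet_derivative \<rho> (at z) (frechet_derivative F (at (z, 0)) (0, y))"
proof -
  have Rs: "smooth_map_on (tangent_bundle M) (kernel_bundle M r) M R"
    and R0: "\<And>p. p \<in> carrier M \<Longrightarrow> r p = p \<Longrightarrow> R (zero_tangent M p) = p"
    and R1: "\<And>p v X. p \<in> carrier M \<Longrightarrow> r p = p \<Longrightarrow> v \<in> kernel_fibre M r p \<Longrightarrow>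
      X = tangent_map_on (tangent_bundle M) (kernel_fibre M r p) M R
        (velocity (tangent_bundle M) (\<lambda>t. scale_tangent M t v)) \<Longrightarrow>
      X = add_tangent M v (tangent_map M M r X)"
    using R unfolding kernel_discretization_def Let_def by blast+
  obtain U \<phi> W \<rho> where U: "p \<in> U" "\<phi> p \<in> W" and e: "local_expression M (carrier M) M r U \<phi> U \<phi> W \<rho>"
    and W: "\<forall>z\<in>W. \<rho> z \<in> W \<and> \<rho> (\<rho> z) = \<rho> z"
    by (rule idempotent_chart[OF p])
  note e' = local_expressionD[OF e]
  have z: "zero_tangent M p \<in> kernel_bundle M r"
    using zero_in_kernel_fibre[OF p] kernel_fibre_subset_bundle[of p M r, OF p] by blast
  obtain Y F where Y: "tangent_coords \<phi> (zero_tangent M p) \<in> Y"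
    and eR: "local_expression (tangent_bundle M) (kernel_bundle M r) M R
      (tangent_domain M U) (tangent_coords \<phi>) U \<phi> Y F"
    by (rule smooth_map_on_local_expression[OF TM M Rs z mem_tangent_bundle[OF e'(1)] _ e'(1)])
       (use zero_tangent[OF p(1)] U(1) R0[OF p] in \<open>auto simp: tangent_domain_def\<close>)
  note eR' = local_expressionD[OF eR]
  have pt: "\<exists>q. q \<in> carrier M \<and> q \<in> U \<and> \<phi> q = z \<and> r q = q" if z: "z \<in> W" "\<rho> z = z" for z
  proof -
    obtain q where q: "q \<in> U" "z = \<phi> q" using e'(4) z(1) by blast
    have qc: "q \<in> carrier M" by (rule carrierI[OF e'(1) q(1)])
    have "r q \<in> U" "\<phi> (r q) = \<phi> q" using e'(6,7)[OF qc q(1)] z q(2) by auto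
    then have "r q = q" using smooth_atlasD(1)[OF M e'(1)] q(1) by (auto dest: inj_onD)
    then show ?thesis using q qc by auto
  qed
  have F0: "F (z, 0) = z" if z: "z \<in> W" "(z, 0) \<in> Y" "\<rho> z = z" for z
  proof -
    obtain q where q: "q \<in> carrier M" "q \<in> U" "\<phi> q = z" "r q = q" using pt[OF z(1,3)] by blast
    have "zero_tangent M q \<in> kernel_bundle M r"
      using zero_in_kernel_fibre[OF q(1,4)] kernel_fibre_subset_bundle[of q M r, OF q(1,4)] by blast
    then show ?thesis
      using eR'(7)[of "zero_tangent M q"] zero_tangent[OF q(1)] e'(1) q z R0[OF q(1,4)]
      by (simp add: tangent_domain_def)
  qed
  have F1: "frechet_derivative F (at (z, 0)) (0, y) =
        y + frechet_derivative \<rho> (at z) (frechet_derivative F (at (z, 0)) (0, y))"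
    if z: "z \<in> W" "(z, 0) \<in> Y" "tangent_lift \<rho> (z, y) = (z, 0)" for z y
  proof -
    have rz: "\<rho> z = z" using z(3) by (simp add: tangent_lift_def)
    obtain q where q: "q \<in> carrier M" "q \<in> U" "\<phi> q = z" "r q = q" using pt[OF z(1) rz] by blast
    obtain v where v: "v \<in> tangent_vectors M" "foot v = q" "tangent_coords \<phi> v = (z, y)"
      using tangent_vector_exists_at[OF M e'(1) q(2)] q(3) by metis
    have "v \<in> kernel_bundle M r" using kernel_bundle_coords[OF e v(1)] v z q by simp
    then have vk: "v \<in> kernel_fibre M r q" using v(2) by (simp add: kernel_bundle_iff kernel_fibre_def)
    define X where "X = tangent_map_on (tangent_bundle M) (kernel_fibre M r q) M R
        (velocity (tangent_bundle M) (\<lambda>t. scale_tangent M t v))"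
    have X: "X \<in> tangent_vectors M" "foot X = q"
      "tangent_coords \<phi> X = tangent_lift F ((z, 0), (0, y))"
      using vertical_derivative[OF q(1,4) vk Rs, folded X_def] R0[OF q(1,4)] eR e'(1) q z(2) v(3)
      by (auto simp: tangent_component_eq_snd)
    have rX: "tangent_map M M r X \<in> tangent_vectors M" "foot (tangent_map M M r X) = q"
      using tangent_map_on_mem(2,3)[OF M M r X(1)] X(2) q(4) by simp_all
    have "tangent_coords \<phi> (tangent_map M M r X) = tangent_lift \<rho> (tangent_coords \<phi> X)"
      by (rule tangent_map_on_coords[OF M M r X(1) _ _ e]) (use X q z in auto)
    then have c: "tangent_component \<phi> (tangent_map M M r X) =
        frechet_derivative \<rho> (at z) (tangent_component \<phi> X)"
      using X(2) q(3) by (simp add: tangent_lift_def tangent_coords_def)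
    obtain u where u: "u \<in> tangent_vectors M" "foot u = q"
      "tangent_coords \<phi> u = (\<phi> q, tangent_component \<phi> v + tangent_component \<phi> (tangent_map M M r X))"
      using tangent_vector_exists_at[OF M e'(1) q(2)] by metis
    have "add_tangent M v (tangent_map M M r X) = u"
      by (rule add_tangent_eqI[OF M v(1) rX(1) _ e'(1)])
         (use rX v u q in \<open>auto simp: tangent_component_eq_snd\<close>)
    then have "X = u" using R1[OF q(1,4) vk X_def] by simp
    then have "tangent_component \<phi> X = tangent_component \<phi> v + tangent_component \<phi> (tangent_map M M r X)"
      using u(3) by (simp add: tangent_component_eq_snd)
    then show ?thesis using c X(3) v(3) by (simp add: tangent_component_eq_snd tangent_lift_def)
  qed
  show ?thesis
    by (rule that[OF U e W _ eR]) (use Y zero_tangent(3)[OF p(1) e'(1) U(1)] F0 F1 in auto)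
qed

text \<open>At each fixed point \<open>w\<close> of \<open>r'\<close>, the two conditions are checked in the coordinates induced by a
  chart around the foot of \<open>w\<close>, where they are the conclusions of \<open>discretization_calculus\<close>.\<close>

theorem (in tangent_idempotent) kernel_discretization_tangent:
  assumes R: "kernel_discretization M r R"
  shows "kernel_discretization (tangent_bundle M) r' (tangent_discretization R)"
proof -
  have Rs: "smooth_map_on (tangent_bundle M) (kernel_bundle M r) M R"
    using R by (simp add: kernel_discretization_def)
  note Ts = smooth_tangent_discretization[OF Rs]
  have "tangent_discretization R (zero_tangent (tangent_bundle M) w) = w \<and>
    (\<forall>\<xi>\<in>kernel_fibre (tangent_bundle M) r' w.
      let X = tangent_map_on (tangent_bundle (tangent_bundle M)) (kernel_fibre (tangent_bundle M) r' w)
        (tangent_bundle M) (tangent_discretization R)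
        (velocity (tangent_bundle (tangent_bundle M)) (\<lambda>t. scale_tangent (tangent_bundle M) t \<xi>))
      in X = add_tangent (tangent_bundle M) \<xi> (tangent_map (tangent_bundle M) (tangent_bundle M) r' X))"
    if w: "w \<in> carrier (tangent_bundle M)" "r' w = w" for w
  proof -
    have wT: "w \<in> tangent_vectors M" using w(1) by (simp add: carrier_tangent_bundle)
    note p = foot_foot_fixed[OF wT w(2)]
    obtain U \<phi> W \<rho> Y F where U: "foot w \<in> U" "\<phi> (foot w) \<in> W"
      and e: "local_expression M (carrier M) M r U \<phi> U \<phi> W \<rho>"
      and W': "\<forall>z\<in>W. \<rho> z \<in> W \<and> \<rho> (\<rho> z) = \<rho> z" and Y: "(\<phi> (foot w), 0) \<in> Y"
      and eR: "local_expression (tangent_bundle M) (kernel_bundle M r) M R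
        (tangent_domain M U) (tangent_coords \<phi>) U \<phi> Y F"
      and F0: "\<forall>z\<in>W. (z, 0) \<in> Y \<longrightarrow> \<rho> z = z \<longrightarrow> F (z, 0) = z"
      and F1: "\<forall>z\<in>W. \<forall>y. (z, 0) \<in> Y \<longrightarrow> tangent_lift \<rho> (z, y) = (z, 0) \<longrightarrow>
        frechet_derivative F (at (z, 0)) (0, y) =
          y + frechet_derivative \<rho> (at z) (frechet_derivative F (at (z, 0)) (0, y))"
      by (rule discretization_coords[OF R p])
    note e' = local_expressionD[OF e] and eR' = local_expressionD[OF eR]
    have wU: "w \<in> tangent_domain M U" using wT U(1) by (simp add: tangent_domain_def)
    obtain x v where xv: "tangent_coords \<phi> w = (x, v)" by (metis surj_pair)
    have x: "x = \<phi> (foot w)" using xv by (simp add: tangent_coords_def)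
    have xW: "x \<in> W" "(x, 0) \<in> Y" using x U(2) Y by simp_all
    let ?T = "\<lambda>z. tangent_lift F (flip z)"
    note cT = mem_tangent_bundle[OF e'(1)]
    note eT = tangent_discretization_local_expression[OF Rs eR e'(1)]
    have Y': "(tangent_coords \<phi> w, 0) \<in> flip -` (Y \<times> UNIV)"
      using xv xW by (simp add: zero_prod_def)
    have calc: "?T ((x, v), 0) = (x, v)"
      "frechet_derivative ?T (at ((x, v), 0)) (0, h) =
        h + frechet_derivative (tangent_lift \<rho>) (at (x, v)) (frechet_derivative ?T (at ((x, v), 0)) (0, h))"
      if \<xi>: "\<xi> \<in> kernel_fibre (tangent_bundle M) r' w" "h = tangent_component (tangent_coords \<phi>) \<xi>" for \<xi> h
    proof -
      obtain x' v' where h: "h = (x', v')" by (cases h)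
      have f: "foot \<xi> = w" and k: "\<xi> \<in> kernel_bundle (tangent_bundle M) r'"
        using \<xi>(1) w(2) by (auto simp: kernel_bundle_iff kernel_fibre_def)
      have "tangent_coords (tangent_coords \<phi>) \<xi> = ((x, v), (x', v'))"
        using f xv h \<xi>(2) by (simp add: tangent_coords_def[of "tangent_coords \<phi>"])
      then have t: "tangent_lift (tangent_lift \<rho>) ((x, v), (x', v')) = ((x, v), 0)"
        using kernel_bundle_coords2[OF e k] f U xv by simp
      note d = discretization_calculus[OF e'(3,5) _ _ eR'(3,5) _ _ xW t]
      show "?T ((x, v), 0) = (x, v)"
        using d(1) W' F0 F1 by (simp add: zero_prod_def)
      show "frechet_derivative ?T (at ((x, v), 0)) (0, h) = h +
          frechet_derivative (tangent_lift \<rho>) (at (x, v)) (frechet_derivative ?T (at ((x, v), 0)) (0, h))"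
        unfolding h by (rule d(2)) (use W' F0 F1 in auto)
    qed
    have z: "zero_tangent (tangent_bundle M) w \<in> kernel_fibre (tangent_bundle M) r' w"
      by (rule tangent.zero_in_kernel_fibre[OF w])
    note zc = zero_tangent[OF w(1)]
    have zk: "zero_tangent (tangent_bundle M) w \<in> kernel_bundle (tangent_bundle M) r'"
      using z w(2) by (auto simp: kernel_bundle_iff kernel_fibre_def)
    have zU: "zero_tangent (tangent_bundle M) w \<in> tangent_domain (tangent_bundle M) (tangent_domain M U)"
      using zc(1,2) wU by (simp add: tangent_domain_def[of "tangent_bundle M"])
    have zY: "tangent_coords (tangent_coords \<phi>) (zero_tangent (tangent_bundle M) w) \<in> flip -` (Y \<times> UNIV)"
      using zc(3)[OF cT wU] Y' by simp
    have T0: "tangent_discretization R (zero_tangent (tangent_bundle M) w) = w"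
    proof (rule tangent_ext[OF M _ wT e'(1)])
      show "tangent_discretization R (zero_tangent (tangent_bundle M) w) \<in> tangent_vectors M"
        "foot (tangent_discretization R (zero_tangent (tangent_bundle M) w)) \<in> U"
        using local_expressionD(6)[OF eT zk zU zY] by (auto simp: tangent_domain_def)
      show "tangent_coords \<phi> (tangent_discretization R (zero_tangent (tangent_bundle M) w)) =
          tangent_coords \<phi> w"
        using local_expressionD(7)[OF eT zk zU zY] calc(1)[OF z refl] zc(3)[OF cT wU] xv by simp
    qed (use U in simp)
    have "X = add_tangent (tangent_bundle M) \<xi> (tangent_map (tangent_bundle M) (tangent_bundle M) r' X)"
      if \<xi>: "\<xi> \<in> kernel_fibre (tangent_bundle M) r' w"
        and X_def: "X = tangent_map_on (tangent_bundle (tangent_bundle M))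
          (kernel_fibre (tangent_bundle M) r' w) (tangent_bundle M) (tangent_discretization R)
          (velocity (tangent_bundle (tangent_bundle M)) (\<lambda>t. scale_tangent (tangent_bundle M) t \<xi>))"
      for \<xi> X
    proof -
      let ?h = "tangent_component (tangent_coords \<phi>) \<xi>"
      have \<xi>': "\<xi> \<in> tangent_vectors (tangent_bundle M)" "foot \<xi> = w"
        using \<xi> by (auto simp: kernel_fibre_def)
      note vd = tangent.vertical_derivative[OF w \<xi> Ts, folded X_def]
      have X: "X \<in> tangent_vectors (tangent_bundle M)" "foot X = w" using vd(1,2) T0 by simp_all
      have "tangent_coords (tangent_coords \<phi>) X = tangent_lift ?T ((tangent_coords \<phi> w, 0), (0, ?h))"
        by (rule vd(3)[OF eT cT wU Y'])
      then have Xh: "tangent_component (tangent_coords \<phi>) X =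
          frechet_derivative ?T (at ((x, v), 0)) (0, ?h)"
        by (simp add: tangent_component_eq_snd[of "tangent_coords \<phi>" X] tangent_lift_def[of ?T] xv)
      have rX: "tangent_map (tangent_bundle M) (tangent_bundle M) r' X \<in> tangent_vectors (tangent_bundle M)"
        "foot (tangent_map (tangent_bundle M) (tangent_bundle M) r' X) = w"
        using tangent_map_on_mem(2,3)[OF TM TM tangent.r X(1)] X(2) w(2) by simp_all
      have "tangent_coords (tangent_coords \<phi>) (tangent_map (tangent_bundle M) (tangent_bundle M) r' X) =
          tangent_lift (tangent_lift \<rho>) (tangent_coords (tangent_coords \<phi>) X)"
        by (rule tangent_map_on_coords[OF TM TM tangent.r X(1) _ _ tangent_local_expression[OF e]])
           (use X(2) wU xv xW in auto)
      then have "tangent_component (tangent_coords \<phi>) (tangent_map (tangent_bundle M) (tangent_bundle M) r' X)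
          = frechet_derivative (tangent_lift \<rho>) (at (x, v)) (tangent_component (tangent_coords \<phi>) X)"
        using X(2) xv
        by (simp add: tangent_coords_def[of "tangent_coords \<phi>"] tangent_lift_def[of "tangent_lift \<rho>"])
      then have "add_tangent (tangent_bundle M) \<xi>
          (tangent_map (tangent_bundle M) (tangent_bundle M) r' X) = X"
        by (intro add_tangent_eqI[OF TM \<xi>'(1) rX(1) _ cT _ X(1)])
           (use \<xi>'(2) rX(2) X(2) wU Xh calc(2)[OF \<xi> refl] in simp_all)
      then show ?thesis by simp
    qed
    then show ?thesis using T0 unfolding Let_def by blast
  qed
  then show ?thesis unfolding kernel_discretization_def using Ts by blast
qed

section \<open>Lie groupoids\<close>

text \<open>The data from which the idempotent \<open>\<epsilon> \<circ> \<alpha>\<close> is built. The tangent groupoid inherits them by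
  functoriality.\<close>

locale source_section =
  fixes G :: "('q, 'm::fd_inner, 'g, 'n::fd_inner) groupoid"
  assumes base: "smooth_atlas (base G)" and arrows: "smooth_atlas (arrows G)"
    and src: "smooth_map (arrows G) (base G) (src G)"
    and ident: "smooth_map (base G) (arrows G) (ident G)"
    and src_ident: "q \<in> carrier (base G) \<Longrightarrow> src G (ident G q) = q"
begin

abbreviation unit :: "'g \<Rightarrow> 'g" where
  "unit \<equiv> \<lambda>g. ident G (src G g)"

lemma src_carrier: "src G ` carrier (arrows G) \<subseteq> carrier (base G)"
  and ident_carrier: "ident G ` carrier (base G) \<subseteq> carrier (arrows G)"
  using smooth_map_on_carrier(1)[OF src] smooth_map_on_carrier(1)[OF ident] by blast+

sublocale smooth_idempotent "arrows G" unit
proof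
  show "smooth_atlas (arrows G)" by (rule arrows)
  show "smooth_map (arrows G) (arrows G) unit"
    by (rule smooth_map_on_compose[OF arrows base src ident src_carrier])
  show "unit (unit p) = unit p" if "p \<in> carrier (arrows G)" for p
    using src_ident[of "src G p"] src_carrier that by auto
qed

lemma tangent_unit:
  assumes "v \<in> tangent_vectors (arrows G)"
  shows "tangent_map (base G) (arrows G) (ident G) (tangent_map (arrows G) (base G) (src G) v) =
    tangent_map (arrows G) (arrows G) unit v"
  by (rule tangent_map_on_compose[OF arrows base arrows src ident src_carrier assms])

lemma unit_fixed_iff:
  "p \<in> carrier (arrows G) \<and> unit p = p \<longleftrightarrow> (\<exists>q\<in>carrier (base G). p = ident G q)"
  using src_carrier ident_carrier src_ident by (metis image_subset_iff)

text \<open>The tangent map of \<open>\<epsilon>\<close> has the left inverse \<open>T\<alpha>\<close>, so \<open>T\<alpha> v\<close> vanishes iff \<open>T\<epsilon> (T\<alpha> v)\<close> does.\<close>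

lemma algebroid_fibre_eq:
  assumes q: "q \<in> carrier (base G)"
  shows "algebroid_fibre G q = kernel_fibre (arrows G) unit (ident G q)"
proof -
  have "tangent_map (arrows G) (base G) (src G) v = zero_tangent (base G) q \<longleftrightarrow>
      tangent_map (arrows G) (arrows G) unit v = zero_tangent (arrows G) (ident G q)" (is "?l \<longleftrightarrow> ?r")
    if v: "v \<in> tangent_vectors (arrows G)" for v
  proof
    assume ?l
    then show ?r using tangent_unit[OF v] tangent_map_zero[OF base arrows ident q] by simp
  next
    assume ?r
    let ?u = "tangent_map (arrows G) (base G) (src G) v"
    have u: "?u \<in> tangent_vectors (base G)" using tangent_map_on_mem(3)[OF arrows base src v] .
    have "?u = tangent_map (base G) (base G) (\<lambda>q. src G (ident G q)) ?u"
      by (rule tangent_map_on_ident[OF base src_ident u, symmetric])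
    also have "\<dots> = tangent_map (arrows G) (base G) (src G) (tangent_map (base G) (arrows G) (ident G) ?u)"
      by (rule tangent_map_on_compose[OF base arrows base ident src ident_carrier u, symmetric])
    also have "\<dots> = tangent_map (arrows G) (base G) (src G) (zero_tangent (arrows G) (ident G q))"
      using tangent_unit[OF v] \<open>?r\<close> by simp
    also have "\<dots> = zero_tangent (base G) q"
      using tangent_map_zero[OF arrows base src, of "ident G q"] ident_carrier q src_ident[OF q] by auto
    finally show ?l .
  qed
  then show ?thesis by (auto simp: algebroid_fibre_def kernel_fibre_def)
qed

lemma algebroid_eq: "algebroid G = kernel_bundle (arrows G) unit"
proof -
  have "kernel_bundle (arrows G) unit = (\<Union>p\<in>{p. \<exists>q\<in>carrier (base G). p = ident G q}. kernel_fibre (arrows G) unit p)"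
    unfolding kernel_bundle_def unit_fixed_iff ..
  also have "\<dots> = (\<Union>q\<in>carrier (base G). kernel_fibre (arrows G) unit (ident G q))" by blast
  finally show ?thesis by (simp add: algebroid_def algebroid_fibre_eq)
qed

lemma generalized_discretization_map_iff:
  "generalized_discretization_map G R \<longleftrightarrow> kernel_discretization (arrows G) unit R"
proof (cases "smooth_map_on (tangent_bundle (arrows G)) (kernel_bundle (arrows G) unit) (arrows G) R")
  case False
  then show ?thesis
    by (simp add: generalized_discretization_map_def kernel_discretization_def algebroid_eq)
next
  case Rs: True
  have all: "(\<forall>p\<in>carrier (arrows G). unit p = p \<longrightarrow> P p) \<longleftrightarrow> (\<forall>q\<in>carrier (base G). P (ident G q))" for P
    using unit_fixed_iff by metis
  have X: "tangent_map (base G) (arrows G) (ident G) (tangent_map (arrows G) (base G) (src G) X) =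
      tangent_map (arrows G) (arrows G) unit X"
    if "q \<in> carrier (base G)" "v \<in> kernel_fibre (arrows G) unit (ident G q)"
      "X = tangent_map_on (tangent_bundle (arrows G)) (kernel_fibre (arrows G) unit (ident G q)) (arrows G) R
         (velocity (tangent_bundle (arrows G)) (\<lambda>t. scale_tangent (arrows G) t v))" for q v X
    using vertical_derivative(1)[OF _ _ that(2) Rs] that unit_fixed_iff[of "ident G q"]
    by (intro tangent_unit) blast
  show ?thesis
    unfolding generalized_discretization_map_def kernel_discretization_def all algebroid_eq
      algebroid_zero_def vertical_lift_def Let_def
    using X by (simp add: algebroid_fibre_eq cong: ball_cong)
qed

end

lemma (in lie_groupoid) source_section: "source_section G"
proof
  show "smooth_atlas (base G)" "smooth_atlas (arrows G)"
    using base_manifold arrows_manifold smooth_manifold_imp_smooth_atlas by blast+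
  show "smooth_map (arrows G) (base G) (src G)" using src_submersion by (simp add: submersion_def)
qed (fact ident_smooth src_ident)+

lemma (in source_section) source_section_tangent: "source_section (tangent_groupoid G)"
proof
  show "smooth_atlas (base (tangent_groupoid G))" "smooth_atlas (arrows (tangent_groupoid G))"
    using smooth_atlas_tangent_bundle base arrows by (simp_all add: tangent_groupoid_def)
  show "smooth_map (arrows (tangent_groupoid G)) (base (tangent_groupoid G)) (src (tangent_groupoid G))"
    using smooth_map_on_tangent_map[OF arrows base src]
    by (simp add: tangent_groupoid_def carrier_tangent_bundle)
  show "smooth_map (base (tangent_groupoid G)) (arrows (tangent_groupoid G)) (ident (tangent_groupoid G))"
    using smooth_map_on_tangent_map[OF base arrows ident]
    by (simp add: tangent_groupoid_def carrier_tangent_bundle)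
  fix w assume "w \<in> carrier (base (tangent_groupoid G))"
  then have w: "w \<in> tangent_vectors (base G)" by (simp add: tangent_groupoid_def carrier_tangent_bundle)
  show "src (tangent_groupoid G) (ident (tangent_groupoid G) w) = w"
    using tangent_map_on_compose[OF base arrows base ident src ident_carrier w]
      tangent_map_on_ident[OF base src_ident w] by (simp add: tangent_groupoid_def)
qed

theorem theorem5p3:
  fixes G :: "('q, 'm::fd_inner, 'g, 'n::fd_inner) groupoid"
    and \<R> :: "'g tangent \<Rightarrow> 'g"
  assumes "lie_groupoid G"
    and "generalized_discretization_map G \<R>"
  shows "generalized_discretization_map (tangent_groupoid G)
           (via_canonical_iso G (algebroid_tangent_map G \<R>))"
proof -
  interpret G: source_section G by (rule lie_groupoid.source_section[OF assms(1)])
  interpret TG: source_section "tangent_groupoid G" by (rule G.source_section_tangent)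
  have a: "arrows (tangent_groupoid G) = tangent_bundle (arrows G)" by (simp add: tangent_groupoid_def)
  interpret tangent_idempotent "arrows G" G.unit TG.unit
    by unfold_locales (simp add: tangent_groupoid_def G.tangent_unit)
  have "via_canonical_iso G (algebroid_tangent_map G \<R>) = tangent_discretization \<R>"
    by (simp add: via_canonical_iso_def tangent_discretization_def G.algebroid_eq)
  then show ?thesis
    using kernel_discretization_tangent assms(2)
    by (simp add: G.generalized_discretization_map_iff TG.generalized_discretization_map_iff a)
qed

end
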